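(* Let $k\in l_2(X)$ with $\check k\in L^\infty(G)$ and $|\check k|=1$ a.e. on $G$. Then: (i) $W_k$ is left invertible on $l_2(X_+)$ if and only if $\operatorname{dist}_{L^\infty}(\check k,H^\infty(G))<1$, and $W_k$ is right invertible if and only if $\operatorname{dist}_{L^\infty}(\overline{\check k},H^\infty(G))<1$; (ii) $W_k$ is invertible on $l_2(X_+)$ if and only if there exists an invertible element $\psi$ of $H^\infty(G)$ with $\|\check k-\psi\|_{L^\infty(G)}<1$.
   Context: $X$ is a discrete linearly ordered abelian group with positive cone $X_+$; $G$ is its compact dual group with normalized Haar measure. $\check k(x)=\sum_{\xi\in X}k(\xi)\xi(x)$; $W_kg=1_{X_+}(k\ast g)$ on $l_2(X_+)$. $H^\infty(G)=\{f\in L^\infty(G):\widehat f(\chi)=0\ \forall\chi\notin X_+\}$ with the $L^\infty$ norm, where $\widehat f(\xi)=\int_Gf(x)\overline{\xi(x)}dx$; $\operatorname{dist}_{L^\infty}(f,H^\infty(G))=\inf_{h\in H^\infty(G)}\|f-h\|_{L^\infty}$. *)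

theory Defs
  imports "HOL-Probability.Probability"
begin

text \<open>X is a linearly ordered abelian group (type class linordered_ab_group_add),
  regarded as a discrete group.  Its positive cone is X_+ = {x. 0 <= x}.\<close>

definition posCone :: "'x::linordered_ab_group_add set" where
  "posCone = {x. 0 \<le> x}"

definition chars :: "('x::linordered_ab_group_add \<Rightarrow> complex) set" where
  "chars = {\<gamma>. (\<forall>a b. \<gamma> (a + b) = \<gamma> a * \<gamma> b) \<and> (\<forall>a. cmod (\<gamma> a) = 1)}"

text \<open>Normalized Haar measure on G: a translation-invariant probability measure on G,
  with the sigma-algebra generated by the evaluation maps (the trace of the product
  sigma-algebra, i.e. the Baire sets of the compact group G).\<close>
definition haar :: "('x::linordered_ab_group_add \<Rightarrow> complex) measure \<Rightarrow> bool" where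
  "haar \<mu> \<longleftrightarrow> prob_space \<mu> \<and> space \<mu> = chars \<and>
     sets \<mu> = sets (restrict_space (Pi\<^sub>M UNIV (\<lambda>_. (borel :: complex measure))) chars) \<and>
     (\<forall>c\<in>chars. distr \<mu> \<mu> (\<lambda>\<gamma> x. c x * \<gamma> x) = \<mu>)"

definition l2space :: "'x set \<Rightarrow> ('x \<Rightarrow> complex) set" where
  "l2space A = {g. (\<lambda>x. (cmod (g x))\<^sup>2) summable_on UNIV \<and> (\<forall>x. x \<notin> A \<longrightarrow> g x = 0)}"

definition l2norm :: "('x \<Rightarrow> complex) \<Rightarrow> real" where
  "l2norm g = sqrt (infsum (\<lambda>x. (cmod (g x))\<^sup>2) UNIV)"

definition conv :: "('x::ab_group_add \<Rightarrow> complex) \<Rightarrow> ('x \<Rightarrow> complex) \<Rightarrow> 'x \<Rightarrow> complex" where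
  "conv k g x = infsum (\<lambda>\<xi>. k \<xi> * g (x - \<xi>)) UNIV"

definition wienerHopf :: "('x::linordered_ab_group_add \<Rightarrow> complex) \<Rightarrow> ('x \<Rightarrow> complex) \<Rightarrow> 'x \<Rightarrow> complex" where
  "wienerHopf k g = (\<lambda>x. if x \<in> posCone then conv k g x else 0)"

definition bounded_op :: "'x set \<Rightarrow> (('x \<Rightarrow> complex) \<Rightarrow> ('x \<Rightarrow> complex)) \<Rightarrow> bool" where
  "bounded_op A T \<longleftrightarrow> (\<forall>g\<in>l2space A. T g \<in> l2space A) \<and>
     (\<forall>g\<in>l2space A. \<forall>h\<in>l2space A. \<forall>c. T (\<lambda>x. c * g x + h x) = (\<lambda>x. c * T g x + T h x)) \<and>
     (\<exists>C. \<forall>g\<in>l2space A. l2norm (T g) \<le> C * l2norm g)"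

definition left_invertible_op :: "'x set \<Rightarrow> (('x \<Rightarrow> complex) \<Rightarrow> ('x \<Rightarrow> complex)) \<Rightarrow> bool" where
  "left_invertible_op A T \<longleftrightarrow> bounded_op A T \<and>
     (\<exists>L. bounded_op A L \<and> (\<forall>g\<in>l2space A. L (T g) = g))"

definition right_invertible_op :: "'x set \<Rightarrow> (('x \<Rightarrow> complex) \<Rightarrow> ('x \<Rightarrow> complex)) \<Rightarrow> bool" where
  "right_invertible_op A T \<longleftrightarrow> bounded_op A T \<and>
     (\<exists>R. bounded_op A R \<and> (\<forall>g\<in>l2space A. T (R g) = g))"

definition invertible_op :: "'x set \<Rightarrow> (('x \<Rightarrow> complex) \<Rightarrow> ('x \<Rightarrow> complex)) \<Rightarrow> bool" where
  "invertible_op A T \<longleftrightarrow> bounded_op A T \<and>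
     (\<exists>S. bounded_op A S \<and> (\<forall>g\<in>l2space A. S (T g) = g) \<and> (\<forall>g\<in>l2space A. T (S g) = g))"

definition Linf :: "('g) measure \<Rightarrow> ('g \<Rightarrow> complex) set" where
  "Linf \<mu> = {f. f \<in> borel_measurable \<mu> \<and> (\<exists>C. AE \<gamma> in \<mu>. cmod (f \<gamma>) \<le> C)}"

definition linf_norm :: "'g measure \<Rightarrow> ('g \<Rightarrow> complex) \<Rightarrow> ereal" where
  "linf_norm \<mu> f = esssup \<mu> (\<lambda>\<gamma>. ereal (cmod (f \<gamma>)))"

definition fourier :: "('x \<Rightarrow> complex) measure \<Rightarrow> (('x \<Rightarrow> complex) \<Rightarrow> complex) \<Rightarrow> 'x \<Rightarrow> complex" where
  "fourier \<mu> f \<xi> = (\<integral>\<gamma>. f \<gamma> * cnj (\<gamma> \<xi>) \<partial>\<mu>)"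

definition Hinf :: "('x::linordered_ab_group_add \<Rightarrow> complex) measure \<Rightarrow> (('x \<Rightarrow> complex) \<Rightarrow> complex) set" where
  "Hinf \<mu> = {f \<in> Linf \<mu>. \<forall>c. c \<notin> posCone \<longrightarrow> fourier \<mu> f c = 0}"

definition dist_Hinf :: "('x::linordered_ab_group_add \<Rightarrow> complex) measure \<Rightarrow> (('x \<Rightarrow> complex) \<Rightarrow> complex) \<Rightarrow> ereal" where
  "dist_Hinf \<mu> f = (INF h\<in>Hinf \<mu>. linf_norm \<mu> (\<lambda>\<gamma>. f \<gamma> - h \<gamma>))"

text \<open>f is (a representative of) k-check = sum_xi k(xi) xi, the series converging in L^2(G)
  (unconditionally, along finite subsets of X).\<close>
definition is_check :: "('x \<Rightarrow> complex) measure \<Rightarrow> ('x \<Rightarrow> complex) \<Rightarrow> (('x \<Rightarrow> complex) \<Rightarrow> complex) \<Rightarrow> bool" where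
  "is_check \<mu> k f \<longleftrightarrow> f \<in> borel_measurable \<mu> \<and> integrable \<mu> (\<lambda>\<gamma>. (cmod (f \<gamma>))\<^sup>2) \<and>
     ((\<lambda>F. \<integral>\<gamma>. (cmod (f \<gamma> - (\<Sum>\<xi>\<in>F. k \<xi> * \<gamma> \<xi>)))\<^sup>2 \<partial>\<mu>) \<longlongrightarrow> 0) (finite_subsets_at_top UNIV)"

end

theory Submission
  imports Defs
begin

text \<open>
  Under the Fourier transform, \<open>W\<^sub>k\<close> becomes the Toeplitz operator \<open>T\<^sub>\<phi> f = P (\<phi> f)\<close> on the Hardy
  space \<open>H\<^sup>2\<close>, where \<open>\<phi>\<close> is the unimodular function \<open>kc\<close>. If \<open>h \<in> H\<^sup>\<infinity>\<close> is within distance less than 1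
  of \<open>\<phi>\<close>, then \<open>cnj h \<cdot> \<phi>\<close> is within distance less than 1 of the constant 1, so its Toeplitz operator is
  invertible, and it factors through \<open>T\<^sub>\<phi>\<close>. Conversely, since \<open>\<bar>\<phi>\<bar> = 1\<close>, a lower bound for \<open>T\<^sub>\<phi>\<close>
  says that the Hankel operator \<open>H f = \<phi> f - P (\<phi> f)\<close> has norm less than 1, and Nehari's theorem
  provides \<open>h\<close>. Right invertibility is left invertibility of the adjoint, whose symbol is \<open>cnj \<phi>\<close>.

  Nehari's theorem is proved without duality: for \<open>t\<close> larger than the norm of \<open>H\<close> let \<open>p \<in> H\<^sup>2\<close> solve
  \<open>t\<^sup>2 p - H\<^sup>* H p = 1\<close>. The function \<open>t\<^sup>2 \<bar>p\<bar>\<^sup>2 - \<bar>H p\<bar>\<^sup>2\<close> has no Fourier coefficients other than the one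
  at 0, so it is a positive constant, and \<open>h = P (\<phi> p) / p\<close> satisfies \<open>\<bar>\<phi> - h\<bar> = \<bar>H p / p\<bar> \<le> t\<close>. It is
  analytic because \<open>p\<close> is outer: replacing \<open>p\<close> by its outer factor would otherwise contradict the
  minimizing property of \<open>p\<close>.
\<close>


section \<open>Characters separate points\<close>

definition nat_mult :: "nat \<Rightarrow> 'x::ab_group_add \<Rightarrow> 'x" where
  "nat_mult n x = (\<Sum>i<n. x)"

lemma nat_mult_0 [simp]: "nat_mult 0 x = 0"
  and nat_mult_Suc [simp]: "nat_mult (Suc n) x = nat_mult n x + x"
  by (simp_all add: nat_mult_def)

lemma nat_mult_add: "nat_mult (m + n) x = nat_mult m x + nat_mult n x"
  by (induction n) (simp_all add: algebra_simps)

lemma nat_mult_mult: "nat_mult (m * n) x = nat_mult n (nat_mult m x)"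
  by (induction n) (simp_all add: nat_mult_add add.commute)

lemma nat_mult_uminus: "nat_mult n (- x) = - nat_mult n x"
  by (induction n) simp_all

lemma nat_mult_pos:
  fixes x :: "'x::linordered_ab_group_add"
  assumes "x > 0" "n > 0"
  shows "nat_mult n x > 0"
  using assms(2)
proof (induction n rule: nat_induct_non_zero)
  case (Suc n)
  then show ?case using assms(1) by (simp add: add_pos_pos)
qed (simp add: assms(1))

lemma nat_mult_eq_0_iff:
  fixes x :: "'x::linordered_ab_group_add"
  assumes "x \<noteq> 0"
  shows "nat_mult n x = 0 \<longleftrightarrow> n = 0"
proof
  assume zero: "nat_mult n x = 0"
  show "n = 0"
  proof (rule ccontr)
    assume "n \<noteq> 0"
    then have pos: "nat_mult n y > 0" if "y > 0" for y :: 'x using nat_mult_pos[OF that] by simp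
    from assms consider "x > 0" | "- x > 0" by (auto simp: neq_iff)
    then show False using pos[of x] pos[of "- x"] zero by cases (simp_all add: nat_mult_uminus)
  qed
qed simp

text \<open>A partial character is the graph of a character of a subgroup.\<close>

definition partial_char :: "('x::ab_group_add \<times> complex) set \<Rightarrow> bool" where
  "partial_char R \<longleftrightarrow> (0, 1) \<in> R \<and>
     (\<forall>a w b u. (a, w) \<in> R \<longrightarrow> (b, u) \<in> R \<longrightarrow> (a - b, w / u) \<in> R) \<and>
     (\<forall>w. (0, w) \<in> R \<longrightarrow> w = 1) \<and> (\<forall>a w. (a, w) \<in> R \<longrightarrow> cmod w = 1)"

lemma partial_char_0: "partial_char R \<Longrightarrow> (0, 1) \<in> R"
  and partial_char_diff: "partial_char R \<Longrightarrow> (a, w) \<in> R \<Longrightarrow> (b, u) \<in> R \<Longrightarrow> (a - b, w / u) \<in> R"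
  and partial_char_at_0: "partial_char R \<Longrightarrow> (0, w) \<in> R \<Longrightarrow> w = 1"
  and partial_char_norm: "partial_char R \<Longrightarrow> (a, w) \<in> R \<Longrightarrow> cmod w = 1"
  unfolding partial_char_def by blast+

lemma partial_char_uminus: "partial_char R \<Longrightarrow> (b, u) \<in> R \<Longrightarrow> (- b, 1 / u) \<in> R"
  using partial_char_diff[of R 0 1 b u] partial_char_0[of R] by simp

lemma partial_char_add: "partial_char R \<Longrightarrow> (a, w) \<in> R \<Longrightarrow> (b, u) \<in> R \<Longrightarrow> (a + b, w * u) \<in> R"
  using partial_char_diff[of R a w "- b" "1 / u"] partial_char_uminus[of R b u] by simp

lemma partial_char_unique:
  assumes "partial_char R" "(a, w) \<in> R" "(a, u) \<in> R"
  shows "w = u"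
proof -
  have "(0, w / u) \<in> R" using partial_char_diff[OF assms] by simp
  then have "w / u = 1" by (rule partial_char_at_0[OF assms(1)])
  then show ?thesis by (cases "u = 0") auto
qed

lemma partial_char_nat_mult: "partial_char R \<Longrightarrow> (a, w) \<in> R \<Longrightarrow> (nat_mult n a, w ^ n) \<in> R"
  by (induction n) (auto simp: partial_char_0 partial_char_add power_Suc2 simp del: power_Suc)

lemma partial_char_chain_Union:
  assumes "C \<noteq> {}" and chain: "subset.chain (Collect partial_char) C"
  shows "partial_char (\<Union>C)"
  unfolding partial_char_def
proof (intro conjI allI impI)
  have C: "partial_char R" if "R \<in> C" for R using chain that by (auto simp: subset.chain_def)
  show "(0, 1) \<in> \<Union>C" using assms(1) C partial_char_0 by blast
  fix a w b u assume "(a, w) \<in> \<Union>C" "(b, u) \<in> \<Union>C"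
  then obtain R R' where R: "R \<in> C" "(a, w) \<in> R" "R' \<in> C" "(b, u) \<in> R'" by auto
  moreover have "R \<subseteq> R' \<or> R' \<subseteq> R" using chain R by (meson subset_chain_def)
  ultimately obtain S where "S \<in> C" "(a, w) \<in> S" "(b, u) \<in> S" by blast
  then show "(a - b, w / u) \<in> \<Union>C" using partial_char_diff C by blast
next
  fix w assume "(0, w) \<in> \<Union>C"
  then show "w = 1" using chain partial_char_at_0 by (auto simp: subset.chain_def)
next
  fix a w assume "(a, w) \<in> \<Union>C"
  then show "cmod w = 1" using chain partial_char_norm by (auto simp: subset.chain_def)
qed

definition compatible_value :: "('x::ab_group_add \<times> complex) set \<Rightarrow> 'x \<Rightarrow> complex \<Rightarrow> bool" where
  "compatible_value R x z \<longleftrightarrow> cmod z = 1 \<and> (\<forall>n w. (nat_mult n x, w) \<in> R \<longrightarrow> w = z ^ n)"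

lemma compatible_value_exists:
  assumes R: "partial_char R"
  obtains z where "compatible_value R x z"
proof (cases "\<exists>d>0. nat_mult d x \<in> Domain R")
  case False
  have "w = 1" if "(nat_mult n x, w) \<in> R" for n w
  proof -
    have "n = 0" using False that by auto
    then show ?thesis using that partial_char_at_0[OF R] by simp
  qed
  then show ?thesis by (intro that[of 1]) (simp add: compatible_value_def)
next
  case True
  define d where "d = (LEAST d. d > 0 \<and> nat_mult d x \<in> Domain R)"
  have d: "d > 0" "nat_mult d x \<in> Domain R"
    using LeastI_ex[OF True] unfolding d_def by auto
  have least: "r = 0" if "r < d" "nat_mult r x \<in> Domain R" for r
    using not_less_Least[of r "\<lambda>d. d > 0 \<and> nat_mult d x \<in> Domain R"] that unfolding d_def by auto
  obtain w\<^sub>d where wd: "(nat_mult d x, w\<^sub>d) \<in> R" using d(2) by (rule DomainE)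
  obtain z where z: "z ^ d = w\<^sub>d"
    using exists_complex_root[of d w\<^sub>d] d(1) by auto
  have "w = z ^ n" if nw: "(nat_mult n x, w) \<in> R" for n w
  proof -
    define q r where "q = n div d" and "r = n mod d"
    have n: "n = d * q + r" by (simp add: q_def r_def)
    have dq: "(nat_mult (d * q) x, w\<^sub>d ^ q) \<in> R"
      unfolding nat_mult_mult by (rule partial_char_nat_mult[OF R wd])
    then have "(nat_mult r x, w / w\<^sub>d ^ q) \<in> R"
      using partial_char_diff[OF R nw dq] by (simp add: n nat_mult_add)
    then have "r = 0" using least[of r] d(1) by (auto simp: r_def)
    then show ?thesis using partial_char_unique[OF R nw, of "w\<^sub>d ^ q"] dq z n
      by (simp add: power_mult)
  qed
  moreover have "cmod z = 1"
  proof -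
    have "cmod z ^ d = 1 ^ d" using z partial_char_norm[OF R wd] by (simp flip: norm_power)
    then show ?thesis using d(1) by (intro power_eq_imp_eq_base[of _ d 1]) auto
  qed
  ultimately show ?thesis using that[of z] by (simp add: compatible_value_def)
qed

definition adjoin_value ::
  "('x::ab_group_add \<times> complex) set \<Rightarrow> 'x \<Rightarrow> complex \<Rightarrow> ('x \<times> complex) set" where
  "adjoin_value R x z =
    {(a + nat_mult n x - nat_mult m x, w * z ^ n / z ^ m) | a w n m. (a, w) \<in> R}"

lemma adjoin_valueI: "(a, w) \<in> R \<Longrightarrow>
    (a + nat_mult n x - nat_mult m x, w * z ^ n / z ^ m) \<in> adjoin_value R x z"
  unfolding adjoin_value_def by blast

lemma adjoin_valueE:
  assumes "(b, u) \<in> adjoin_value R x z"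
  obtains a w n m where "(a, w) \<in> R" "b = a + nat_mult n x - nat_mult m x" "u = w * z ^ n / z ^ m"
  using assms unfolding adjoin_value_def by blast

lemma subset_adjoin_value: "R \<subseteq> adjoin_value R x z"
  using adjoin_valueI[of _ _ R 0 x 0 z] by auto

lemma adjoined_value_mem: "partial_char R \<Longrightarrow> (x, z) \<in> adjoin_value R x z"
  using adjoin_valueI[OF partial_char_0, of R 1 x 0 z] by simp

lemma adjoin_value_at_0:
  assumes R: "partial_char R" and z: "compatible_value R x z" and "(0, u) \<in> adjoin_value R x z"
  shows "u = 1"
proof -
  have z0: "z \<noteq> 0" and compat: "\<And>n w. (nat_mult n x, w) \<in> R \<Longrightarrow> w = z ^ n"
    using z by (auto simp: compatible_value_def)
  obtain a w n m where aw: "(a, w) \<in> R" and zero: "0 = a + nat_mult n x - nat_mult m x"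
    and u: "u = w * z ^ n / z ^ m"
    using assms(3) by (rule adjoin_valueE)
  show ?thesis
  proof (cases "n \<le> m")
    case True
    then obtain d where d: "m = d + n" by (metis le_add_diff_inverse2)
    from zero have "a = nat_mult d x" by (simp add: d nat_mult_add)
    with aw compat have "w = z ^ d" by blast
    then show ?thesis using z0 by (simp add: u d power_add)
  next
    case False
    then obtain d where d: "n = d + m" by (metis le_add_diff_inverse2 nat_le_linear)
    from zero have "nat_mult d x = - a"
      by (simp add: d nat_mult_add eq_neg_iff_add_eq_0 add.commute)
    with partial_char_uminus[OF R aw] have "1 / w = z ^ d" by (intro compat) simp
    moreover have "w \<noteq> 0" using partial_char_norm[OF R aw] by auto
    ultimately show ?thesis using z0 by (simp add: u d power_add field_simps)
  qed
qed

lemma partial_char_adjoin_value: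
  assumes R: "partial_char R" and z: "compatible_value R x z"
  shows "partial_char (adjoin_value R x z)"
  unfolding partial_char_def
proof (intro conjI allI impI)
  show "(0, 1) \<in> adjoin_value R x z" using partial_char_0[OF R] subset_adjoin_value by blast
next
  fix a w b u assume "(a, w) \<in> adjoin_value R x z" "(b, u) \<in> adjoin_value R x z"
  then obtain a' w' n m b' u' n' m' where
    a: "(a', w') \<in> R" "a = a' + nat_mult n x - nat_mult m x" "w = w' * z ^ n / z ^ m" and
    b: "(b', u') \<in> R" "b = b' + nat_mult n' x - nat_mult m' x" "u = u' * z ^ n' / z ^ m'"
    by (elim adjoin_valueE)
  have "(a' - b' + nat_mult (n + m') x - nat_mult (m + n') x,
    w' / u' * z ^ (n + m') / z ^ (m + n')) \<in> adjoin_value R x z"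
    by (rule adjoin_valueI) (rule partial_char_diff[OF R a(1) b(1)])
  also have "a' - b' + nat_mult (n + m') x - nat_mult (m + n') x = a - b"
    by (simp add: a b nat_mult_add algebra_simps)
  also have "w' / u' * z ^ (n + m') / z ^ (m + n') = w / u"
    by (simp add: a b power_add mult_ac)
  finally show "(a - b, w / u) \<in> adjoin_value R x z" .
next
  fix w assume "(0, w) \<in> adjoin_value R x z"
  then show "w = 1" by (rule adjoin_value_at_0[OF R z])
next
  fix a w assume "(a, w) \<in> adjoin_value R x z"
  then show "cmod w = 1"
    using partial_char_norm[OF R] z
    by (auto elim!: adjoin_valueE simp: compatible_value_def norm_mult norm_divide norm_power)
qed

lemma partial_char_extension:
  fixes R :: "('x::ab_group_add \<times> complex) set"
  assumes R: "partial_char R"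
  obtains c where "\<And>a b. c (a + b) = c a * c b" "\<And>a. cmod (c a) = 1" "\<And>a w. (a, w) \<in> R \<Longrightarrow> c a = w"
proof -
  have "\<exists>M\<in>{M. partial_char M \<and> R \<subseteq> M}. \<forall>M'\<in>{M. partial_char M \<and> R \<subseteq> M}. M \<subseteq> M' \<longrightarrow> M' = M"
  proof (rule subset_Zorn_nonempty)
    fix C assume C: "C \<noteq> {}" "subset.chain {M. partial_char M \<and> R \<subseteq> M} C"
    then have "partial_char (\<Union>C)" by (intro partial_char_chain_Union) (auto simp: subset.chain_def)
    moreover have "R \<subseteq> \<Union>C" using C unfolding subset.chain_def by blast
    ultimately show "\<Union>C \<in> {M. partial_char M \<and> R \<subseteq> M}" by blast
  qed (use R in blast)
  then obtain M where M: "partial_char M" "R \<subseteq> M"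
    and max: "\<And>M'. partial_char M' \<Longrightarrow> M \<subseteq> M' \<Longrightarrow> M' = M"
    by auto
  have total: "\<exists>w. (a, w) \<in> M" for a
  proof -
    obtain z where z: "compatible_value M a z" by (rule compatible_value_exists[OF M(1)])
    have "adjoin_value M a z = M" by (intro max partial_char_adjoin_value M z subset_adjoin_value)
    then show ?thesis using adjoined_value_mem[OF M(1), of a z] by auto
  qed
  define c where "c a = (THE w. (a, w) \<in> M)" for a
  have mem: "(a, c a) \<in> M" for a
    unfolding c_def by (rule theI') (use total[of a] partial_char_unique[OF M(1)] in blast)
  have c: "c a = w" if "(a, w) \<in> M" for a w using partial_char_unique[OF M(1) mem that] .
  show ?thesis
  proof (rule that)
    show "c (a + b) = c a * c b" for a b by (intro c partial_char_add[OF M(1)] mem)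
    show "cmod (c a) = 1" for a by (rule partial_char_norm[OF M(1) mem])
    show "c a = w" if "(a, w) \<in> R" for a w using that M(2) by (intro c) blast
  qed
qed

lemma chars_separate_points:
  fixes x :: "'x::linordered_ab_group_add"
  assumes "x \<noteq> 0"
  obtains c where "c \<in> chars" "c x \<noteq> 1"
proof -
  define R where "R = adjoin_value {(0::'x, 1)} x (- 1)"
  have trivial: "partial_char {(0::'x, 1)}" unfolding partial_char_def by auto
  have "compatible_value {(0, 1)} x (- 1)"
    using nat_mult_eq_0_iff[OF assms] by (auto simp: compatible_value_def)
  then have "partial_char R" unfolding R_def by (rule partial_char_adjoin_value[OF trivial])
  then obtain c
    where c: "\<And>a b. c (a + b) = c a * c b" "\<And>a. cmod (c a) = 1" "\<And>a w. (a, w) \<in> R \<Longrightarrow> c a = w"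
    using partial_char_extension by blast
  have "c x = - 1" by (rule c(3)) (simp add: R_def adjoined_value_mem[OF trivial])
  then show ?thesis using that[of c] c by (simp add: chars_def)
qed


section \<open>Square-integrable functions\<close>

definition L2 :: "'g measure \<Rightarrow> ('g \<Rightarrow> complex) set" where
  "L2 M = {f \<in> borel_measurable M. integrable M (\<lambda>x. (cmod (f x))\<^sup>2)}"

definition L2_norm :: "'g measure \<Rightarrow> ('g \<Rightarrow> complex) \<Rightarrow> real" where
  "L2_norm M f = sqrt (\<integral>x. (cmod (f x))\<^sup>2 \<partial>M)"

definition L2_inner :: "'g measure \<Rightarrow> ('g \<Rightarrow> complex) \<Rightarrow> ('g \<Rightarrow> complex) \<Rightarrow> complex" where
  "L2_inner M f g = (\<integral>x. f x * cnj (g x) \<partial>M)"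

definition L2_tendsto ::
  "'g measure \<Rightarrow> ('i \<Rightarrow> 'g \<Rightarrow> complex) \<Rightarrow> ('g \<Rightarrow> complex) \<Rightarrow> 'i filter \<Rightarrow> bool" where
  "L2_tendsto M s f F \<longleftrightarrow> ((\<lambda>i. L2_norm M (\<lambda>x. s i x - f x)) \<longlongrightarrow> 0) F"

definition L2_Cauchy :: "'g measure \<Rightarrow> (nat \<Rightarrow> 'g \<Rightarrow> complex) \<Rightarrow> bool" where
  "L2_Cauchy M s \<longleftrightarrow> (\<forall>e>0. \<exists>N. \<forall>m\<ge>N. \<forall>n\<ge>N. L2_norm M (\<lambda>x. s m x - s n x) \<le> e)"

definition L2_subspace :: "'g measure \<Rightarrow> ('g \<Rightarrow> complex) set \<Rightarrow> bool" where
  "L2_subspace M D \<longleftrightarrow> D \<subseteq> L2 M \<and> D \<noteq> {} \<and> (\<forall>d\<in>D. \<forall>e\<in>D. \<forall>c. (\<lambda>x. c * d x + e x) \<in> D)"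

lemma le_if_power2_le_mult:
  fixes a c :: real
  assumes "a\<^sup>2 \<le> c * a" "0 \<le> a" "0 \<le> c"
  shows "a \<le> c"
  using assms by (cases "a = 0") (auto simp: power2_eq_square mult_le_cancel_right)

lemma L2_subspace_mem: "L2_subspace M D \<Longrightarrow> d \<in> D \<Longrightarrow> d \<in> L2 M"
  and L2_subspace_lincomb: "L2_subspace M D \<Longrightarrow> d \<in> D \<Longrightarrow> e \<in> D \<Longrightarrow> (\<lambda>x. c * d x + e x) \<in> D"
  by (auto simp: L2_subspace_def)

lemma L2_measurable [measurable_dest]: "f \<in> L2 M \<Longrightarrow> f \<in> borel_measurable M"
  and L2_integrable_sq: "f \<in> L2 M \<Longrightarrow> integrable M (\<lambda>x. (cmod (f x))\<^sup>2)"
  by (simp_all add: L2_def)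

lemma borel_measurable_cnj [measurable (raw)]:
  "f \<in> borel_measurable M \<Longrightarrow> (\<lambda>x. cnj (f x)) \<in> borel_measurable M"
  by (rule borel_measurable_continuous_on[where f = cnj]) (auto intro: continuous_intros)

lemma L2_mult_integrable:
  assumes f: "f \<in> L2 M" and g: "g \<in> L2 M"
  shows "integrable M (\<lambda>x. f x * g x)"
proof (rule Bochner_Integration.integrable_bound)
  show "integrable M (\<lambda>x. (cmod (f x))\<^sup>2 + (cmod (g x))\<^sup>2)"
    using f g by (intro Bochner_Integration.integrable_add L2_integrable_sq)
  show "(\<lambda>x. f x * g x) \<in> borel_measurable M" using f g by (auto simp: L2_def)
  have "norm (f x * g x) \<le> norm ((cmod (f x))\<^sup>2 + (cmod (g x))\<^sup>2)" for x
  proof -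
    have "2 * cmod (f x) * cmod (g x) \<le> (cmod (f x))\<^sup>2 + (cmod (g x))\<^sup>2"
      by (rule sum_squares_bound)
    moreover have "0 \<le> cmod (f x) * cmod (g x)" by simp
    ultimately show ?thesis unfolding norm_mult real_norm_def by linarith
  qed
  then show "AE x in M. norm (f x * g x) \<le> norm ((cmod (f x))\<^sup>2 + (cmod (g x))\<^sup>2)" by simp
qed

lemma integrable_bounded_mult:
  assumes "integrable M f" "g \<in> borel_measurable M" "AE x in M. cmod (g x) \<le> C"
  shows "integrable M (\<lambda>x. f x * g x)"
proof (rule Bochner_Integration.integrable_bound)
  show "integrable M (\<lambda>x. of_real C * f x)" using assms(1) by simp
  show "(\<lambda>x. f x * g x) \<in> borel_measurable M" using assms(1,2) by measurable
  show "AE x in M. cmod (f x * g x) \<le> cmod (of_real C * f x)"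
    using assms(3)
  proof eventually_elim
    case (elim x)
    then have "cmod (f x) * cmod (g x) \<le> cmod (f x) * \<bar>C\<bar>" by (intro mult_left_mono) auto
    then show ?case by (simp add: norm_mult mult.commute)
  qed
qed

lemma L2_cnj: "f \<in> L2 M \<Longrightarrow> (\<lambda>x. cnj (f x)) \<in> L2 M"
  by (auto simp: L2_def)

lemma L2_inner_integrable: "f \<in> L2 M \<Longrightarrow> g \<in> L2 M \<Longrightarrow> integrable M (\<lambda>x. f x * cnj (g x))"
  by (intro L2_mult_integrable L2_cnj)

lemma L2_bounded_mult:
  assumes f: "f \<in> L2 M" and \<psi>: "\<psi> \<in> borel_measurable M" "AE x in M. cmod (\<psi> x) \<le> C"
  shows "(\<lambda>x. \<psi> x * f x) \<in> L2 M"
proof -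
  have "integrable M (\<lambda>x. (cmod (\<psi> x * f x))\<^sup>2)"
  proof (rule Bochner_Integration.integrable_bound)
    show "integrable M (\<lambda>x. C\<^sup>2 * (cmod (f x))\<^sup>2)" using L2_integrable_sq[OF f] by simp
    show "(\<lambda>x. (cmod (\<psi> x * f x))\<^sup>2) \<in> borel_measurable M" using f \<psi>(1) by measurable
    show "AE x in M. norm ((cmod (\<psi> x * f x))\<^sup>2) \<le> norm (C\<^sup>2 * (cmod (f x))\<^sup>2)"
      using \<psi>(2)
    proof eventually_elim
      case (elim x)
      then have "(cmod (\<psi> x))\<^sup>2 \<le> C\<^sup>2" by (intro power_mono) auto
      then show ?case by (simp add: norm_mult power_mult_distrib mult_right_mono)
    qed
  qed
  then show ?thesis using f \<psi>(1) by (auto simp: L2_def)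
qed

lemma L2_zero: "(\<lambda>x. 0) \<in> L2 M"
  by (simp add: L2_def)

lemma L2_cmult: "f \<in> L2 M \<Longrightarrow> (\<lambda>x. c * f x) \<in> L2 M"
  by (rule L2_bounded_mult[where C = "cmod c"]) auto

lemma L2_add:
  assumes "f \<in> L2 M" "g \<in> L2 M"
  shows "(\<lambda>x. f x + g x) \<in> L2 M"
proof -
  have "integrable M (\<lambda>x. (cmod (f x))\<^sup>2 + (cmod (g x))\<^sup>2 + 2 * Re (f x * cnj (g x)))"
    using assms by (intro Bochner_Integration.integrable_add L2_integrable_sq integrable_mult_right
      integrable_Re L2_inner_integrable)
  moreover have "(cmod (f x + g x))\<^sup>2
      = (cmod (f x))\<^sup>2 + (cmod (g x))\<^sup>2 + 2 * Re (f x * cnj (g x))" for x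
    unfolding cmod_power2 by (simp add: power2_eq_square algebra_simps)
  ultimately show ?thesis using assms by (auto simp: L2_def)
qed

lemma L2_diff: "f \<in> L2 M \<Longrightarrow> g \<in> L2 M \<Longrightarrow> (\<lambda>x. f x - g x) \<in> L2 M"
  using L2_add[of f M "\<lambda>x. - 1 * g x"] L2_cmult[of g M "- 1"] by simp

lemma L2_sum: "(\<And>i. i \<in> I \<Longrightarrow> f i \<in> L2 M) \<Longrightarrow> (\<lambda>x. \<Sum>i\<in>I. f i x) \<in> L2 M"
  by (induction I rule: infinite_finite_induct) (auto simp: L2_zero intro!: L2_add)

lemma L2_norm_nonneg [simp]: "0 \<le> L2_norm M f"
  by (simp add: L2_norm_def)

lemma L2_norm_zero [simp]: "L2_norm M (\<lambda>x. 0) = 0"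
  by (simp add: L2_norm_def)

lemma L2_norm_sq: "(L2_norm M f)\<^sup>2 = (\<integral>x. (cmod (f x))\<^sup>2 \<partial>M)"
  by (simp add: L2_norm_def)

lemma L2_norm_cong_AE:
  assumes "f \<in> borel_measurable M" "g \<in> borel_measurable M" "AE x in M. f x = g x"
  shows "L2_norm M f = L2_norm M g"
  unfolding L2_norm_def using assms by (auto intro!: integral_cong_AE)

lemma L2_inner_cong_AE:
  assumes "f \<in> borel_measurable M" "g \<in> borel_measurable M" "f' \<in> borel_measurable M"
    "g' \<in> borel_measurable M" "AE x in M. f x = f' x" "AE x in M. g x = g' x"
  shows "L2_inner M f g = L2_inner M f' g'"
  unfolding L2_inner_def using assms by (auto intro!: integral_cong_AE)

lemma L2_norm_eq_0_iff:
  assumes "f \<in> L2 M"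
  shows "L2_norm M f = 0 \<longleftrightarrow> (AE x in M. f x = 0)"
  unfolding L2_norm_def using integral_nonneg_eq_0_iff_AE[OF L2_integrable_sq[OF assms]] by simp

lemma L2_norm_cmult: "L2_norm M (\<lambda>x. c * f x) = cmod c * L2_norm M f"
  by (simp add: L2_norm_def norm_mult power_mult_distrib real_sqrt_mult)

lemma L2_norm_diff_commute: "L2_norm M (\<lambda>x. f x - g x) = L2_norm M (\<lambda>x. g x - f x)"
  by (simp add: L2_norm_def norm_minus_commute)

lemma L2_norm_bounded_mult:
  assumes "f \<in> L2 M" "AE x in M. cmod (\<psi> x) \<le> C" "0 \<le> C"
  shows "L2_norm M (\<lambda>x. \<psi> x * f x) \<le> C * L2_norm M f"
proof -
  have "(\<integral>x. (cmod (\<psi> x * f x))\<^sup>2 \<partial>M) \<le> (\<integral>x. C\<^sup>2 * (cmod (f x))\<^sup>2 \<partial>M)"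
  proof (rule integral_mono_AE')
    show "integrable M (\<lambda>x. C\<^sup>2 * (cmod (f x))\<^sup>2)" using L2_integrable_sq[OF assms(1)] by simp
    show "AE x in M. (cmod (\<psi> x * f x))\<^sup>2 \<le> C\<^sup>2 * (cmod (f x))\<^sup>2"
      using assms(2)
      by eventually_elim (simp add: norm_mult power_mult_distrib mult_right_mono power_mono)
  qed simp
  then have "L2_norm M (\<lambda>x. \<psi> x * f x) \<le> sqrt (C\<^sup>2 * (L2_norm M f)\<^sup>2)"
    unfolding L2_norm_sq by (simp add: L2_norm_def del: real_sqrt_power)
  then show ?thesis using assms(3) by (simp add: real_sqrt_mult)
qed

lemma nn_integral_sq_eq_L2_norm:
  assumes "f \<in> L2 M"
  shows "(\<integral>\<^sup>+x. (ennreal (cmod (f x)))\<^sup>2 \<partial>M) = ennreal ((L2_norm M f)\<^sup>2)"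
  unfolding L2_norm_sq nn_integral_eq_integral[symmetric, OF L2_integrable_sq[OF assms], simplified]
  by (simp add: ennreal_power)

lemma L2_Cauchy_Schwarz:
  assumes f: "f \<in> L2 M" and g: "g \<in> L2 M"
  shows "cmod (L2_inner M f g) \<le> L2_norm M f * L2_norm M g"
proof -
  define I where "I = (\<integral>x. cmod (f x) * cmod (g x) \<partial>M)"
  have int: "integrable M (\<lambda>x. cmod (f x) * cmod (g x))"
    using integrable_norm[OF L2_mult_integrable[OF f g]] by (simp add: norm_mult)
  have "I \<ge> 0" unfolding I_def by simp
  note [measurable] = L2_measurable[OF f] L2_measurable[OF g]
  have "(\<integral>\<^sup>+x. ennreal (cmod (f x)) * ennreal (cmod (g x)) \<partial>M)\<^sup>2 \<le>
    (\<integral>\<^sup>+x. (ennreal (cmod (f x)))\<^sup>2 \<partial>M) * (\<integral>\<^sup>+x. (ennreal (cmod (g x)))\<^sup>2 \<partial>M)"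
    by (intro Cauchy_Schwarz_nn_integral) measurable
  also have "(\<integral>\<^sup>+x. ennreal (cmod (f x)) * ennreal (cmod (g x)) \<partial>M) = ennreal I"
    unfolding I_def by (subst nn_integral_eq_integral[symmetric, OF int]) (auto simp: ennreal_mult)
  finally have "I\<^sup>2 \<le> (L2_norm M f)\<^sup>2 * (L2_norm M g)\<^sup>2"
    unfolding nn_integral_sq_eq_L2_norm[OF f] nn_integral_sq_eq_L2_norm[OF g]
    using \<open>I \<ge> 0\<close> by (simp add: ennreal_power ennreal_mult[symmetric])
  then have "I \<le> L2_norm M f * L2_norm M g"
    by (intro power2_le_imp_le[of I]) (simp_all add: power_mult_distrib)
  moreover have "cmod (L2_inner M f g) \<le> I"
    unfolding I_def L2_inner_def using integral_norm_bound[of M "\<lambda>x. f x * cnj (g x)"]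
    by (simp add: norm_mult)
  ultimately show ?thesis by linarith
qed

lemma L2_inner_self: "L2_inner M f f = of_real ((L2_norm M f)\<^sup>2)"
  unfolding L2_inner_def L2_norm_sq
  by (simp add: complex_norm_square[symmetric] flip: of_real_power)

lemma L2_inner_commute: "L2_inner M g f = cnj (L2_inner M f g)"
  unfolding L2_inner_def
  by (subst Bochner_Integration.integral_cnj[symmetric]) (simp add: mult.commute)

lemma L2_inner_eq_0_commute: "L2_inner M f g = 0 \<longleftrightarrow> L2_inner M g f = 0"
  using L2_inner_commute[of M f g] by simp

lemma L2_inner_add_left: "f \<in> L2 M \<Longrightarrow> f' \<in> L2 M \<Longrightarrow> g \<in> L2 M \<Longrightarrow>
    L2_inner M (\<lambda>x. f x + f' x) g = L2_inner M f g + L2_inner M f' g"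
  unfolding L2_inner_def
  by (simp add: ring_distribs L2_inner_integrable Bochner_Integration.integral_add)

lemma L2_inner_diff_left: "f \<in> L2 M \<Longrightarrow> f' \<in> L2 M \<Longrightarrow> g \<in> L2 M \<Longrightarrow>
    L2_inner M (\<lambda>x. f x - f' x) g = L2_inner M f g - L2_inner M f' g"
  unfolding L2_inner_def
  by (simp add: ring_distribs L2_inner_integrable Bochner_Integration.integral_diff)

lemma L2_inner_cmult_left: "L2_inner M (\<lambda>x. c * f x) g = c * L2_inner M f g"
  unfolding L2_inner_def by (simp add: mult.assoc)

lemma L2_inner_add_right: "f \<in> L2 M \<Longrightarrow> g \<in> L2 M \<Longrightarrow> g' \<in> L2 M \<Longrightarrow>
    L2_inner M f (\<lambda>x. g x + g' x) = L2_inner M f g + L2_inner M f g'"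
  unfolding L2_inner_def
  by (simp add: ring_distribs L2_inner_integrable Bochner_Integration.integral_add)

lemma L2_inner_sum_left: "(\<And>i. i \<in> I \<Longrightarrow> f i \<in> L2 M) \<Longrightarrow> g \<in> L2 M \<Longrightarrow>
    L2_inner M (\<lambda>x. \<Sum>i\<in>I. f i x) g = (\<Sum>i\<in>I. L2_inner M (f i) g)"
  unfolding L2_inner_def
  by (simp add: sum_distrib_right L2_inner_integrable Bochner_Integration.integral_sum)

lemma L2_inner_diff_right: "f \<in> L2 M \<Longrightarrow> g \<in> L2 M \<Longrightarrow> g' \<in> L2 M \<Longrightarrow>
    L2_inner M f (\<lambda>x. g x - g' x) = L2_inner M f g - L2_inner M f g'"
  unfolding L2_inner_def
  by (simp add: ring_distribs L2_inner_integrable Bochner_Integration.integral_diff)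

lemma L2_inner_cmult_right: "L2_inner M f (\<lambda>x. c * g x) = cnj c * L2_inner M f g"
  unfolding L2_inner_def by (simp add: mult.left_commute)

lemma L2_norm_add_sq:
  assumes "f \<in> L2 M" "g \<in> L2 M"
  shows "(L2_norm M (\<lambda>x. f x + g x))\<^sup>2
      = (L2_norm M f)\<^sup>2 + 2 * Re (L2_inner M f g) + (L2_norm M g)\<^sup>2"
proof -
  have "complex_of_real ((L2_norm M (\<lambda>x. f x + g x))\<^sup>2)
      = L2_inner M (\<lambda>x. f x + g x) (\<lambda>x. f x + g x)"
    by (rule L2_inner_self[symmetric])
  also have "\<dots> = L2_inner M f f + cnj (L2_inner M f g) + (L2_inner M f g + L2_inner M g g)"
    using assms
    by (simp add: L2_inner_add_left L2_inner_add_right L2_add L2_inner_commute[of M g f])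
  finally have "(L2_norm M (\<lambda>x. f x + g x))\<^sup>2 =
      Re (L2_inner M f f + cnj (L2_inner M f g) + (L2_inner M f g + L2_inner M g g))"
    by (metis Re_complex_of_real)
  then show ?thesis by (simp add: L2_inner_self)
qed

lemma L2_norm_diff_sq:
  assumes "f \<in> L2 M" "g \<in> L2 M"
  shows "(L2_norm M (\<lambda>x. f x - g x))\<^sup>2
      = (L2_norm M f)\<^sup>2 - 2 * Re (L2_inner M f g) + (L2_norm M g)\<^sup>2"
  using L2_norm_add_sq[OF assms(1) L2_cmult[OF assms(2), of "- 1"]]
  unfolding L2_inner_cmult_right L2_norm_cmult by simp

lemma L2_norm_parallelogram:
  assumes "f \<in> L2 M" "g \<in> L2 M"
  shows "(L2_norm M (\<lambda>x. f x - g x))\<^sup>2 =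
    2 * (L2_norm M f)\<^sup>2 + 2 * (L2_norm M g)\<^sup>2 - (L2_norm M (\<lambda>x. f x + g x))\<^sup>2"
  by (simp add: L2_norm_diff_sq L2_norm_add_sq assms)

lemma L2_norm_triangle:
  assumes "f \<in> L2 M" "g \<in> L2 M"
  shows "L2_norm M (\<lambda>x. f x + g x) \<le> L2_norm M f + L2_norm M g"
proof (rule power2_le_imp_le)
  have "Re (L2_inner M f g) \<le> L2_norm M f * L2_norm M g"
    using L2_Cauchy_Schwarz[OF assms] complex_Re_le_cmod order_trans by blast
  then show "(L2_norm M (\<lambda>x. f x + g x))\<^sup>2 \<le> (L2_norm M f + L2_norm M g)\<^sup>2"
    unfolding L2_norm_add_sq[OF assms] by (simp add: power2_sum)
qed simp

lemma L2_norm_diff_triangle: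
  assumes "f \<in> L2 M" "g \<in> L2 M" "h \<in> L2 M"
  shows "L2_norm M (\<lambda>x. f x - h x) \<le> L2_norm M (\<lambda>x. f x - g x) + L2_norm M (\<lambda>x. g x - h x)"
  using L2_norm_triangle[OF L2_diff[OF assms(1,2)] L2_diff[OF assms(2,3)]] by simp

lemma L2_norm_triangle_diff:
  assumes "f \<in> L2 M" "g \<in> L2 M"
  shows "L2_norm M f \<le> L2_norm M g + L2_norm M (\<lambda>x. f x - g x)"
  using L2_norm_triangle[OF assms(2) L2_diff[OF assms]] by simp

lemma L2_norm_sum:
  assumes "\<And>i. i \<in> I \<Longrightarrow> f i \<in> L2 M"
  shows "L2_norm M (\<lambda>x. \<Sum>i\<in>I. f i x) \<le> (\<Sum>i\<in>I. L2_norm M (f i))"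
  using assms
proof (induction I rule: infinite_finite_induct)
  case (insert i I)
  then have "L2_norm M (\<lambda>x. f i x + (\<Sum>i\<in>I. f i x)) \<le> L2_norm M (f i) + L2_norm M (\<lambda>x. \<Sum>i\<in>I. f i x)"
    by (intro L2_norm_triangle L2_sum) auto
  with insert show ?case by fastforce
qed auto

lemma L2_tendsto_iff_diff: "L2_tendsto M (\<lambda>i x. s i x - g x) (\<lambda>x. f x - g x) F \<longleftrightarrow> L2_tendsto M s f F"
  by (simp add: L2_tendsto_def)

lemma tendsto_L2_norm:
  assumes s: "\<And>i. s i \<in> L2 M" and f: "f \<in> L2 M" and lim: "L2_tendsto M s f F"
  shows "((\<lambda>i. L2_norm M (s i)) \<longlongrightarrow> L2_norm M f) F"
proof (rule LIM_zero_cancel, rule Lim_null_comparison)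
  have "\<bar>L2_norm M (s i) - L2_norm M f\<bar> \<le> L2_norm M (\<lambda>x. s i x - f x)" for i
    using L2_norm_triangle_diff[OF s[of i] f] L2_norm_triangle_diff[OF f s[of i]]
      L2_norm_diff_commute[of M f "s i"] by linarith
  then show "\<forall>\<^sub>F i in F. norm (L2_norm M (s i) - L2_norm M f) \<le> L2_norm M (\<lambda>x. s i x - f x)" by simp
qed (use lim in \<open>simp add: L2_tendsto_def\<close>)

lemma tendsto_L2_inner:
  assumes s: "\<And>i. s i \<in> L2 M" and f: "f \<in> L2 M" and g: "g \<in> L2 M" and lim: "L2_tendsto M s f F"
  shows "((\<lambda>i. L2_inner M (s i) g) \<longlongrightarrow> L2_inner M f g) F"
proof (rule LIM_zero_cancel, rule Lim_null_comparison)
  have "cmod (L2_inner M (s i) g - L2_inner M f g)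
      \<le> L2_norm M (\<lambda>x. s i x - f x) * L2_norm M g" for i
    using L2_Cauchy_Schwarz[OF L2_diff[OF s f] g, of i] by (simp add: L2_inner_diff_left s f g)
  then show "\<forall>\<^sub>F i in F. norm (L2_inner M (s i) g - L2_inner M f g)
      \<le> L2_norm M (\<lambda>x. s i x - f x) * L2_norm M g"
    by simp
  show "((\<lambda>i. L2_norm M (\<lambda>x. s i x - f x) * L2_norm M g) \<longlongrightarrow> 0) F"
    using tendsto_mult_right[OF lim[unfolded L2_tendsto_def], of "L2_norm M g"] by simp
qed

lemma L2_tendsto_bounded_mult:
  assumes s: "\<And>i. s i \<in> L2 M" and f: "f \<in> L2 M" and lim: "L2_tendsto M s f F"
    and \<psi>: "AE x in M. cmod (\<psi> x) \<le> C" "0 \<le> C"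
  shows "L2_tendsto M (\<lambda>i x. \<psi> x * s i x) (\<lambda>x. \<psi> x * f x) F"
  unfolding L2_tendsto_def
proof (rule Lim_null_comparison)
  have "L2_norm M (\<lambda>x. \<psi> x * s i x - \<psi> x * f x) \<le> C * L2_norm M (\<lambda>x. s i x - f x)" for i
    using L2_norm_bounded_mult[OF L2_diff[OF s f] \<psi>] by (simp add: right_diff_distrib)
  then show "\<forall>\<^sub>F i in F. norm (L2_norm M (\<lambda>x. \<psi> x * s i x - \<psi> x * f x))
      \<le> C * L2_norm M (\<lambda>x. s i x - f x)"
    by simp
  show "((\<lambda>i. C * L2_norm M (\<lambda>x. s i x - f x)) \<longlongrightarrow> 0) F"
    using tendsto_mult_left[OF lim[unfolded L2_tendsto_def], of C] by simp
qed

lemma L2_tendsto_imp_L2_Cauchy: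
  assumes s: "\<And>n. s n \<in> L2 M" and f: "f \<in> L2 M" and lim: "L2_tendsto M s f sequentially"
  shows "L2_Cauchy M s"
  unfolding L2_Cauchy_def
proof (intro allI impI)
  fix e :: real assume "e > 0"
  then have "\<forall>\<^sub>F n in sequentially. L2_norm M (\<lambda>x. s n x - f x) < e / 2"
    using lim unfolding L2_tendsto_def by (intro order_tendstoD) auto
  then obtain N where N: "\<And>n. n \<ge> N \<Longrightarrow> L2_norm M (\<lambda>x. s n x - f x) < e / 2"
    unfolding eventually_sequentially by blast
  have "L2_norm M (\<lambda>x. s m x - s n x) \<le> e" if "m \<ge> N" "n \<ge> N" for m n
    using L2_norm_diff_triangle[OF s[of m] f s[of n]] N[OF that(1)] N[OF that(2)]
      L2_norm_diff_commute[of M f "s n"] by linarith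
  then show "\<exists>N. \<forall>m\<ge>N. \<forall>n\<ge>N. L2_norm M (\<lambda>x. s m x - s n x) \<le> e" by blast
qed

lemma AE_bounded_if_L2_norm_bounded:
  assumes f: "\<And>n. f n \<in> L2 M" and mono: "\<And>n x. cmod (f n x) \<le> cmod (f (Suc n) x)"
    and bound: "\<And>n. L2_norm M (f n) \<le> B"
  shows "AE x in M. \<exists>C. \<forall>n. cmod (f n x) \<le> C"
proof -
  note [measurable] = L2_measurable[OF f]
  have "(\<integral>\<^sup>+x. (ennreal (cmod (f n x)))\<^sup>2 \<partial>M) \<le> ennreal (B\<^sup>2)" for n
    unfolding nn_integral_sq_eq_L2_norm[OF f] by (intro ennreal_leI power_mono bound) simp
  then have "(SUP n. \<integral>\<^sup>+x. (ennreal (cmod (f n x)))\<^sup>2 \<partial>M) \<le> ennreal (B\<^sup>2)" by (intro SUP_least)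
  also have "(SUP n. \<integral>\<^sup>+x. (ennreal (cmod (f n x)))\<^sup>2 \<partial>M)
      = (\<integral>\<^sup>+x. (SUP n. (ennreal (cmod (f n x)))\<^sup>2) \<partial>M)"
  proof (rule nn_integral_monotone_convergence_SUP[symmetric])
    show "incseq (\<lambda>n x. (ennreal (cmod (f n x)))\<^sup>2)"
      by (intro incseq_SucI le_funI power_mono ennreal_leI mono) auto
  qed measurable
  finally have "(\<integral>\<^sup>+x. (SUP n. (ennreal (cmod (f n x)))\<^sup>2) \<partial>M) \<noteq> \<infinity>"
    by (auto simp: top_unique)
  then have "AE x in M. (SUP n. (ennreal (cmod (f n x)))\<^sup>2) \<noteq> \<infinity>"
    by (intro nn_integral_PInf_AE) measurable
  then show ?thesis
  proof eventually_elim
    case (elim x)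
    then obtain C where C: "0 \<le> C" "(SUP n. (ennreal (cmod (f n x)))\<^sup>2) = ennreal C"
      by (cases "SUP n. (ennreal (cmod (f n x)))\<^sup>2") auto
    have "cmod (f n x) \<le> sqrt C" for n
    proof (rule real_le_rsqrt)
      have "(ennreal (cmod (f n x)))\<^sup>2 \<le> ennreal C" unfolding C(2)[symmetric]
        by (rule SUP_upper) simp
      then show "(cmod (f n x))\<^sup>2 \<le> C" using C(1) by (simp add: ennreal_power)
    qed
    then show ?case by blast
  qed
qed

lemma AE_convergent_if_summable_L2_norm_increments:
  assumes s: "\<And>n. s n \<in> L2 M" and summable: "summable (\<lambda>n. L2_norm M (\<lambda>x. s (Suc n) x - s n x))"
  shows "AE x in M. convergent (\<lambda>n. s n x)"
proof -
  define d where "d k x = complex_of_real (cmod (s (Suc k) x - s k x))" for k x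
  have d: "d k \<in> L2 M" and d_norm: "L2_norm M (d k) = L2_norm M (\<lambda>x. s (Suc k) x - s k x)" for k
    using L2_diff[OF s[of "Suc k"] s[of k]] unfolding d_def by (auto simp: L2_def L2_norm_def)
  have cmod_sum: "cmod (\<Sum>k<n. d k x) = (\<Sum>k<n. cmod (s (Suc k) x - s k x))" for n x
    unfolding d_def of_real_sum[symmetric] norm_of_real by (simp add: sum_nonneg)
  have "L2_norm M (\<lambda>x. \<Sum>k<n. d k x) \<le> (\<Sum>k. L2_norm M (d k))" for n
  proof -
    have "L2_norm M (\<lambda>x. \<Sum>k<n. d k x) \<le> (\<Sum>k<n. L2_norm M (d k))" by (intro L2_norm_sum d)
    also have "\<dots> \<le> (\<Sum>k. L2_norm M (d k))" unfolding d_norm by (intro sum_le_suminf summable) auto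
    finally show ?thesis .
  qed
  then have "AE x in M. \<exists>C. \<forall>n. cmod (\<Sum>k<n. d k x) \<le> C"
    by (rule AE_bounded_if_L2_norm_bounded[rotated 2]) (intro L2_sum d, simp only: cmod_sum, simp)
  then show ?thesis
  proof eventually_elim
    case (elim x)
    then obtain C where "\<And>n. (\<Sum>k<n. cmod (s (Suc k) x - s k x)) \<le> C" unfolding cmod_sum by blast
    then have "summable (\<lambda>k. cmod (s (Suc k) x - s k x))" by (intro summableI_nonneg_bounded) auto
    then have "summable (\<lambda>k. s (Suc k) x - s k x)" by (rule summable_norm_cancel)
    then have "convergent (\<lambda>k. s k x - s 0 x)"
      by (simp add: summable_iff_convergent sum_lessThan_telescope[of "\<lambda>k. s k x"])
    from convergent_add[OF this convergent_const[of "s 0 x"]] show ?case by simp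
  qed
qed

lemma L2_norm_AE_limit_le:
  assumes s: "\<And>n. s n \<in> L2 M" and f: "f \<in> borel_measurable M"
    and lim: "AE x in M. (\<lambda>n. s n x) \<longlonglongrightarrow> f x"
    and bound: "\<forall>\<^sub>F n in sequentially. L2_norm M (s n) \<le> e"
  shows "f \<in> L2 M" "L2_norm M f \<le> e"
proof -
  note [measurable] = f L2_measurable[OF s]
  have "0 \<le> e" using bound order_trans[OF L2_norm_nonneg] by (auto simp: eventually_sequentially)
  have "(\<integral>\<^sup>+x. (ennreal (cmod (f x)))\<^sup>2 \<partial>M) = (\<integral>\<^sup>+x. liminf (\<lambda>n. (ennreal (cmod (s n x)))\<^sup>2) \<partial>M)"
  proof (rule nn_integral_cong_AE)
    show "AE x in M. (ennreal (cmod (f x)))\<^sup>2 = liminf (\<lambda>n. (ennreal (cmod (s n x)))\<^sup>2)"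
      using lim
    proof eventually_elim
      case (elim x)
      then have "(\<lambda>n. ennreal ((cmod (s n x))\<^sup>2)) \<longlonglongrightarrow> ennreal ((cmod (f x))\<^sup>2)"
        by (intro tendsto_ennrealI tendsto_intros)
      then show ?case by (intro lim_imp_Liminf[symmetric]) (simp_all add: ennreal_power)
    qed
  qed
  also have "\<dots> \<le> liminf (\<lambda>n. \<integral>\<^sup>+x. (ennreal (cmod (s n x)))\<^sup>2 \<partial>M)"
    by (rule nn_integral_liminf) measurable
  also have "\<dots> \<le> limsup (\<lambda>n. ennreal ((L2_norm M (s n))\<^sup>2))"
    unfolding nn_integral_sq_eq_L2_norm[OF s] by (rule Liminf_le_Limsup) simp
  also have "\<dots> \<le> ennreal (e\<^sup>2)"
    using bound
    by (intro Limsup_bounded) (auto elim!: eventually_mono intro!: ennreal_leI power_mono)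
  finally have le: "(\<integral>\<^sup>+x. (ennreal (cmod (f x)))\<^sup>2 \<partial>M) \<le> ennreal (e\<^sup>2)" .
  then show fL: "f \<in> L2 M"
    unfolding L2_def
    by (auto simp: ennreal_power less_top[symmetric] top_unique intro!: integrableI_nonneg)
  have "(L2_norm M f)\<^sup>2 \<le> e\<^sup>2" using le unfolding nn_integral_sq_eq_L2_norm[OF fL] by simp
  then show "L2_norm M f \<le> e" using \<open>0 \<le> e\<close> by (rule power2_le_imp_le)
qed

lemma L2_norm_diff_le_sum_increments:
  assumes s: "\<And>n. s n \<in> L2 M" and "n \<le> m"
  shows "L2_norm M (\<lambda>x. s m x - s n x) \<le> (\<Sum>k = n..<m. L2_norm M (\<lambda>x. s (Suc k) x - s k x))"
proof -
  have "(\<lambda>x. s m x - s n x) = (\<lambda>x. \<Sum>k = n..<m. s (Suc k) x - s k x)"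
    by (rule ext) (rule sum_Suc_diff'[OF assms(2), symmetric])
  then show ?thesis using L2_norm_sum[of "{n..<m}" "\<lambda>k x. s (Suc k) x - s k x" M]
    by (simp add: L2_diff s)
qed

lemma L2_tendsto_AE_limit_if_summable_increments:
  assumes s: "\<And>n. s n \<in> L2 M" and summable: "summable (\<lambda>n. L2_norm M (\<lambda>x. s (Suc n) x - s n x))"
    and f: "f \<in> borel_measurable M" and lim: "AE x in M. (\<lambda>n. s n x) \<longlonglongrightarrow> f x" and "e > 0"
  shows "\<exists>N. \<forall>n\<ge>N. (\<lambda>x. f x - s n x) \<in> L2 M \<and> L2_norm M (\<lambda>x. f x - s n x) \<le> e"
proof -
  obtain N where N: "\<forall>n\<ge>N. \<forall>m. norm (\<Sum>k = n..<m. L2_norm M (\<lambda>x. s (Suc k) x - s k x)) < e"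
    using summable \<open>e > 0\<close> unfolding summable_Cauchy by blast
  have "(\<lambda>x. f x - s n x) \<in> L2 M \<and> L2_norm M (\<lambda>x. f x - s n x) \<le> e" if "n \<ge> N" for n
  proof -
    have "L2_norm M (\<lambda>x. s m x - s n x) \<le> e" if "m \<ge> n" for m
    proof -
      have "L2_norm M (\<lambda>x. s m x - s n x) \<le> (\<Sum>k = n..<m. L2_norm M (\<lambda>x. s (Suc k) x - s k x))"
        by (rule L2_norm_diff_le_sum_increments[OF s that])
      also have "\<dots> \<le> norm (\<Sum>k = n..<m. L2_norm M (\<lambda>x. s (Suc k) x - s k x))" by simp
      also have "\<dots> \<le> e" using N \<open>n \<ge> N\<close> less_imp_le by blast
      finally show ?thesis .
    qed
    then have bound: "\<forall>\<^sub>F m in sequentially. L2_norm M (\<lambda>x. s m x - s n x) \<le> e"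
      unfolding eventually_sequentially by blast
    have "AE x in M. (\<lambda>m. s m x - s n x) \<longlonglongrightarrow> f x - s n x"
      using lim by eventually_elim (intro tendsto_intros)
    from L2_norm_AE_limit_le[OF L2_diff[OF s s] _ this bound] show ?thesis
      using f L2_measurable[OF s] by simp
  qed
  then show ?thesis by blast
qed

lemma L2_convergent_if_summable_increments:
  assumes s: "\<And>n. s n \<in> L2 M" and summable: "summable (\<lambda>n. L2_norm M (\<lambda>x. s (Suc n) x - s n x))"
  obtains f where "f \<in> L2 M" "L2_tendsto M s f sequentially"
proof
  note [measurable] = L2_measurable[OF s]
  define f where "f x = lim (\<lambda>n. s n x)" for x
  have f: "f \<in> borel_measurable M" unfolding f_def by measurable
  have "AE x in M. (\<lambda>n. s n x) \<longlonglongrightarrow> f x"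
    using AE_convergent_if_summable_L2_norm_increments[OF assms]
    unfolding f_def by (simp add: convergent_LIMSEQ_iff)
  note tail = L2_tendsto_AE_limit_if_summable_increments[OF s summable f this]
  obtain n where "(\<lambda>x. f x - s n x) \<in> L2 M" using tail[of 1] by auto
  from L2_add[OF this s[of n]] show "f \<in> L2 M" by simp
  show "L2_tendsto M s f sequentially"
    unfolding L2_tendsto_def
  proof (rule LIMSEQ_I)
    fix e :: real assume "e > 0"
    then show "\<exists>N. \<forall>n\<ge>N. norm (L2_norm M (\<lambda>x. s n x - f x) - 0) < e"
      using tail[of "e / 2"] L2_norm_diff_commute[of M f] by fastforce
  qed
qed

theorem L2_complete:
  assumes s: "\<And>n. s n \<in> L2 M" and Cauchy: "L2_Cauchy M s"
  obtains f where "f \<in> L2 M" "L2_tendsto M s f sequentially"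
proof -
  have "\<exists>N. \<forall>k. \<forall>m\<ge>N k. \<forall>n\<ge>N k. L2_norm M (\<lambda>x. s m x - s n x) \<le> (1/2) ^ k"
    using Cauchy unfolding L2_Cauchy_def by (intro choice allI) simp
  then obtain N :: "nat \<Rightarrow> nat"
    where N: "\<And>k m n. m \<ge> N k \<Longrightarrow> n \<ge> N k \<Longrightarrow> L2_norm M (\<lambda>x. s m x - s n x) \<le> (1/2) ^ k"
    by blast
  define r where "r k = (\<Sum>i\<le>k. N i) + k" for k
  have r: "r k \<ge> N k" "r (Suc k) \<ge> r k" "r k \<ge> k" for k
    unfolding r_def by (auto intro: trans_le_add1 member_le_sum)
  have "summable (\<lambda>k. L2_norm M (\<lambda>x. s (r (Suc k)) x - s (r k) x))"
  proof (rule summable_comparison_test')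
    show "summable (\<lambda>k. (1/2::real) ^ k)" by (rule summable_geometric) simp
    show "norm (L2_norm M (\<lambda>x. s (r (Suc k)) x - s (r k) x)) \<le> (1/2) ^ k" for k
      using N[OF order_trans[OF r(1,2)] r(1), of k] by simp
  qed
  then obtain f where f: "f \<in> L2 M" and lim: "L2_tendsto M (\<lambda>k. s (r k)) f sequentially"
    by (rule L2_convergent_if_summable_increments[OF s])
  have "(\<lambda>n. L2_norm M (\<lambda>x. s n x - f x)) \<longlonglongrightarrow> 0"
  proof (rule LIMSEQ_I)
    fix e :: real assume "e > 0"
    then obtain K where K: "\<And>m n. m \<ge> K \<Longrightarrow> n \<ge> K \<Longrightarrow> L2_norm M (\<lambda>x. s m x - s n x) \<le> e / 2"
      using Cauchy unfolding L2_Cauchy_def by (meson half_gt_zero)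
    have "\<forall>\<^sub>F k in sequentially. L2_norm M (\<lambda>x. s (r k) x - f x) < e / 2"
      using lim \<open>e > 0\<close> unfolding L2_tendsto_def by (intro order_tendstoD) auto
    then obtain K' where K': "\<And>k. k \<ge> K' \<Longrightarrow> L2_norm M (\<lambda>x. s (r k) x - f x) < e / 2"
      unfolding eventually_sequentially by blast
    have "L2_norm M (\<lambda>x. s n x - f x) < e" if "n \<ge> max K K'" for n
      using L2_norm_diff_triangle[OF s[of n] s[of "r n"] f] K[of n "r n"] K'[of n] r(3)[of n] that
      by fastforce
    then show "\<exists>N. \<forall>n\<ge>N. norm (L2_norm M (\<lambda>x. s n x - f x) - 0) < e"
      by (intro exI[of _ "max K K'"]) simp
  qed
  then show ?thesis using f by (intro that[of f]) (simp_all add: L2_tendsto_def)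
qed

lemma L2_Cauchy_if_L2_norm_minimizing:
  assumes D: "L2_subspace M D" and p: "p \<in> L2 M" and m: "\<And>n. m n \<in> D"
    and le: "\<And>d. d \<in> D \<Longrightarrow> \<delta> \<le> (L2_norm M (\<lambda>x. p x - d x))\<^sup>2"
    and lim: "(\<lambda>n. (L2_norm M (\<lambda>x. p x - m n x))\<^sup>2) \<longlonglongrightarrow> \<delta>"
  shows "L2_Cauchy M (\<lambda>n x. p x - m n x)"
  unfolding L2_Cauchy_def
proof (intro allI impI)
  fix e :: real assume "e > 0"
  then have "\<forall>\<^sub>F n in sequentially. (L2_norm M (\<lambda>x. p x - m n x))\<^sup>2 < \<delta> + e\<^sup>2 / 4"
    using lim by (intro order_tendstoD) auto
  then obtain N where N: "\<And>n. n \<ge> N \<Longrightarrow> (L2_norm M (\<lambda>x. p x - m n x))\<^sup>2 < \<delta> + e\<^sup>2 / 4"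
    unfolding eventually_sequentially by blast
  have pm: "(\<lambda>x. p x - m n x) \<in> L2 M" for n by (intro L2_diff p L2_subspace_mem[OF D] m)
  have "L2_norm M (\<lambda>x. (p x - m i x) - (p x - m j x)) \<le> e" if "i \<ge> N" "j \<ge> N" for i j
  proof (rule power2_le_imp_le)
    define d where "d = (\<lambda>x. 1/2 * m i x + (- 1/2 * m j x + m j x))"
    have "d \<in> D" unfolding d_def by (intro L2_subspace_lincomb[OF D] m)
    from le[OF this] have "4 * \<delta> \<le> (2 * L2_norm M (\<lambda>x. p x - d x))\<^sup>2" by simp
    also have "2 * L2_norm M (\<lambda>x. p x - d x) = L2_norm M (\<lambda>x. (p x - m i x) + (p x - m j x))"
      using L2_norm_cmult[of M 2 "\<lambda>x. p x - d x"] by (simp add: d_def algebra_simps)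
    finally show "(L2_norm M (\<lambda>x. (p x - m i x) - (p x - m j x)))\<^sup>2 \<le> e\<^sup>2"
      using L2_norm_parallelogram[OF pm[of i] pm[of j]] N[OF that(1)] N[OF that(2)] by simp
  qed (use \<open>e > 0\<close> in simp)
  then show "\<exists>N. \<forall>i\<ge>N. \<forall>j\<ge>N. L2_norm M (\<lambda>x. (p x - m i x) - (p x - m j x)) \<le> e" by blast
qed

lemma L2_orthogonal_if_L2_norm_minimal:
  assumes v: "v \<in> L2 M" and d: "d \<in> L2 M" and le: "\<And>c. L2_norm M v \<le> L2_norm M (\<lambda>x. v x - c * d x)"
  shows "L2_inner M v d = 0"
proof -
  define a where "a = L2_inner M v d"
  define t where "t = 1 / ((L2_norm M d)\<^sup>2 + 1)"
  have t: "t > 0" "t * (L2_norm M d)\<^sup>2 < 1"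
    unfolding t_def by (auto simp: add_pos_nonneg add_nonneg_pos divide_less_eq)
  have "(L2_norm M v)\<^sup>2 \<le> (L2_norm M (\<lambda>x. v x - (of_real t * a) * d x))\<^sup>2"
    by (intro power_mono le) auto
  also have "\<dots>
      = (L2_norm M v)\<^sup>2 - 2 * Re (cnj (of_real t * a) * a) + (cmod (of_real t * a) * L2_norm M d)\<^sup>2"
    by (simp add: L2_norm_diff_sq v L2_cmult d L2_inner_cmult_right L2_norm_cmult a_def)
  also have "Re (cnj (of_real t * a) * a) = t * (cmod a)\<^sup>2"
    unfolding cmod_power2 by (simp add: power2_eq_square algebra_simps)
  also have "(cmod (of_real t * a) * L2_norm M d)\<^sup>2 = t * (cmod a)\<^sup>2 * (t * (L2_norm M d)\<^sup>2)"
    using t by (simp add: norm_mult power2_eq_square)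
  finally have "t * (cmod a)\<^sup>2 * 2 \<le> t * (cmod a)\<^sup>2 * (t * (L2_norm M d)\<^sup>2)" by simp
  then have "\<not> t * (cmod a)\<^sup>2 > 0" using t(2) by (auto simp: mult_le_cancel_left)
  then show ?thesis using t(1) by (simp add: a_def zero_less_mult_iff)
qed

lemma L2_minimizing_sequence:
  assumes D: "L2_subspace M D"
  obtains m \<delta> where "\<And>n. m n \<in> D" "\<And>d. d \<in> D \<Longrightarrow> \<delta> \<le> (L2_norm M (\<lambda>x. p x - d x))\<^sup>2"
    "(\<lambda>n. (L2_norm M (\<lambda>x. p x - m n x))\<^sup>2) \<longlonglongrightarrow> \<delta>"
proof -
  define \<delta> where "\<delta> = (INF d\<in>D. (L2_norm M (\<lambda>x. p x - d x))\<^sup>2)"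
  have bdd: "bdd_below ((\<lambda>d. (L2_norm M (\<lambda>x. p x - d x))\<^sup>2) ` D)" by (rule bdd_belowI[of _ 0]) auto
  have \<delta>_le: "\<delta> \<le> (L2_norm M (\<lambda>x. p x - d x))\<^sup>2" if "d \<in> D" for d
    unfolding \<delta>_def using that by (intro cINF_lower bdd)
  have "\<exists>d\<in>D. (L2_norm M (\<lambda>x. p x - d x))\<^sup>2 < \<delta> + 1 / real (Suc n)" for n
    using cINF_less_iff[OF _ bdd, of "\<delta> + 1 / real (Suc n)"] D
    unfolding \<delta>_def[symmetric] L2_subspace_def by simp
  then obtain m where m: "\<And>n. m n \<in> D" "\<And>n. (L2_norm M (\<lambda>x. p x - m n x))\<^sup>2 < \<delta> + 1 / real (Suc n)"
    by metis
  have lim: "(\<lambda>n. (L2_norm M (\<lambda>x. p x - m n x))\<^sup>2) \<longlonglongrightarrow> \<delta>"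
  proof (rule tendsto_sandwich)
    show "\<forall>\<^sub>F n in sequentially. \<delta> \<le> (L2_norm M (\<lambda>x. p x - m n x))\<^sup>2"
      using \<delta>_le[OF m(1)] by simp
    show "\<forall>\<^sub>F n in sequentially. (L2_norm M (\<lambda>x. p x - m n x))\<^sup>2 \<le> \<delta> + 1 / real (Suc n)"
      using m(2) less_imp_le by (intro always_eventually) blast
    show "(\<lambda>n. \<delta> + 1 / real (Suc n)) \<longlonglongrightarrow> \<delta>"
      using tendsto_add[OF tendsto_const LIMSEQ_Suc[OF lim_1_over_n]] by simp
  qed simp
  show ?thesis by (rule that[OF m(1) \<delta>_le lim])
qed

theorem L2_projection:
  assumes D: "L2_subspace M D" and p: "p \<in> L2 M"
  obtains v m where "v \<in> L2 M" "\<And>n. m n \<in> D" "L2_tendsto M (\<lambda>n x. p x - m n x) v sequentially"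
    "\<And>d. d \<in> D \<Longrightarrow> L2_inner M v d = 0"
proof -
  note DL = L2_subspace_mem[OF D]
  obtain m \<delta> where m: "\<And>n. m n \<in> D" and \<delta>_le: "\<And>d. d \<in> D \<Longrightarrow> \<delta> \<le> (L2_norm M (\<lambda>x. p x - d x))\<^sup>2"
    and lim: "(\<lambda>n. (L2_norm M (\<lambda>x. p x - m n x))\<^sup>2) \<longlonglongrightarrow> \<delta>"
    by (rule L2_minimizing_sequence[OF D, of p]) blast
  have pm: "(\<lambda>x. p x - m n x) \<in> L2 M" for n by (intro L2_diff p DL m)
  obtain v where v: "v \<in> L2 M" and v_lim: "L2_tendsto M (\<lambda>n x. p x - m n x) v sequentially"
    by (rule L2_complete[OF pm L2_Cauchy_if_L2_norm_minimizing[OF D p m \<delta>_le lim]])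
  have v_norm: "(L2_norm M v)\<^sup>2 = \<delta>"
    by (rule LIMSEQ_unique[OF tendsto_power[OF tendsto_L2_norm[OF pm v v_lim]] lim])
  have "L2_inner M v d = 0" if d: "d \<in> D" for d
  proof (rule L2_orthogonal_if_L2_norm_minimal[OF v DL[OF d]])
    fix c
    have mem: "(\<lambda>x. c * d x + m n x) \<in> D" for n by (rule L2_subspace_lincomb[OF D d m])
    have eq: "(\<lambda>x. p x - (c * d x + m n x)) = (\<lambda>x. (p x - m n x) - c * d x)" for n
      by (simp add: algebra_simps)
    have "L2_tendsto M (\<lambda>n x. p x - (c * d x + m n x)) (\<lambda>x. v x - c * d x) sequentially"
      unfolding eq L2_tendsto_iff_diff by (rule v_lim)
    then have "(\<lambda>n. (L2_norm M (\<lambda>x. p x - (c * d x + m n x)))\<^sup>2)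
        \<longlonglongrightarrow> (L2_norm M (\<lambda>x. v x - c * d x))\<^sup>2"
      by (intro tendsto_power tendsto_L2_norm L2_diff p v L2_cmult DL d mem)
    then have "\<delta> \<le> (L2_norm M (\<lambda>x. v x - c * d x))\<^sup>2"
      by (rule LIMSEQ_le_const) (use \<delta>_le[OF mem] in blast)
    then show "L2_norm M v \<le> L2_norm M (\<lambda>x. v x - c * d x)"
      unfolding v_norm[symmetric] by (rule power2_le_imp_le) simp
  qed
  with v m v_lim show ?thesis by (rule that)
qed

theorem L2_contraction_fixpoint:
  assumes S: "S \<subseteq> L2 M" "x\<^sub>0 \<in> S"
    and closed: "\<And>s f. (\<And>n. s n \<in> S) \<Longrightarrow> f \<in> L2 M \<Longrightarrow> L2_tendsto M s f sequentially \<Longrightarrow> f \<in> S"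
    and A: "\<And>f. f \<in> S \<Longrightarrow> A f \<in> S"
    and contraction: "\<And>f g. f \<in> S \<Longrightarrow> g \<in> S \<Longrightarrow>
      L2_norm M (\<lambda>x. A f x - A g x) \<le> r * L2_norm M (\<lambda>x. f x - g x)"
    and r: "r < 1"
  obtains f where "f \<in> S" "AE x in M. A f x = f x"
proof -
  define s where "s n = (A ^^ n) x\<^sub>0" for n
  have s: "s n \<in> S" for n unfolding s_def by (induction n) (auto intro: A S(2))
  have sL: "s n \<in> L2 M" for n using s S(1) by blast
  have s_step: "L2_norm M (\<lambda>x. A f x - s (Suc n) x) \<le> r * L2_norm M (\<lambda>x. f x - s n x)"
    if "f \<in> S" for f n
    using contraction[OF that s[of n]] by (simp add: s_def)
  have "L2_norm M (\<lambda>x. s (Suc (Suc n)) x - s (Suc n) x)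
      \<le> r * L2_norm M (\<lambda>x. s (Suc n) x - s n x)" for n
    using s_step[OF s[of "Suc n"], of n] by (simp add: s_def)
  then have "summable (\<lambda>n. L2_norm M (\<lambda>x. s (Suc n) x - s n x))"
    by (intro summable_ratio_test[OF r, of 0]) simp
  then obtain f where f: "f \<in> L2 M" "L2_tendsto M s f sequentially"
    by (rule L2_convergent_if_summable_increments[OF sL])
  have fS: "f \<in> S" by (rule closed[OF s f])
  have AL: "A f \<in> L2 M" using A[OF fS] S(1) by blast
  have "L2_norm M (\<lambda>x. A f x - f x) \<le> 0"
  proof (rule LIMSEQ_le[OF tendsto_const])
    define \<delta> where "\<delta> n = L2_norm M (\<lambda>x. s n x - f x)" for n
    have "\<delta> \<longlonglongrightarrow> 0" using f(2) by (simp add: L2_tendsto_def \<delta>_def[abs_def])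
    from tendsto_add[OF tendsto_mult_left[OF this, of r] LIMSEQ_Suc[OF this]]
    show "(\<lambda>n. r * \<delta> n + \<delta> (Suc n)) \<longlonglongrightarrow> 0" by simp
    have "L2_norm M (\<lambda>x. A f x - f x) \<le> r * \<delta> n + \<delta> (Suc n)" for n
      using L2_norm_diff_triangle[OF AL sL f(1), of "Suc n"] s_step[OF fS, of n]
        L2_norm_diff_commute[of M f "s n"] by (simp add: \<delta>_def)
    then show "\<exists>N. \<forall>n\<ge>N. L2_norm M (\<lambda>x. A f x - f x) \<le> r * \<delta> n + \<delta> (Suc n)" by blast
  qed
  then have "L2_norm M (\<lambda>x. A f x - f x) = 0" using L2_norm_nonneg order_antisym by blast
  then have "AE x in M. A f x = f x" using L2_norm_eq_0_iff[OF L2_diff[OF AL f(1)]] by simp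
  with fS show ?thesis by (rule that)
qed

lemma (in finite_measure) L2_bounded:
  assumes "f \<in> borel_measurable M" "AE x in M. cmod (f x) \<le> C"
  shows "f \<in> L2 M"
proof -
  have "(\<lambda>x. 1) \<in> L2 M" by (simp add: L2_def)
  from L2_bounded_mult[OF this assms] show ?thesis by simp
qed

lemma (in finite_measure) L2_integrable: "f \<in> L2 M \<Longrightarrow> integrable M f"
  using L2_mult_integrable[OF _ L2_bounded[of "\<lambda>x. 1" 1], of f] by simp

lemma (in prob_space) L2_unimodular: "f \<in> borel_measurable M \<Longrightarrow> AE x in M. cmod (f x) = 1 \<Longrightarrow> f \<in> L2 M"
  by (rule L2_bounded[where C = 1]) (auto elim: eventually_mono)

lemma (in prob_space) L2_norm_unimodular:
  assumes "f \<in> borel_measurable M" "AE x in M. cmod (f x) = 1"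
  shows "L2_norm M f = 1"
proof -
  have "(\<integral>x. (cmod (f x))\<^sup>2 \<partial>M) = (\<integral>x. 1 \<partial>M)"
    using assms by (intro integral_cong_AE) (auto elim: eventually_mono)
  then show ?thesis by (simp add: L2_norm_def prob_space)
qed

lemma AE_inverse_bounded:
  assumes "c > 0" "AE x in M. c \<le> (cmod (p x))\<^sup>2"
  shows "AE x in M. cmod (inverse (p x)) \<le> inverse (sqrt c)"
  using assms(2)
proof eventually_elim
  case (elim x)
  then have "sqrt c \<le> cmod (p x)" by (intro real_le_lsqrt) auto
  then show ?case using assms(1) by (simp add: norm_inverse le_imp_inverse_le)
qed

lemma AE_neq_0_if_norm_sq_bounded_below:
  "c > 0 \<Longrightarrow> AE x in M. c \<le> (cmod (p x))\<^sup>2 \<Longrightarrow> AE x in M. p x \<noteq> 0"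
  by (auto elim: eventually_mono)


section \<open>Bounded operators on \<open>\<ell>\<^sup>2\<close>\<close>

abbreviation l2inner :: "('x \<Rightarrow> complex) \<Rightarrow> ('x \<Rightarrow> complex) \<Rightarrow> complex" where
  "l2inner \<equiv> L2_inner (count_space UNIV)"

abbreviation l2_tendsto :: "('i \<Rightarrow> 'x \<Rightarrow> complex) \<Rightarrow> ('x \<Rightarrow> complex) \<Rightarrow> 'i filter \<Rightarrow> bool" where
  "l2_tendsto \<equiv> L2_tendsto (count_space UNIV)"

definition truncate :: "'x set \<Rightarrow> ('x \<Rightarrow> complex) \<Rightarrow> 'x \<Rightarrow> complex" where
  "truncate F g x = (if x \<in> F then g x else 0)"

lemma l2space_eq_L2: "l2space A = {g \<in> L2 (count_space UNIV). \<forall>x. x \<notin> A \<longrightarrow> g x = 0}"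
proof -
  have "(\<lambda>x. (cmod (g x))\<^sup>2) summable_on UNIV \<longleftrightarrow> integrable (count_space UNIV) (\<lambda>x. (cmod (g x))\<^sup>2)"
    for g :: "'a \<Rightarrow> complex"
    using abs_summable_equivalent[of "\<lambda>x. (cmod (g x))\<^sup>2" UNIV] by (simp add: abs_summable_on_def)
  then show ?thesis by (simp add: l2space_def L2_def)
qed

lemma l2norm_eq_L2_norm: "l2norm g = L2_norm (count_space UNIV) g"
proof (cases "integrable (count_space UNIV) (\<lambda>x. (cmod (g x))\<^sup>2)")
  case True
  then show ?thesis
    using infsetsum_infsum[of "\<lambda>x. (cmod (g x))\<^sup>2" UNIV]
    by (simp add: l2norm_def L2_norm_def abs_summable_on_def infsetsum_def)
next
  case False
  then have "\<not> (\<lambda>x. (cmod (g x))\<^sup>2) summable_on UNIV"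
    using abs_summable_equivalent[of "\<lambda>x. (cmod (g x))\<^sup>2" UNIV] by (simp add: abs_summable_on_def)
  with False show ?thesis
    by (simp add: l2norm_def L2_norm_def infsum_not_exists not_integrable_integral_eq)
qed

lemma l2space_L2: "g \<in> l2space A \<Longrightarrow> g \<in> L2 (count_space UNIV)"
  and l2space_outside: "g \<in> l2space A \<Longrightarrow> x \<notin> A \<Longrightarrow> g x = 0"
  by (simp_all add: l2space_eq_L2)

lemma l2space_UNIV: "l2space UNIV = L2 (count_space UNIV)"
  by (simp add: l2space_eq_L2)

lemma l2norm_nonneg [simp]: "0 \<le> l2norm g"
  by (simp add: l2norm_eq_L2_norm)

lemma l2norm_zero [simp]: "l2norm (\<lambda>x. 0) = 0"
  by (simp add: l2norm_eq_L2_norm)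

lemma zero_l2space: "(\<lambda>x. 0) \<in> l2space A"
  by (simp add: l2space_eq_L2 L2_zero)

lemma l2space_lincomb: "g \<in> l2space A \<Longrightarrow> h \<in> l2space A \<Longrightarrow> (\<lambda>x. c * g x + h x) \<in> l2space A"
  by (simp add: l2space_eq_L2 L2_add L2_cmult)

lemma l2space_diff: "g \<in> l2space A \<Longrightarrow> h \<in> l2space A \<Longrightarrow> (\<lambda>x. g x - h x) \<in> l2space A"
  by (simp add: l2space_eq_L2 L2_diff)

lemma l2norm_eq_0_iff: "g \<in> l2space A \<Longrightarrow> l2norm g = 0 \<longleftrightarrow> g = (\<lambda>x. 0)"
  using L2_norm_eq_0_iff[OF l2space_L2, of g A] by (auto simp: l2norm_eq_L2_norm AE_count_space)

lemma truncate_l2space: "g \<in> l2space A \<Longrightarrow> truncate F g \<in> l2space A"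
  using L2_bounded_mult[of g "count_space UNIV" "\<lambda>x. if x \<in> F then 1 else 0" 1]
  by (simp add: l2space_eq_L2 truncate_def[abs_def] if_distrib[of "\<lambda>c. c * g _"] cong: if_cong)

lemma l2norm_truncate_sq: "finite F \<Longrightarrow> (l2norm (truncate F g))\<^sup>2 = (\<Sum>x\<in>F. (cmod (g x))\<^sup>2)"
  unfolding l2norm_eq_L2_norm L2_norm_sq
  by (subst lebesgue_integral_count_space_finite_support)
    (auto simp: truncate_def elim: finite_subset[rotated] intro!: sum.mono_neutral_cong_left)

lemma l2space_summable: "g \<in> l2space A \<Longrightarrow> (\<lambda>x. (cmod (g x))\<^sup>2) summable_on UNIV"
  by (simp add: l2space_def)

lemma l2norm_sq: "(l2norm g)\<^sup>2 = (\<Sum>\<^sub>\<infinity>x. (cmod (g x))\<^sup>2)"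
  by (simp add: l2norm_def infsum_nonneg)

lemma cmod_le_l2norm:
  assumes "g \<in> l2space A"
  shows "cmod (g x) \<le> l2norm g"
proof (rule power2_le_imp_le)
  show "(cmod (g x))\<^sup>2 \<le> (l2norm g)\<^sup>2"
    unfolding l2norm_sq using finite_sum_le_infsum[OF l2space_summable[OF assms], of "{x}"] by simp
qed simp

lemma l2space_closed:
  assumes s: "\<And>n::nat. s n \<in> l2space A" and f: "f \<in> L2 (count_space UNIV)"
    and lim: "l2_tendsto s f sequentially"
  shows "f \<in> l2space A"
proof -
  have "f x = 0" if "x \<notin> A" for x
  proof -
    have "cmod (f x) \<le> l2norm (\<lambda>x. s n x - f x)" for n
      using cmod_le_l2norm[of "\<lambda>x. s n x - f x" UNIV x] l2space_outside[OF s that, of n]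
        L2_diff[OF l2space_L2[OF s] f] by (simp add: l2space_UNIV)
    then have "cmod (f x) \<le> 0"
      using lim unfolding L2_tendsto_def l2norm_eq_L2_norm by (intro LIMSEQ_le_const) auto
    then show ?thesis by simp
  qed
  with f show ?thesis by (simp add: l2space_eq_L2)
qed

lemma l2_tendsto_truncate:
  assumes g: "g \<in> l2space A"
  shows "l2_tendsto (\<lambda>F. truncate F g) g (finite_subsets_at_top UNIV)"
proof -
  define a where "a x = (cmod (g x))\<^sup>2" for x
  have a: "(a has_sum infsum a UNIV) UNIV"
    unfolding a_def by (rule has_sum_infsum[OF l2space_summable[OF g]])
  have tail: "l2norm (\<lambda>x. truncate F g x - g x) = sqrt (infsum a UNIV - sum a F)"
    if "finite F" for F
  proof -
    have "(a has_sum (infsum a UNIV - sum a F)) (UNIV - F)"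
      by (rule has_sum_Diff[OF a has_sum_finite[OF that]]) simp
    then have "((\<lambda>x. (cmod (truncate F g x - g x))\<^sup>2) has_sum (infsum a UNIV - sum a F)) UNIV"
      by (rule has_sum_cong_neutral[THEN iffD1, rotated -1]) (auto simp: a_def truncate_def)
    then show ?thesis unfolding l2norm_def by (simp only: infsumI)
  qed
  have "((\<lambda>F. sqrt (infsum a UNIV - sum a F)) \<longlongrightarrow> sqrt (infsum a UNIV - infsum a UNIV))
      (finite_subsets_at_top UNIV)"
    using a unfolding has_sum_def by (intro tendsto_intros)
  then have "((\<lambda>F. sqrt (infsum a UNIV - sum a F)) \<longlongrightarrow> 0) (finite_subsets_at_top UNIV)" by simp
  then show ?thesis
    unfolding L2_tendsto_def l2norm_eq_L2_norm[symmetric]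
    by (rule Lim_transform_eventually)
      (auto simp: tail intro: eventually_finite_subsets_at_top_weakI)
qed

lemma l2inner_eq_infsum:
  assumes "f \<in> l2space A" "g \<in> l2space B"
  shows "l2inner f g = (\<Sum>\<^sub>\<infinity>x. f x * cnj (g x))"
proof -
  have "Infinite_Set_Sum.abs_summable_on (\<lambda>x. f x * cnj (g x)) UNIV"
    unfolding abs_summable_on_def
    by (intro L2_inner_integrable l2space_L2[OF assms(1)] l2space_L2[OF assms(2)])
  from infsetsum_infsum[OF this] show ?thesis by (simp add: L2_inner_def infsetsum_def)
qed

lemma l2inner_eqI:
  assumes "g \<in> l2space A" "h \<in> l2space A" and eq: "\<And>f. f \<in> l2space A \<Longrightarrow> l2inner f g = l2inner f h"
  shows "g = h"
proof -
  define d where "d = (\<lambda>x. g x - h x)"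
  have d: "d \<in> l2space A" unfolding d_def by (intro l2space_diff assms)
  have "l2inner d d = l2inner d g - l2inner d h"
    using L2_inner_diff_right[OF l2space_L2[OF d] l2space_L2[OF assms(1)] l2space_L2[OF assms(2)]]
    by (simp add: d_def)
  then have "l2norm d = 0" using eq[OF d] by (simp add: L2_inner_self l2norm_eq_L2_norm)
  then show ?thesis using l2norm_eq_0_iff[OF d] by (auto simp: d_def fun_eq_iff)
qed

lemma bounded_opI:
  assumes "\<And>g. g \<in> l2space A \<Longrightarrow> T g \<in> l2space A"
    and "\<And>g h c. g \<in> l2space A \<Longrightarrow> h \<in> l2space A \<Longrightarrow> T (\<lambda>x. c * g x + h x) = (\<lambda>x. c * T g x + T h x)"
    and "\<And>g. g \<in> l2space A \<Longrightarrow> l2norm (T g) \<le> C * l2norm g"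
  shows "bounded_op A T"
  unfolding bounded_op_def using assms by blast

lemma bounded_op_l2space: "bounded_op A T \<Longrightarrow> g \<in> l2space A \<Longrightarrow> T g \<in> l2space A"
  and bounded_op_linear: "bounded_op A T \<Longrightarrow> g \<in> l2space A \<Longrightarrow> h \<in> l2space A \<Longrightarrow>
    T (\<lambda>x. c * g x + h x) = (\<lambda>x. c * T g x + T h x)"
  unfolding bounded_op_def by blast+

lemma bounded_op_bound:
  assumes "bounded_op A T"
  obtains C where "C > 0" "\<And>g. g \<in> l2space A \<Longrightarrow> l2norm (T g) \<le> C * l2norm g"
proof -
  obtain C where C: "\<And>g. g \<in> l2space A \<Longrightarrow> l2norm (T g) \<le> C * l2norm g"
    using assms unfolding bounded_op_def by blast
  have "C * l2norm g \<le> (\<bar>C\<bar> + 1) * l2norm g" for g :: "'a \<Rightarrow> complex" by (intro mult_right_mono) auto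
  then show ?thesis using that[of "\<bar>C\<bar> + 1"] C order_trans
    by (meson abs_ge_zero add_nonneg_pos zero_less_one)
qed

lemma bounded_op_diff:
  assumes "bounded_op A T" "g \<in> l2space A" "h \<in> l2space A"
  shows "T (\<lambda>x. g x - h x) = (\<lambda>x. T g x - T h x)"
  using bounded_op_linear[OF assms(1,3,2), of "- 1"] by simp

lemma bounded_op_zero:
  assumes "bounded_op A T"
  shows "T (\<lambda>x. 0) = (\<lambda>x. 0)"
  using bounded_op_diff[OF assms zero_l2space zero_l2space] by simp

lemma l2space_sum: "(\<And>i. i \<in> I \<Longrightarrow> g i \<in> l2space A) \<Longrightarrow> (\<lambda>x. \<Sum>i\<in>I. c i * g i x) \<in> l2space A"
  by (induction I rule: infinite_finite_induct) (simp_all add: zero_l2space l2space_lincomb)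

lemma bounded_op_sum:
  assumes T: "bounded_op A T" and g: "\<And>i. i \<in> I \<Longrightarrow> g i \<in> l2space A"
  shows "T (\<lambda>x. \<Sum>i\<in>I. c i * g i x) = (\<lambda>x. \<Sum>i\<in>I. c i * T (g i) x)"
  using g
proof (induction I rule: infinite_finite_induct)
  case (insert i I)
  then show ?case by (simp add: bounded_op_linear[OF T] l2space_sum)
qed (simp_all add: bounded_op_zero[OF T])

lemma bounded_op_compose:
  assumes S: "bounded_op A S" and T: "bounded_op A T"
  shows "bounded_op A (\<lambda>g. S (T g))"
proof -
  obtain C where C: "C > 0" "\<And>g. g \<in> l2space A \<Longrightarrow> l2norm (S g) \<le> C * l2norm g"
    by (rule bounded_op_bound[OF S]) blast
  obtain D where D: "\<And>g. g \<in> l2space A \<Longrightarrow> l2norm (T g) \<le> D * l2norm g"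
    by (rule bounded_op_bound[OF T]) blast
  show ?thesis
  proof (rule bounded_opI)
    fix g assume g: "g \<in> l2space A"
    have "l2norm (S (T g)) \<le> C * l2norm (T g)" by (rule C(2)[OF bounded_op_l2space[OF T g]])
    also have "\<dots> \<le> C * (D * l2norm g)" using C(1) by (intro mult_left_mono D g) simp
    finally show "l2norm (S (T g)) \<le> (C * D) * l2norm g" by simp
  qed (simp_all add: bounded_op_l2space[OF S] bounded_op_l2space[OF T] bounded_op_linear[OF S]
      bounded_op_linear[OF T])
qed

lemma bounded_op_lincomb:
  assumes S: "bounded_op A S" and T: "bounded_op A T"
  shows "bounded_op A (\<lambda>g x. a * S g x + T g x)"
proof -
  obtain C where C: "\<And>g. g \<in> l2space A \<Longrightarrow> l2norm (S g) \<le> C * l2norm g"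
    by (rule bounded_op_bound[OF S]) blast
  obtain D where D: "\<And>g. g \<in> l2space A \<Longrightarrow> l2norm (T g) \<le> D * l2norm g"
    by (rule bounded_op_bound[OF T]) blast
  show ?thesis
  proof (rule bounded_opI)
    fix g assume g: "g \<in> l2space A"
    note Sg = bounded_op_l2space[OF S g] and Tg = bounded_op_l2space[OF T g]
    show "(\<lambda>x. a * S g x + T g x) \<in> l2space A" by (intro l2space_lincomb Sg Tg)
    have "l2norm (\<lambda>x. a * S g x + T g x) \<le> cmod a * l2norm (S g) + l2norm (T g)"
      using L2_norm_triangle[OF L2_cmult[OF l2space_L2[OF Sg], of a] l2space_L2[OF Tg]]
      by (simp add: l2norm_eq_L2_norm L2_norm_cmult)
    also have "\<dots> \<le> cmod a * (C * l2norm g) + D * l2norm g"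
      by (intro add_mono mult_left_mono C D g) simp
    finally show "l2norm (\<lambda>x. a * S g x + T g x) \<le> (cmod a * C + D) * l2norm g"
      by (simp add: ring_distribs mult.assoc)
  next
    fix g h c assume gh: "g \<in> l2space A" "h \<in> l2space A"
    show "(\<lambda>x. a * S (\<lambda>x. c * g x + h x) x + T (\<lambda>x. c * g x + h x) x) =
        (\<lambda>x. c * (a * S g x + T g x) + (a * S h x + T h x))"
      unfolding bounded_op_linear[OF S gh] bounded_op_linear[OF T gh] by (simp add: algebra_simps)
  qed
qed

lemma bounded_op_id: "bounded_op A (\<lambda>g. g)"
  by (rule bounded_opI[where C = 1]) auto

lemma bounded_op_cong:
  assumes "\<And>g. g \<in> l2space A \<Longrightarrow> T g = T' g"
  shows "bounded_op A T \<longleftrightarrow> bounded_op A T'"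
  unfolding bounded_op_def by (simp add: assms l2space_lincomb cong: ball_cong)

lemma left_invertible_op_cong:
  assumes "\<And>g. g \<in> l2space A \<Longrightarrow> T g = T' g"
  shows "left_invertible_op A T \<longleftrightarrow> left_invertible_op A T'"
  unfolding left_invertible_op_def using bounded_op_cong[of A T T'] assms by auto

lemma right_invertible_op_cong:
  assumes "\<And>g. g \<in> l2space A \<Longrightarrow> T g = T' g"
  shows "right_invertible_op A T \<longleftrightarrow> right_invertible_op A T'"
proof -
  have "(\<forall>g\<in>l2space A. T (R g) = g) \<longleftrightarrow> (\<forall>g\<in>l2space A. T' (R g) = g)" if "bounded_op A R" for R
    using assms bounded_op_l2space[OF that] by simp
  then show ?thesis unfolding right_invertible_op_def using bounded_op_cong[of A T T'] assms by auto
qed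

lemma invertible_op_iff_left_right:
  "invertible_op A T \<longleftrightarrow> left_invertible_op A T \<and> right_invertible_op A T"
proof
  assume "left_invertible_op A T \<and> right_invertible_op A T"
  then obtain L R where T: "bounded_op A T"
    and L: "bounded_op A L" "\<And>g. g \<in> l2space A \<Longrightarrow> L (T g) = g"
    and R: "bounded_op A R" "\<And>g. g \<in> l2space A \<Longrightarrow> T (R g) = g"
    unfolding left_invertible_op_def right_invertible_op_def by blast
  have "R g = L g" if "g \<in> l2space A" for g
    using L(2)[OF bounded_op_l2space[OF R(1) that]] R(2)[OF that] by simp
  then show "invertible_op A T"
    unfolding invertible_op_def using T L R by auto
qed (auto simp: invertible_op_def left_invertible_op_def right_invertible_op_def)

lemma invertible_op_cong:
  "(\<And>g. g \<in> l2space A \<Longrightarrow> T g = T' g) \<Longrightarrow> invertible_op A T \<longleftrightarrow> invertible_op A T'"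
  unfolding invertible_op_iff_left_right
  using left_invertible_op_cong[of A T T'] right_invertible_op_cong[of A T T'] by blast

lemma left_invertible_op_if_compose:
  assumes "bounded_op A S" "bounded_op A T" "left_invertible_op A (\<lambda>g. S (T g))"
  shows "left_invertible_op A T"
proof -
  obtain L where "bounded_op A L" "\<And>g. g \<in> l2space A \<Longrightarrow> L (S (T g)) = g"
    using assms(3) unfolding left_invertible_op_def by blast
  then show ?thesis
    unfolding left_invertible_op_def using assms(2) bounded_op_compose[OF _ assms(1), of L] by blast
qed

lemma left_invertible_op_bounded_below:
  assumes "left_invertible_op A T"
  obtains \<epsilon> where "\<epsilon> > 0" "\<And>g. g \<in> l2space A \<Longrightarrow> \<epsilon> * l2norm g \<le> l2norm (T g)"
proof -
  obtain L where T: "bounded_op A T" and L: "bounded_op A L" "\<And>g. g \<in> l2space A \<Longrightarrow> L (T g) = g"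
    using assms unfolding left_invertible_op_def by blast
  obtain C where C: "C > 0" "\<And>g. g \<in> l2space A \<Longrightarrow> l2norm (L g) \<le> C * l2norm g"
    by (rule bounded_op_bound[OF L(1)]) blast
  show ?thesis
  proof (rule that)
    show "1 / C > 0" using C(1) by simp
    fix g assume g: "g \<in> l2space A"
    show "1 / C * l2norm g \<le> l2norm (T g)"
      using C(2)[OF bounded_op_l2space[OF T g]] C(1) by (simp add: L(2)[OF g] field_simps)
  qed
qed

lemma invertible_op_cancel_left:
  assumes S: "invertible_op A S" and T: "bounded_op A T" and ST: "invertible_op A (\<lambda>g. S (T g))"
  shows "invertible_op A T"
proof -
  obtain S' where S': "bounded_op A S" "bounded_op A S'" "\<And>g. g \<in> l2space A \<Longrightarrow> S' (S g) = g"
    using S unfolding invertible_op_def by blast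
  obtain U where U: "bounded_op A U" "\<And>g. g \<in> l2space A \<Longrightarrow> U (S (T g)) = g"
    "\<And>g. g \<in> l2space A \<Longrightarrow> S (T (U g)) = g"
    using ST unfolding invertible_op_def by blast
  have "T (U (S g)) = g" if g: "g \<in> l2space A" for g
  proof -
    note Sg = bounded_op_l2space[OF S'(1) g]
    have "T (U (S g)) = S' (S (T (U (S g))))"
      by (rule S'(3)[symmetric]) (intro bounded_op_l2space[OF T] bounded_op_l2space[OF U(1)] Sg)
    also have "\<dots> = S' (S g)" by (simp only: U(3)[OF Sg])
    finally show ?thesis by (simp only: S'(3)[OF g])
  qed
  then show ?thesis
    unfolding invertible_op_def using T U bounded_op_compose[OF U(1) S'(1)] by blast
qed

lemma invertible_op_if_bounded_below_surj:
  assumes T: "bounded_op A T" and "\<delta> > 0"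
    and below: "\<And>g. g \<in> l2space A \<Longrightarrow> \<delta> * l2norm g \<le> l2norm (T g)"
    and surj: "\<And>y. y \<in> l2space A \<Longrightarrow> \<exists>g\<in>l2space A. T g = y"
  shows "invertible_op A T"
proof -
  have inj: "inj_on T (l2space A)"
  proof (rule inj_onI)
    fix g h assume gh: "g \<in> l2space A" "h \<in> l2space A" and eq: "T g = T h"
    note d = l2space_diff[OF gh]
    have "\<delta> * l2norm (\<lambda>x. g x - h x) \<le> 0" using below[OF d]
      by (simp add: bounded_op_diff[OF T gh] eq)
    then have "l2norm (\<lambda>x. g x - h x) = 0"
      using \<open>\<delta> > 0\<close> l2norm_nonneg[of "\<lambda>x. g x - h x"] by (simp add: mult_le_0_iff)
    then show "g = h" unfolding l2norm_eq_0_iff[OF d] by (simp add: fun_eq_iff)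
  qed
  have image: "T ` l2space A = l2space A" using surj bounded_op_l2space[OF T] by force
  define S where "S = inv_into (l2space A) T"
  have S: "S y \<in> l2space A" "T (S y) = y" if "y \<in> l2space A" for y
    using that inv_into_into[of y T "l2space A"] f_inv_into_f[of y T "l2space A"]
    by (simp_all add: S_def image)
  have ST: "S (T g) = g" if "g \<in> l2space A" for g
    unfolding S_def by (rule inv_into_f_f[OF inj that])
  have "bounded_op A S"
  proof (rule bounded_opI)
    fix y z c assume yz: "y \<in> l2space A" "z \<in> l2space A"
    have "S (\<lambda>x. c * y x + z x) = S (T (\<lambda>x. c * S y x + S z x))"
      by (simp add: bounded_op_linear[OF T] S yz)
    also have "\<dots> = (\<lambda>x. c * S y x + S z x)" by (intro ST l2space_lincomb S yz)
    finally show "S (\<lambda>x. c * y x + z x) = (\<lambda>x. c * S y x + S z x)" .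
    show "l2norm (S y) \<le> 1 / \<delta> * l2norm y"
      using below[OF S(1)[OF yz(1)]] S(2)[OF yz(1)] \<open>\<delta> > 0\<close> by (simp add: field_simps)
  qed (rule S)
  then show ?thesis unfolding invertible_op_def using T ST S(2) by blast
qed

lemma invertible_op_if_near_identity:
  assumes T: "bounded_op A T" and r: "0 \<le> r" "r < 1"
    and near: "\<And>g. g \<in> l2space A \<Longrightarrow> l2norm (\<lambda>x. g x - T g x) \<le> r * l2norm g"
  shows "invertible_op A T"
proof (rule invertible_op_if_bounded_below_surj[OF T, of "1 - r"])
  fix g assume g: "g \<in> l2space A"
  have "l2norm g \<le> l2norm (T g) + l2norm (\<lambda>x. g x - T g x)"
    unfolding l2norm_eq_L2_norm
    by (intro L2_norm_triangle_diff l2space_L2[OF g] l2space_L2[OF bounded_op_l2space[OF T g]])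
  then show "(1 - r) * l2norm g \<le> l2norm (T g)" using near[OF g] by (simp add: algebra_simps)
next
  fix y assume y: "y \<in> l2space A"
  define B where "B g = (\<lambda>x. g x - T g x + y x)" for g
  have B: "B g \<in> l2space A" if "g \<in> l2space A" for g
    using l2space_lincomb[OF l2space_diff[OF that bounded_op_l2space[OF T that]] y, of 1]
    by (simp add: B_def)
  obtain g where g: "g \<in> l2space A" "AE x in count_space UNIV. B g x = g x"
  proof (rule L2_contraction_fixpoint[of "l2space A" "count_space UNIV" y B r])
    fix g h assume gh: "g \<in> l2space A" "h \<in> l2space A"
    have "(\<lambda>x. B g x - B h x) = (\<lambda>x. (g x - h x) - T (\<lambda>x. g x - h x) x)"
      by (simp add: B_def bounded_op_diff[OF T gh] algebra_simps)
    then show "L2_norm (count_space UNIV) (\<lambda>x. B g x - B h x)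
        \<le> r * L2_norm (count_space UNIV) (\<lambda>x. g x - h x)"
      using near[OF l2space_diff[OF gh]] by (simp add: l2norm_eq_L2_norm)
  qed (use B y r l2space_L2 l2space_closed[where A = A] in blast)+
  then have "T g = y" by (auto simp: AE_count_space B_def fun_eq_iff)
  with g(1) show "\<exists>g\<in>l2space A. T g = y" by blast
qed (use r in simp)

definition adjoint_ops ::
  "'x set \<Rightarrow> (('x \<Rightarrow> complex) \<Rightarrow> 'x \<Rightarrow> complex) \<Rightarrow> (('x \<Rightarrow> complex) \<Rightarrow> 'x \<Rightarrow> complex) \<Rightarrow> bool" where
  "adjoint_ops A T S \<longleftrightarrow> bounded_op A T \<and> bounded_op A S \<and>
     (\<forall>f\<in>l2space A. \<forall>g\<in>l2space A. l2inner (T f) g = l2inner f (S g))"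

lemma adjoint_opsD: "adjoint_ops A T S \<Longrightarrow> f \<in> l2space A \<Longrightarrow> g \<in> l2space A \<Longrightarrow>
    l2inner (T f) g = l2inner f (S g)"
  by (simp add: adjoint_ops_def)

lemma adjoint_ops_sym: "adjoint_ops A T S \<Longrightarrow> adjoint_ops A S T"
  unfolding adjoint_ops_def using L2_inner_commute by metis

definition op_adjoint ::
  "'x set \<Rightarrow> (('x \<Rightarrow> complex) \<Rightarrow> 'x \<Rightarrow> complex) \<Rightarrow> ('x \<Rightarrow> complex) \<Rightarrow> 'x \<Rightarrow> complex" where
  "op_adjoint A T g x = (if x \<in> A then l2inner g (T (indicator {x})) else 0)"

lemma indicator_l2space: "x \<in> A \<Longrightarrow> indicator {x} \<in> l2space A"
proof -
  have "(\<lambda>y. (cmod (indicator {x} y))\<^sup>2) summable_on UNIV \<longleftrightarrow> (\<lambda>_. 1 :: real) summable_on {x}"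
    by (rule summable_on_cong_neutral) auto
  then show "x \<in> A \<Longrightarrow> indicator {x} \<in> l2space A" by (auto simp: l2space_def indicator_def)
qed

lemma truncate_eq_sum_indicator:
  "finite F \<Longrightarrow> truncate F g = (\<lambda>y. \<Sum>x\<in>F. g x * indicator {x} y)"
  by (rule ext) (simp add: truncate_def indicator_def if_distrib cong: if_cong)

lemma l2inner_truncate_left:
  assumes "finite F"
  shows "l2inner (truncate F f) g = (\<Sum>x\<in>F. f x * cnj (g x))"
  unfolding L2_inner_def using assms
  by (subst lebesgue_integral_count_space_finite_support)
    (auto simp: truncate_def elim: finite_subset[rotated] intro!: sum.mono_neutral_cong_left)

lemma op_adjoint_truncate:
  assumes T: "bounded_op A T" and f: "\<And>x. x \<notin> A \<Longrightarrow> f x = 0" and g: "g \<in> l2space A" and F: "finite F"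
  shows "truncate F f \<in> l2space A"
    "l2inner (T (truncate F f)) g = (\<Sum>x\<in>F. f x * cnj (op_adjoint A T g x))"
proof -
  define e :: "'a \<Rightarrow> 'a \<Rightarrow> complex" where "e x = indicator {x}" for x
  have e: "e x \<in> l2space A" if "x \<in> F \<inter> A" for x unfolding e_def using that
    by (intro indicator_l2space) simp
  have "truncate F f = truncate (F \<inter> A) f" using f by (auto simp: truncate_def fun_eq_iff)
  then have trunc: "truncate F f = (\<lambda>y. \<Sum>x\<in>F \<inter> A. f x * e x y)"
    unfolding e_def using F by (simp add: truncate_eq_sum_indicator)
  show "truncate F f \<in> l2space A" unfolding trunc by (rule l2space_sum[OF e])
  have Te: "T (\<lambda>y. \<Sum>x\<in>F \<inter> A. f x * e x y) = (\<lambda>y. \<Sum>x\<in>F \<inter> A. f x * T (e x) y)"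
    by (rule bounded_op_sum[OF T e])
  have "l2inner (T (truncate F f)) g = (\<Sum>x\<in>F \<inter> A. f x * l2inner (T (e x)) g)"
    unfolding trunc Te
    by (subst L2_inner_sum_left) (auto simp: L2_inner_cmult_left
        intro!: L2_cmult l2space_L2[OF bounded_op_l2space[OF T]] e l2space_L2[OF g])
  also have "\<dots> = (\<Sum>x\<in>F \<inter> A. f x * cnj (op_adjoint A T g x))"
    by (intro sum.cong refl) (simp add: op_adjoint_def e_def L2_inner_commute[of _ "T _" g])
  also have "\<dots> = (\<Sum>x\<in>F. f x * cnj (op_adjoint A T g x))"
    using F f by (intro sum.mono_neutral_left) auto
  finally show "l2inner (T (truncate F f)) g = (\<Sum>x\<in>F. f x * cnj (op_adjoint A T g x))" .
qed

lemma op_adjoint_bounded: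
  assumes T: "bounded_op A T" and C: "0 \<le> C" "\<And>g. g \<in> l2space A \<Longrightarrow> l2norm (T g) \<le> C * l2norm g"
    and g: "g \<in> l2space A"
  shows "op_adjoint A T g \<in> l2space A" "l2norm (op_adjoint A T g) \<le> C * l2norm g"
proof -
  define h where "h = op_adjoint A T g"
  have h: "h x = 0" if "x \<notin> A" for x using that by (simp add: h_def op_adjoint_def)
  have bound: "(\<Sum>x\<in>F. (cmod (h x))\<^sup>2) \<le> (C * l2norm g)\<^sup>2" if F: "finite F" for F
  proof -
    have hF: "truncate F h \<in> l2space A"
      and inner: "l2inner (T (truncate F h)) g = (\<Sum>x\<in>F. h x * cnj (h x))"
      using op_adjoint_truncate[OF T h g F] by (simp_all add: h_def)
    have "of_real ((l2norm (truncate F h))\<^sup>2) = l2inner (T (truncate F h)) g"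
      unfolding inner l2norm_truncate_sq[OF F] of_real_sum complex_norm_square ..
    then have "(l2norm (truncate F h))\<^sup>2 = cmod (l2inner (T (truncate F h)) g)"
      by (metis norm_of_real abs_of_nonneg zero_le_power2)
    also have "\<dots> \<le> l2norm (T (truncate F h)) * l2norm g"
      unfolding l2norm_eq_L2_norm
      by (intro L2_Cauchy_Schwarz l2space_L2[OF bounded_op_l2space[OF T hF]] l2space_L2[OF g])
    also have "\<dots> \<le> (C * l2norm (truncate F h)) * l2norm g" by (intro mult_right_mono C(2) hF) simp
    finally have "(l2norm (truncate F h))\<^sup>2 \<le> (C * l2norm g) * l2norm (truncate F h)"
      by (simp add: mult_ac)
    from le_if_power2_le_mult[OF this] have "l2norm (truncate F h) \<le> C * l2norm g" using C(1)
      by simp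
    then show ?thesis unfolding l2norm_truncate_sq[OF F, symmetric] by (intro power_mono) auto
  qed
  have summable: "(\<lambda>x. (cmod (h x))\<^sup>2) summable_on UNIV"
    by (rule nonneg_bdd_above_summable_on) (auto intro!: bdd_aboveI2[OF bound])
  then show "op_adjoint A T g \<in> l2space A" using h unfolding h_def[symmetric]
    by (simp add: l2space_def)
  have "(l2norm h)\<^sup>2 \<le> (C * l2norm g)\<^sup>2"
    unfolding l2norm_sq by (rule infsum_le_finite_sums[OF summable bound])
  then show "l2norm (op_adjoint A T g) \<le> C * l2norm g"
    unfolding h_def[symmetric] by (rule power2_le_imp_le) (simp add: C(1))
qed

lemma tendsto_l2_bounded_op:
  assumes T: "bounded_op A T" and s: "\<And>i. s i \<in> l2space A" and f: "f \<in> l2space A"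
    and lim: "l2_tendsto s f F"
  shows "l2_tendsto (\<lambda>i. T (s i)) (T f) F"
proof -
  obtain C where C: "\<And>g. g \<in> l2space A \<Longrightarrow> l2norm (T g) \<le> C * l2norm g"
    by (rule bounded_op_bound[OF T]) blast
  show ?thesis
    unfolding L2_tendsto_def
  proof (rule Lim_null_comparison)
    have "l2norm (\<lambda>x. T (s i) x - T f x) \<le> C * l2norm (\<lambda>x. s i x - f x)" for i
      using C[OF l2space_diff[OF s f]] by (simp add: bounded_op_diff[OF T s f])
    then show "\<forall>\<^sub>F i in F. norm (L2_norm (count_space UNIV) (\<lambda>x. T (s i) x - T f x)) \<le>
        C * L2_norm (count_space UNIV) (\<lambda>x. s i x - f x)"
      by (simp add: l2norm_eq_L2_norm)
    show "((\<lambda>i. C * L2_norm (count_space UNIV) (\<lambda>x. s i x - f x)) \<longlongrightarrow> 0) F"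
      using tendsto_mult_left[OF lim[unfolded L2_tendsto_def], of C] by simp
  qed
qed

theorem adjoint_op_exists:
  assumes T: "bounded_op A T"
  obtains S where "adjoint_ops A T S"
proof
  obtain C where C: "C > 0" "\<And>g. g \<in> l2space A \<Longrightarrow> l2norm (T g) \<le> C * l2norm g"
    by (rule bounded_op_bound[OF T]) blast
  have adj: "op_adjoint A T g \<in> l2space A" "l2norm (op_adjoint A T g) \<le> C * l2norm g"
    if "g \<in> l2space A" for g
    using op_adjoint_bounded[OF T _ C(2) that] C(1) by simp_all
  have "l2inner (T f) g = l2inner f (op_adjoint A T g)"
    if f: "f \<in> l2space A" and g: "g \<in> l2space A" for f g
  proof (rule tendsto_unique[OF finite_subsets_at_top_neq_bot])
    note trunc = l2_tendsto_truncate[OF f]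
    have lim: "((\<lambda>F. l2inner (truncate F f) (op_adjoint A T g)) \<longlongrightarrow>
        l2inner f (op_adjoint A T g)) (finite_subsets_at_top UNIV)"
      by (rule tendsto_L2_inner[OF l2space_L2[OF truncate_l2space[OF f]] l2space_L2[OF f]
            l2space_L2[OF adj(1)[OF g]] trunc])
    have "l2inner (truncate F f) (op_adjoint A T g) = l2inner (T (truncate F f)) g"
      if "finite F" for F
      using op_adjoint_truncate(2)[OF T l2space_outside[OF f] g that] l2inner_truncate_left[OF that]
      by simp
    with lim show "((\<lambda>F. l2inner (T (truncate F f)) g) \<longlongrightarrow> l2inner f (op_adjoint A T g))
        (finite_subsets_at_top UNIV)"
      by (elim Lim_transform_eventually) (auto intro: eventually_finite_subsets_at_top_weakI)
    note Tl = bounded_op_l2space[OF T]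
    show "((\<lambda>F. l2inner (T (truncate F f)) g) \<longlongrightarrow> l2inner (T f) g) (finite_subsets_at_top UNIV)"
      by (rule tendsto_L2_inner[OF l2space_L2[OF Tl[OF truncate_l2space[OF f]]]
            l2space_L2[OF Tl[OF f]] l2space_L2[OF g]
        tendsto_l2_bounded_op[OF T truncate_l2space[OF f] f trunc]])
  qed
  moreover have "bounded_op A (op_adjoint A T)"
  proof (rule bounded_opI[OF adj(1) _ adj(2)])
    fix g h c assume "g \<in> l2space A" "h \<in> l2space A"
    then show "op_adjoint A T (\<lambda>x. c * g x + h x)
        = (\<lambda>x. c * op_adjoint A T g x + op_adjoint A T h x)"
      using bounded_op_l2space[OF T indicator_l2space, THEN l2space_L2] l2space_L2[of g A]
          l2space_L2[of h A]
      by (auto simp: op_adjoint_def fun_eq_iff L2_inner_add_left L2_inner_cmult_left L2_cmult)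
  qed
  ultimately show "adjoint_ops A T (op_adjoint A T)" using T by (simp add: adjoint_ops_def)
qed

lemma left_inverse_adjoint:
  assumes T: "adjoint_ops A T S" and R: "adjoint_ops A R R'"
    and TR: "\<And>g. g \<in> l2space A \<Longrightarrow> T (R g) = g"
    and g: "g \<in> l2space A"
  shows "R' (S g) = g"
proof -
  have ops: "bounded_op A R" "bounded_op A S" "bounded_op A R'" using T R
    by (simp_all add: adjoint_ops_def)
  note Sg = bounded_op_l2space[OF ops(2) g]
  show ?thesis
  proof (rule l2inner_eqI[OF bounded_op_l2space[OF ops(3) Sg] g])
    fix f assume f: "f \<in> l2space A"
    have "l2inner f (R' (S g)) = l2inner (T (R f)) g"
      using adjoint_opsD[OF R f Sg] adjoint_opsD[OF T bounded_op_l2space[OF ops(1) f] g] by simp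
    then show "l2inner f (R' (S g)) = l2inner f g" by (simp add: TR[OF f])
  qed
qed

theorem right_invertible_op_iff_adjoint_left_invertible:
  assumes adj: "adjoint_ops A T S"
  shows "right_invertible_op A T \<longleftrightarrow> left_invertible_op A S"
proof
  assume "right_invertible_op A T"
  then obtain R where R: "bounded_op A R" "\<And>g. g \<in> l2space A \<Longrightarrow> T (R g) = g"
    unfolding right_invertible_op_def by blast
  obtain R' where "adjoint_ops A R R'" by (rule adjoint_op_exists[OF R(1)])
  with left_inverse_adjoint[OF adj this R(2)] adj show "left_invertible_op A S"
    unfolding left_invertible_op_def adjoint_ops_def by blast
next
  assume "left_invertible_op A S"
  then obtain L where L: "bounded_op A L" "\<And>g. g \<in> l2space A \<Longrightarrow> L (S g) = g"
    unfolding left_invertible_op_def by blast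
  obtain L' where L': "adjoint_ops A L L'" by (rule adjoint_op_exists[OF L(1)])
  from left_inverse_adjoint[OF L' adjoint_ops_sym[OF adj] L(2)] adj L'
    show "right_invertible_op A T"
    unfolding right_invertible_op_def adjoint_ops_def by blast
qed

lemma invertible_op_adjoint:
  assumes "adjoint_ops A T S"
  shows "invertible_op A T \<longleftrightarrow> invertible_op A S"
  unfolding invertible_op_iff_left_right
  using right_invertible_op_iff_adjoint_left_invertible[OF assms]
    right_invertible_op_iff_adjoint_left_invertible[OF adjoint_ops_sym[OF assms]] by blast


section \<open>Uniqueness of Fourier coefficients\<close>

lemma chars_add: "\<gamma> \<in> chars \<Longrightarrow> \<gamma> (a + b) = \<gamma> a * \<gamma> b"
  and chars_norm: "\<gamma> \<in> chars \<Longrightarrow> cmod (\<gamma> a) = 1"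
  by (auto simp: chars_def)

lemma chars_0: "\<gamma> \<in> chars \<Longrightarrow> \<gamma> 0 = 1"
  using chars_add[of \<gamma> 0 0] chars_norm[of \<gamma> 0] by force

lemma chars_uminus:
  assumes "\<gamma> \<in> chars"
  shows "\<gamma> (- a) = cnj (\<gamma> a)"
proof -
  have "\<gamma> a * cnj (\<gamma> a) = 1" using chars_norm[OF assms, of a] complex_norm_square[of "\<gamma> a"] by simp
  moreover have "\<gamma> (- a) * \<gamma> a = 1" using chars_add[OF assms, of "- a" a] chars_0[OF assms] by simp
  ultimately show ?thesis by (metis mult.assoc mult.commute mult_1)
qed

lemma chars_diff: "\<gamma> \<in> chars \<Longrightarrow> \<gamma> (a - b) = \<gamma> a * cnj (\<gamma> b)"
  using chars_add[of \<gamma> a "- b"] chars_uminus[of \<gamma> b] by simp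

lemma chars_mult: "c \<in> chars \<Longrightarrow> \<gamma> \<in> chars \<Longrightarrow> (\<lambda>x. c x * \<gamma> x) \<in> chars"
  by (auto simp: chars_def norm_mult)

locale haar_measure =
  fixes \<mu> :: "('x::linordered_ab_group_add \<Rightarrow> complex) measure"
  assumes haar: "haar \<mu>"

sublocale haar_measure \<subseteq> prob_space \<mu>
  using haar by (simp add: haar_def)

context haar_measure
begin

abbreviation ft :: "(('x \<Rightarrow> complex) \<Rightarrow> complex) \<Rightarrow> 'x \<Rightarrow> complex" where
  "ft \<equiv> fourier \<mu>"

lemma space_haar: "space \<mu> = chars"
  and sets_haar: "sets \<mu> = sets (restrict_space (Pi\<^sub>M UNIV (\<lambda>_. borel)) chars)"
  and translate_haar: "c \<in> chars \<Longrightarrow> distr \<mu> \<mu> (\<lambda>\<gamma> x. c x * \<gamma> x) = \<mu>"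
  using haar by (auto simp: haar_def)

lemma AE_chars: "(\<And>\<gamma>. \<gamma> \<in> chars \<Longrightarrow> P \<gamma>) \<Longrightarrow> AE \<gamma> in \<mu>. P \<gamma>"
  by (rule AE_I2) (simp add: space_haar)

lemma integral_chars_cong: "(\<And>\<gamma>. \<gamma> \<in> chars \<Longrightarrow> f \<gamma> = g \<gamma>) \<Longrightarrow> (\<integral>\<gamma>. f \<gamma> \<partial>\<mu>) = (\<integral>\<gamma>. g \<gamma> \<partial>\<mu>)"
  by (rule Bochner_Integration.integral_cong) (simp_all add: space_haar)

lemma borel_measurable_eval [measurable]: "(\<lambda>\<gamma>. \<gamma> \<xi>) \<in> borel_measurable \<mu>"
proof -
  have "(\<lambda>\<gamma>. \<gamma> \<xi>)
      \<in> measurable (restrict_space (Pi\<^sub>M UNIV (\<lambda>_. borel)) chars) (borel :: complex measure)"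
    by (intro measurable_restrict_space1 measurable_component_singleton) auto
  then show ?thesis
    using measurable_cong_sets[OF sets_haar refl, of "borel :: complex measure"] by simp
qed

lemma measurable_haarI:
  assumes "\<And>\<xi>. (\<lambda>y. h y \<xi>) \<in> borel_measurable M" "h \<in> space M \<rightarrow> chars"
  shows "h \<in> measurable M \<mu>"
proof -
  have "h \<in> measurable M (restrict_space (Pi\<^sub>M UNIV (\<lambda>_. borel)) chars)"
    using measurable_PiM_single'[of UNIV "\<lambda>\<xi> y. h y \<xi>" M "\<lambda>_. borel"] assms
    by (intro measurable_restrict_space2) auto
  then show ?thesis using measurable_cong_sets[OF refl sets_haar, of M] by simp
qed

lemma integral_char_eq_0:
  assumes "\<xi> \<noteq> 0"
  shows "(\<integral>\<gamma>. \<gamma> \<xi> \<partial>\<mu>) = 0"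
proof -
  obtain c where c: "c \<in> chars" "c \<xi> \<noteq> 1" using chars_separate_points[OF assms] by blast
  have translation: "(\<lambda>\<gamma> x. c x * \<gamma> x) \<in> measurable \<mu> \<mu>"
    using chars_mult[OF c(1)] by (intro measurable_haarI) (auto simp: space_haar)
  have "(\<integral>\<gamma>. \<gamma> \<xi> \<partial>\<mu>) = (\<integral>\<gamma>. \<gamma> \<xi> \<partial>distr \<mu> \<mu> (\<lambda>\<gamma> x. c x * \<gamma> x))"
    by (simp add: translate_haar[OF c(1)])
  also have "\<dots> = (\<integral>\<gamma>. c \<xi> * \<gamma> \<xi> \<partial>\<mu>)" by (rule integral_distr[OF translation]) measurable
  also have "\<dots> = c \<xi> * (\<integral>\<gamma>. \<gamma> \<xi> \<partial>\<mu>)" by simp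
  finally show ?thesis using c(2) by simp
qed

lemma integrable_mult_char: "integrable \<mu> f \<Longrightarrow> integrable \<mu> (\<lambda>\<gamma>. f \<gamma> * \<gamma> \<xi>)"
  by (rule integrable_bounded_mult[where C = 1]) (auto intro!: AE_chars simp: chars_norm)

definition char_orthogonal :: "(('x \<Rightarrow> complex) \<Rightarrow> complex) \<Rightarrow> bool" where
  "char_orthogonal f \<longleftrightarrow> integrable \<mu> f \<and> (\<forall>\<xi>. (\<integral>\<gamma>. f \<gamma> * \<gamma> \<xi> \<partial>\<mu>) = 0)"

lemma char_orthogonal_lincomb:
  assumes "char_orthogonal f" "char_orthogonal g"
  shows "char_orthogonal (\<lambda>\<gamma>. a * f \<gamma> + b * g \<gamma>)"
  using assms integrable_mult_char[of f] integrable_mult_char[of g]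
  by (simp add: char_orthogonal_def ring_distribs mult.assoc)

lemma char_orthogonal_mult_char:
  assumes "char_orthogonal f"
  shows "char_orthogonal (\<lambda>\<gamma>. f \<gamma> * \<gamma> \<eta>)"
proof -
  have "(\<integral>\<gamma>. f \<gamma> * \<gamma> \<eta> * \<gamma> \<xi> \<partial>\<mu>) = (\<integral>\<gamma>. f \<gamma> * \<gamma> (\<eta> + \<xi>) \<partial>\<mu>)" for \<xi>
    by (rule integral_chars_cong) (simp add: chars_add)
  then show ?thesis using assms integrable_mult_char by (simp add: char_orthogonal_def)
qed

lemma char_orthogonal_cong:
  assumes "char_orthogonal f" "\<And>\<gamma>. \<gamma> \<in> chars \<Longrightarrow> f \<gamma> = g \<gamma>"
  shows "char_orthogonal g"
proof -
  have "integrable \<mu> f = integrable \<mu> g"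
    by (rule Bochner_Integration.integrable_cong) (simp_all add: space_haar assms)
  moreover have "(\<integral>\<gamma>. f \<gamma> * \<gamma> \<xi> \<partial>\<mu>) = (\<integral>\<gamma>. g \<gamma> * \<gamma> \<xi> \<partial>\<mu>)" for \<xi>
    by (rule integral_chars_cong) (simp add: assms)
  ultimately show ?thesis using assms(1) by (simp add: char_orthogonal_def)
qed

text \<open>The bounded multipliers form an algebra that is closed under bounded pointwise limits, hence
  contains the indicators of a \<open>\<sigma>\<close>-algebra; since it contains the real and imaginary parts of the
  evaluations \<open>\<gamma> \<mapsto> \<gamma> \<xi>\<close>, this is the whole Baire \<open>\<sigma>\<close>-algebra.\<close>

definition multiplier :: "(('x \<Rightarrow> complex) \<Rightarrow> real) \<Rightarrow> bool" where
  "multiplier g \<longleftrightarrow> g \<in> borel_measurable \<mu> \<and>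
     (\<forall>f. char_orthogonal f \<longrightarrow> char_orthogonal (\<lambda>\<gamma>. f \<gamma> * of_real (g \<gamma>)))"

lemma multiplier_measurable [measurable_dest]: "multiplier g \<Longrightarrow> g \<in> borel_measurable \<mu>"
  and multiplierD: "multiplier g \<Longrightarrow> char_orthogonal f \<Longrightarrow> char_orthogonal (\<lambda>\<gamma>. f \<gamma> * of_real (g \<gamma>))"
  by (simp_all add: multiplier_def)

lemma multiplier_cong:
  assumes "multiplier g" "\<And>\<gamma>. \<gamma> \<in> chars \<Longrightarrow> g \<gamma> = h \<gamma>"
  shows "multiplier h"
proof -
  have "h \<in> borel_measurable \<mu> \<longleftrightarrow> g \<in> borel_measurable \<mu>"
    by (rule measurable_cong) (simp add: space_haar assms(2))
  moreover have "char_orthogonal (\<lambda>\<gamma>. f \<gamma> * of_real (h \<gamma>))" if "char_orthogonal f" for f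
    by (rule char_orthogonal_cong[OF multiplierD[OF assms(1) that]]) (simp add: assms(2))
  ultimately show ?thesis using assms(1) by (simp add: multiplier_def)
qed

lemma multiplier_const: "multiplier (\<lambda>\<gamma>. c)"
  using char_orthogonal_lincomb[of _ _ "of_real c" 0] by (auto simp: multiplier_def mult.commute)

lemma multiplier_mult: "multiplier g \<Longrightarrow> multiplier h \<Longrightarrow> multiplier (\<lambda>\<gamma>. g \<gamma> * h \<gamma>)"
  unfolding multiplier_def by (auto simp flip: mult.assoc)

lemma multiplier_add:
  assumes "multiplier g" "multiplier h"
  shows "multiplier (\<lambda>\<gamma>. g \<gamma> + h \<gamma>)"
proof -
  have "char_orthogonal (\<lambda>\<gamma>. f \<gamma> * of_real (g \<gamma> + h \<gamma>))" if "char_orthogonal f" for f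
    using char_orthogonal_lincomb[OF multiplierD[OF assms(1) that]
          multiplierD[OF assms(2) that], of 1 1]
    by (simp add: ring_distribs)
  then show ?thesis using assms by (auto simp: multiplier_def)
qed

lemma multiplier_limit:
  fixes s :: "nat \<Rightarrow> ('x \<Rightarrow> complex) \<Rightarrow> real"
  assumes s: "\<And>n. multiplier (s n)" and bound: "\<And>n \<gamma>. \<gamma> \<in> chars \<Longrightarrow> \<bar>s n \<gamma>\<bar> \<le> C"
    and lim: "\<And>\<gamma>. \<gamma> \<in> chars \<Longrightarrow> (\<lambda>n. s n \<gamma>) \<longlonglongrightarrow> g \<gamma>"
  shows "multiplier g"
proof -
  have [measurable]: "g \<in> borel_measurable \<mu>"
    using lim
    by (intro borel_measurable_LIMSEQ_real[OF _ multiplier_measurable[OF s]]) (simp add: space_haar)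
  have gC: "\<bar>g \<gamma>\<bar> \<le> C" if "\<gamma> \<in> chars" for \<gamma>
    using lim[OF that] bound[OF that] by (intro LIMSEQ_le_const2[OF tendsto_rabs]) auto
  have "char_orthogonal (\<lambda>\<gamma>. f \<gamma> * of_real (g \<gamma>))" if f: "char_orthogonal f" for f
  proof -
    have fs: "char_orthogonal (\<lambda>\<gamma>. f \<gamma> * of_real (s n \<gamma>))" for n by (rule multiplierD[OF s f])
    have int: "integrable \<mu> (\<lambda>\<gamma>. f \<gamma> * of_real (g \<gamma>))"
      using f gC
      by (intro integrable_bounded_mult[where C = C] AE_chars) (auto simp: char_orthogonal_def)
    have "(\<integral>\<gamma>. f \<gamma> * of_real (g \<gamma>) * \<gamma> \<xi> \<partial>\<mu>) = 0" for \<xi>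
    proof (rule LIMSEQ_unique)
      show "(\<lambda>n. \<integral>\<gamma>. f \<gamma> * of_real (s n \<gamma>) * \<gamma> \<xi> \<partial>\<mu>) \<longlonglongrightarrow> (\<integral>\<gamma>. f \<gamma> * of_real (g \<gamma>) * \<gamma> \<xi> \<partial>\<mu>)"
      proof (rule integral_dominated_convergence)
        show "integrable \<mu> (\<lambda>\<gamma>. C * cmod (f \<gamma>))" using f by (auto simp: char_orthogonal_def)
        show "AE \<gamma> in \<mu>. (\<lambda>n. f \<gamma> * of_real (s n \<gamma>) * \<gamma> \<xi>) \<longlonglongrightarrow> f \<gamma> * of_real (g \<gamma>) * \<gamma> \<xi>"
          by (intro AE_chars tendsto_intros lim)
        show "AE \<gamma> in \<mu>. norm (f \<gamma> * of_real (s n \<gamma>) * \<gamma> \<xi>) \<le> C * cmod (f \<gamma>)" for n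
          using bound
          by (intro AE_chars) (simp add: norm_mult chars_norm mult.commute[of C] mult_left_mono)
      qed (use int fs integrable_mult_char in
          \<open>auto simp: char_orthogonal_def intro!: borel_measurable_integrable\<close>)
      show "(\<lambda>n. \<integral>\<gamma>. f \<gamma> * of_real (s n \<gamma>) * \<gamma> \<xi> \<partial>\<mu>) \<longlonglongrightarrow> 0"
        using fs by (simp add: char_orthogonal_def)
    qed
    with int show ?thesis by (simp add: char_orthogonal_def)
  qed
  then show ?thesis by (simp add: multiplier_def)
qed

lemma multiplier_polynomial:
  assumes "real_polynomial_function q" "multiplier g"
  shows "multiplier (\<lambda>\<gamma>. q (g \<gamma>))"
  using assms(1)
proof induction
  case (linear h)
  have "h (g \<gamma>) = h 1 * g \<gamma>" for \<gamma>
    using linear_cmul[OF bounded_linear.linear[OF linear], of "g \<gamma>" 1] by (simp add: mult.commute)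
  then show ?case using multiplier_mult[OF multiplier_const[of "h 1"] assms(2)] by simp
next
  case (const c)
  show ?case by (rule multiplier_const)
next
  case (add q\<^sub>1 q\<^sub>2)
  then show ?case by (intro multiplier_add)
next
  case (mult q\<^sub>1 q\<^sub>2)
  then show ?case by (intro multiplier_mult)
qed

lemma multiplier_continuous:
  assumes g: "multiplier g" "\<And>\<gamma>. \<gamma> \<in> chars \<Longrightarrow> \<bar>g \<gamma>\<bar> \<le> B" and q: "continuous_on {-B..B} q"
  shows "multiplier (\<lambda>\<gamma>. q (g \<gamma>))"
proof -
  have "\<exists>h. real_polynomial_function h \<and> (\<forall>t\<in>{-B..B}. \<bar>q t - h t\<bar> < 1 / real (Suc n))" for n
    by (rule Stone_Weierstrass_real_polynomial_function[OF compact_Icc q, of "1 / real (Suc n)"])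
        auto
  then obtain h where h: "\<And>n. real_polynomial_function (h n)"
    "\<And>n t. t \<in> {-B..B} \<Longrightarrow> \<bar>q t - h n t\<bar> < 1 / real (Suc n)"
    by metis
  obtain K where K: "\<And>t. t \<in> {-B..B} \<Longrightarrow> \<bar>q t\<bar> \<le> K"
    using compact_imp_bounded[OF compact_continuous_image[OF q compact_Icc]] unfolding bounded_real
    by blast
  show ?thesis
  proof (rule multiplier_limit)
    show "multiplier (\<lambda>\<gamma>. h n (g \<gamma>))" for n by (rule multiplier_polynomial[OF h(1) g(1)])
    fix \<gamma> :: "'x \<Rightarrow> complex" assume "\<gamma> \<in> chars"
    then have mem: "g \<gamma> \<in> {-B..B}" using g(2)[of \<gamma>] by auto
    show "\<bar>h n (g \<gamma>)\<bar> \<le> K + 1" for n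
    proof -
      have "1 / real (Suc n) \<le> 1" by simp
      then show ?thesis using h(2)[OF mem, of n] K[OF mem] by linarith
    qed
    show "(\<lambda>n. h n (g \<gamma>)) \<longlonglongrightarrow> q (g \<gamma>)"
    proof (rule LIM_zero_cancel, rule Lim_null_comparison)
      show "\<forall>\<^sub>F n in sequentially. norm (h n (g \<gamma>) - q (g \<gamma>)) \<le> 1 / real (Suc n)"
        using h(2)[OF mem] by (auto intro!: always_eventually less_imp_le simp: abs_minus_commute)
      show "(\<lambda>n. 1 / real (Suc n)) \<longlonglongrightarrow> 0" by (rule LIMSEQ_Suc[OF lim_1_over_n])
    qed
  qed
qed

lemma multiplier_indicator_superlevel:
  assumes g: "multiplier g" "\<And>\<gamma>. \<gamma> \<in> chars \<Longrightarrow> \<bar>g \<gamma>\<bar> \<le> B"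
  shows "multiplier (indicator {\<gamma> \<in> chars. a < g \<gamma>})"
proof (rule multiplier_limit[where s = "\<lambda>n \<gamma>. min 1 (max 0 (real n * (g \<gamma> - a)))" and C = 1])
  show "multiplier (\<lambda>\<gamma>. min 1 (max 0 (real n * (g \<gamma> - a))))" for n
    by (rule multiplier_continuous[OF g, of "\<lambda>t. min 1 (max 0 (real n * (t - a)))"])
      (auto intro!: continuous_intros)
  fix \<gamma> :: "'x \<Rightarrow> complex" assume \<gamma>: "\<gamma> \<in> chars"
  show "(\<lambda>n. min 1 (max 0 (real n * (g \<gamma> - a)))) \<longlonglongrightarrow> indicator {\<gamma> \<in> chars. a < g \<gamma>} \<gamma>"
  proof (cases "a < g \<gamma>")
    case True
    have "filterlim (\<lambda>n. real n * (g \<gamma> - a)) at_top sequentially"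
      using True
      by (intro filterlim_at_top_mult_tendsto_pos[OF tendsto_const] filterlim_real_sequentially)
          auto
    then have "\<forall>\<^sub>F n in sequentially. 1 \<le> real n * (g \<gamma> - a)" by (simp add: filterlim_at_top)
    then have "\<forall>\<^sub>F n in sequentially. min 1 (max 0 (real n * (g \<gamma> - a))) = 1"
      by eventually_elim simp
    then show ?thesis using True \<gamma> by (simp add: tendsto_eventually)
  next
    case False
    then have "max 0 (real n * (g \<gamma> - a)) = 0" for n by (intro max_absorb1 mult_nonneg_nonpos) auto
    then show ?thesis using False by simp
  qed
qed auto

definition multiplier_sets :: "('x \<Rightarrow> complex) set set" where
  "multiplier_sets = {E \<in> sets \<mu>. multiplier (indicator E)}"

lemma sigma_algebra_multiplier_sets: "sigma_algebra chars multiplier_sets"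
  unfolding sigma_algebra_iff2
proof (intro conjI ballI allI impI)
  show "multiplier_sets \<subseteq> Pow chars"
    unfolding multiplier_sets_def using sets.sets_into_space[of _ \<mu>] space_haar by auto
  show "{} \<in> multiplier_sets" using multiplier_const[of 0]
    by (simp add: multiplier_sets_def indicator_def[abs_def])
next
  fix E assume "E \<in> multiplier_sets"
  then have E: "E \<in> sets \<mu>" "multiplier (indicator E)" by (auto simp: multiplier_sets_def)
  have "multiplier (\<lambda>\<gamma>. 1 + - 1 * indicator E \<gamma>)"
    by (intro multiplier_add multiplier_mult multiplier_const E(2))
  then have "multiplier (indicator (chars - E))"
    by (rule multiplier_cong) (auto simp: indicator_def)
  then show "chars - E \<in> multiplier_sets"
    using sets.compl_sets[OF E(1)] by (simp add: multiplier_sets_def space_haar)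
next
  fix A :: "nat \<Rightarrow> ('x \<Rightarrow> complex) set" assume "range A \<subseteq> multiplier_sets"
  then have A: "A n \<in> sets \<mu>" "multiplier (indicator (A n))" for n
    by (auto simp: multiplier_sets_def)
  have finite_union: "multiplier (indicator (\<Union>i<n. A i))" for n
  proof (induction n)
    case 0
    show ?case using multiplier_const[of 0] by (simp add: indicator_def[abs_def])
  next
    case (Suc n)
    have "multiplier (\<lambda>\<gamma>. indicator (\<Union>i<n. A i) \<gamma> + (1 + - 1 * indicator (\<Union>i<n. A i) \<gamma>) * indicator (A n) \<gamma>)"
      by (intro multiplier_add multiplier_mult multiplier_const A(2) Suc)
    then show ?case by (rule multiplier_cong) (auto simp: indicator_def lessThan_Suc)
  qed
  have "multiplier (indicator (\<Union>i. A i))"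
    by (rule multiplier_limit[where C = 1, OF finite_union _ LIMSEQ_indicator_UN])
      (simp add: indicator_def)
  then show "(\<Union>i. A i) \<in> multiplier_sets" using A(1) by (auto simp: multiplier_sets_def)
qed

lemma multiplier_Re_eval: "multiplier (\<lambda>\<gamma>. Re (\<gamma> \<xi>))"
proof -
  have "char_orthogonal (\<lambda>\<gamma>. f \<gamma> * of_real (Re (\<gamma> \<xi>)))" if "char_orthogonal f" for f
  proof -
    have "char_orthogonal (\<lambda>\<gamma>. (1/2) * (f \<gamma> * \<gamma> \<xi>) + (1/2) * (f \<gamma> * \<gamma> (- \<xi>)))"
      by (intro char_orthogonal_lincomb char_orthogonal_mult_char that)
    then show ?thesis
      by (rule char_orthogonal_cong) (simp add: chars_uminus complex_eq_iff field_simps)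
  qed
  then show ?thesis by (simp add: multiplier_def)
qed

lemma multiplier_Im_eval: "multiplier (\<lambda>\<gamma>. Im (\<gamma> \<xi>))"
proof -
  have "char_orthogonal (\<lambda>\<gamma>. f \<gamma> * of_real (Im (\<gamma> \<xi>)))" if "char_orthogonal f" for f
  proof -
    have "char_orthogonal (\<lambda>\<gamma>. (- \<i>/2) * (f \<gamma> * \<gamma> \<xi>) + (\<i>/2) * (f \<gamma> * \<gamma> (- \<xi>)))"
      by (intro char_orthogonal_lincomb char_orthogonal_mult_char that)
    then show ?thesis
      by (rule char_orthogonal_cong) (simp add: chars_uminus complex_eq_iff field_simps)
  qed
  then show ?thesis by (simp add: multiplier_def)
qed

lemma multiplier_indicator:
  assumes "E \<in> sets \<mu>"
  shows "multiplier (indicator E)"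
proof -
  interpret sigma_algebra chars multiplier_sets by (rule sigma_algebra_multiplier_sets)
  define S where "S = sigma chars multiplier_sets"
  have S: "sets S = multiplier_sets" "space S = chars"
    unfolding S_def using sets_measure_of_eq space_closed by auto
  have measurable_S: "g \<in> borel_measurable S" if "multiplier g" "\<And>\<gamma>. \<gamma> \<in> chars \<Longrightarrow> \<bar>g \<gamma>\<bar> \<le> 1" for g
    unfolding borel_measurable_iff_greater S
  proof
    fix a
    have "{\<gamma> \<in> chars. a < g \<gamma>} \<in> sets \<mu>"
      using multiplier_measurable[OF that(1)] unfolding borel_measurable_iff_greater space_haar
      by simp
    then show "{\<gamma> \<in> chars. a < g \<gamma>} \<in> multiplier_sets"
      using multiplier_indicator_superlevel[OF that] by (simp add: multiplier_sets_def)
  qed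
  have "\<bar>Re (\<gamma> \<xi>)\<bar> \<le> 1" "\<bar>Im (\<gamma> \<xi>)\<bar> \<le> 1" if "\<gamma> \<in> chars" for \<gamma> :: "'x \<Rightarrow> complex" and \<xi>
    using abs_Re_le_cmod[of "\<gamma> \<xi>"] abs_Im_le_cmod[of "\<gamma> \<xi>"] chars_norm[OF that, of \<xi>] by simp_all
  then have "(\<lambda>\<gamma>. \<gamma> \<xi>) \<in> borel_measurable S" for \<xi>
    unfolding borel_measurable_complex_iff
    by (auto intro!: measurable_S multiplier_Re_eval multiplier_Im_eval)
  then have "(\<lambda>\<gamma>. \<gamma>) \<in> measurable S \<mu>" by (intro measurable_haarI) (auto simp: S)
  from measurable_sets[OF this assms] have "E \<in> multiplier_sets"
    using sets.sets_into_space[OF assms] by (simp add: S space_haar Int_absorb2)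
  then show ?thesis by (simp add: multiplier_sets_def)
qed

lemma char_orthogonal_imp_AE_zero:
  assumes "char_orthogonal f"
  shows "AE \<gamma> in \<mu>. f \<gamma> = 0"
proof (rule density_zero)
  show "integrable \<mu> f" using assms by (simp add: char_orthogonal_def)
  fix E assume "E \<in> sets \<mu>"
  from multiplierD[OF multiplier_indicator[OF this] assms]
  have "(\<integral>\<gamma>. f \<gamma> * of_real (indicator E \<gamma>) * \<gamma> 0 \<partial>\<mu>) = 0" by (simp add: char_orthogonal_def)
  also have "(\<integral>\<gamma>. f \<gamma> * of_real (indicator E \<gamma>) * \<gamma> 0 \<partial>\<mu>) = set_lebesgue_integral \<mu> E f"
    unfolding set_lebesgue_integral_def
    by (rule integral_chars_cong) (simp add: chars_0 scaleR_conv_of_real mult.commute)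
  finally show "set_lebesgue_integral \<mu> E f = 0" .
qed

theorem fourier_eq_imp_AE_eq:
  assumes f: "integrable \<mu> f" and g: "integrable \<mu> g" and eq: "\<And>\<xi>. ft f \<xi> = ft g \<xi>"
  shows "AE \<gamma> in \<mu>. f \<gamma> = g \<gamma>"
proof -
  have "(\<integral>\<gamma>. (f \<gamma> - g \<gamma>) * \<gamma> \<xi> \<partial>\<mu>) = 0" for \<xi>
  proof -
    have "(\<integral>\<gamma>. h \<gamma> * \<gamma> \<xi> \<partial>\<mu>) = ft h (- \<xi>)" for h
      unfolding fourier_def by (rule integral_chars_cong) (simp add: chars_uminus)
    then show ?thesis
      using eq integrable_mult_char[OF f] integrable_mult_char[OF g]
      by (simp add: left_diff_distrib)
  qed
  then have "char_orthogonal (\<lambda>\<gamma>. f \<gamma> - g \<gamma>)" using f g by (simp add: char_orthogonal_def)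
  from char_orthogonal_imp_AE_zero[OF this] show ?thesis by simp
qed

end


section \<open>Fourier series and the Riesz--Fischer theorem\<close>

definition trig_poly :: "'x set \<Rightarrow> ('x \<Rightarrow> complex) \<Rightarrow> ('x \<Rightarrow> complex) \<Rightarrow> complex" where
  "trig_poly F k \<gamma> = (\<Sum>\<xi>\<in>F. k \<xi> * \<gamma> \<xi>)"

definition trig_polys :: "'x set \<Rightarrow> (('x \<Rightarrow> complex) \<Rightarrow> complex) set" where
  "trig_polys A = {trig_poly F k | F k. finite F \<and> F \<subseteq> A}"

lemma trig_polyI: "finite F \<Longrightarrow> F \<subseteq> A \<Longrightarrow> trig_poly F k \<in> trig_polys A"
  unfolding trig_polys_def by blast

lemma trig_polysE:
  assumes "q \<in> trig_polys A"
  obtains F k where "q = trig_poly F k" "finite F" "F \<subseteq> A"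
  using assms unfolding trig_polys_def by blast

lemma trig_polys_zero: "(\<lambda>\<gamma>. 0) \<in> trig_polys A"
  using trig_polyI[of "{}" A] by (simp add: trig_poly_def[abs_def])

lemma eval_in_trig_polys: "\<xi> \<in> A \<Longrightarrow> (\<lambda>\<gamma>. \<gamma> \<xi>) \<in> trig_polys A"
  using trig_polyI[of "{\<xi>}" A "\<lambda>_. 1"] by (simp add: trig_poly_def[abs_def])

lemma trig_poly_eq_superset:
  assumes "finite G" "F \<subseteq> G"
  shows "trig_poly F k = trig_poly G (truncate F k)"
proof
  show "trig_poly F k \<gamma> = trig_poly G (truncate F k) \<gamma>" for \<gamma>
    unfolding trig_poly_def truncate_def using assms by (intro sum.mono_neutral_cong_left) auto
qed

lemma trig_polys_lincomb:
  assumes "d \<in> trig_polys A" "e \<in> trig_polys A"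
  shows "(\<lambda>\<gamma>. c * d \<gamma> + e \<gamma>) \<in> trig_polys A"
proof -
  obtain F k where F: "d = trig_poly F k" "finite F" "F \<subseteq> A" using assms(1) by (rule trig_polysE)
  obtain G l where G: "e = trig_poly G l" "finite G" "G \<subseteq> A" using assms(2) by (rule trig_polysE)
  have "d = trig_poly (F \<union> G) (truncate F k)" "e = trig_poly (F \<union> G) (truncate G l)"
    unfolding F(1) G(1) using F G by (intro trig_poly_eq_superset; simp)+
  then have "(\<lambda>\<gamma>. c * d \<gamma> + e \<gamma>) = trig_poly (F \<union> G) (\<lambda>\<xi>. c * truncate F k \<xi> + truncate G l \<xi>)"
    by (simp add: fun_eq_iff trig_poly_def sum_distrib_left sum.distrib ring_distribs mult.assoc)
  then show ?thesis using F G by (simp add: trig_polyI)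
qed

context haar_measure
begin

abbreviation nrm :: "(('x \<Rightarrow> complex) \<Rightarrow> complex) \<Rightarrow> real" where
  "nrm \<equiv> L2_norm \<mu>"

abbreviation ip :: "(('x \<Rightarrow> complex) \<Rightarrow> complex) \<Rightarrow> (('x \<Rightarrow> complex) \<Rightarrow> complex) \<Rightarrow> complex" where
  "ip \<equiv> L2_inner \<mu>"

lemma AE_norm_char: "AE \<gamma> in \<mu>. cmod (\<gamma> \<xi>) = 1"
  by (rule AE_chars) (rule chars_norm)

lemma char_L2: "(\<lambda>\<gamma>. \<gamma> \<xi>) \<in> L2 \<mu>"
  by (rule L2_unimodular[OF borel_measurable_eval AE_norm_char])

lemma one_L2: "(\<lambda>\<gamma>. 1) \<in> L2 \<mu>"
  by (rule L2_unimodular) auto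

lemma L2_mult_char: "f \<in> L2 \<mu> \<Longrightarrow> (\<lambda>\<gamma>. f \<gamma> * \<gamma> \<xi>) \<in> L2 \<mu>"
  unfolding mult.commute[of "f _"]
  by (rule L2_bounded_mult[where C = 1]) (auto intro!: AE_chars simp: chars_norm)

lemma fourier_eq_inner: "ft f \<xi> = ip f (\<lambda>\<gamma>. \<gamma> \<xi>)"
  by (simp add: fourier_def L2_inner_def)

lemma fourier_char: "ft (\<lambda>\<gamma>. \<gamma> \<eta>) \<xi> = (if \<xi> = \<eta> then 1 else 0)"
proof -
  have "ft (\<lambda>\<gamma>. \<gamma> \<eta>) \<xi> = (\<integral>\<gamma>. \<gamma> (\<eta> - \<xi>) \<partial>\<mu>)"
    unfolding fourier_def by (rule integral_chars_cong) (simp add: chars_diff)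
  moreover have "(\<integral>\<gamma>. \<gamma> 0 \<partial>\<mu>) = (\<integral>\<gamma>. 1 \<partial>\<mu>)" by (rule integral_chars_cong) (simp add: chars_0)
  ultimately show ?thesis using integral_char_eq_0[of "\<eta> - \<xi>"] by (auto simp: prob_space)
qed

lemma fourier_at_0: "ft f 0 = (\<integral>\<gamma>. f \<gamma> \<partial>\<mu>)"
  unfolding fourier_def by (rule integral_chars_cong) (simp add: chars_0)

lemma fourier_one: "ft (\<lambda>\<gamma>. 1) \<xi> = (if \<xi> = 0 then 1 else 0)"
proof -
  have "ft (\<lambda>\<gamma>. 1) \<xi> = ft (\<lambda>\<gamma>. \<gamma> 0) \<xi>"
    unfolding fourier_def by (rule integral_chars_cong) (simp add: chars_0)
  then show ?thesis by (simp add: fourier_char)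
qed

lemma fourier_add: "f \<in> L2 \<mu> \<Longrightarrow> g \<in> L2 \<mu> \<Longrightarrow> ft (\<lambda>\<gamma>. f \<gamma> + g \<gamma>) \<xi> = ft f \<xi> + ft g \<xi>"
  and fourier_diff: "f \<in> L2 \<mu> \<Longrightarrow> g \<in> L2 \<mu> \<Longrightarrow> ft (\<lambda>\<gamma>. f \<gamma> - g \<gamma>) \<xi> = ft f \<xi> - ft g \<xi>"
  and fourier_cmult: "ft (\<lambda>\<gamma>. c * f \<gamma>) \<xi> = c * ft f \<xi>"
  by (simp_all add: fourier_eq_inner L2_inner_add_left L2_inner_diff_left L2_inner_cmult_left
      char_L2)

lemma fourier_cnj: "ft (\<lambda>\<gamma>. cnj (f \<gamma>)) \<xi> = cnj (ft f (- \<xi>))"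
proof -
  have "ft (\<lambda>\<gamma>. cnj (f \<gamma>)) \<xi> = (\<integral>\<gamma>. cnj (f \<gamma> * cnj (\<gamma> (- \<xi>))) \<partial>\<mu>)"
    unfolding fourier_def by (rule integral_chars_cong) (simp add: chars_uminus)
  then show ?thesis unfolding fourier_def by (simp only: Bochner_Integration.integral_cnj)
qed

lemma fourier_mult_char: "ft (\<lambda>\<gamma>. f \<gamma> * \<gamma> \<eta>) \<xi> = ft f (\<xi> - \<eta>)"
  unfolding fourier_def by (rule integral_chars_cong) (simp add: chars_diff)

lemma inner_mult_char: "ip (\<lambda>\<gamma>. f \<gamma> * \<gamma> \<xi>) g = ip f (\<lambda>\<gamma>. g \<gamma> * \<gamma> (- \<xi>))"
  unfolding L2_inner_def by (rule integral_chars_cong) (simp add: chars_uminus mult_ac)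

lemma fourier_cong_AE:
  assumes "f \<in> borel_measurable \<mu>" "g \<in> borel_measurable \<mu>" "AE \<gamma> in \<mu>. f \<gamma> = g \<gamma>"
  shows "ft f = ft g"
  unfolding fourier_def using assms by (auto intro!: ext integral_cong_AE)

lemma L2_fourier_eq_iff:
  assumes "f \<in> L2 \<mu>" "g \<in> L2 \<mu>"
  shows "ft f = ft g \<longleftrightarrow> (AE \<gamma> in \<mu>. f \<gamma> = g \<gamma>)"
  using fourier_eq_imp_AE_eq[OF L2_integrable L2_integrable, OF assms]
    fourier_cong_AE[OF L2_measurable L2_measurable, OF assms] by metis

lemma cmod_fourier_le: "f \<in> L2 \<mu> \<Longrightarrow> cmod (ft f \<xi>) \<le> nrm f"
  unfolding fourier_eq_inner
  using L2_Cauchy_Schwarz[OF _ char_L2, of f \<xi>]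
    L2_norm_unimodular[OF borel_measurable_eval AE_norm_char, of \<xi>]
  by simp

lemma tendsto_fourier:
  assumes "\<And>i. s i \<in> L2 \<mu>" "f \<in> L2 \<mu>" "L2_tendsto \<mu> s f F"
  shows "((\<lambda>i. ft (s i) \<xi>) \<longlongrightarrow> ft f \<xi>) F"
  unfolding fourier_eq_inner by (rule tendsto_L2_inner[OF assms(1,2) char_L2 assms(3)])

lemma trig_poly_L2: "trig_poly F k \<in> L2 \<mu>"
  unfolding trig_poly_def[abs_def] by (intro L2_sum L2_cmult char_L2)

lemma trig_polys_L2: "q \<in> trig_polys A \<Longrightarrow> q \<in> L2 \<mu>"
  by (elim trig_polysE) (simp add: trig_poly_L2)

lemma inner_trig_poly_left:
  assumes "f \<in> L2 \<mu>"
  shows "ip (trig_poly F k) f = (\<Sum>\<xi>\<in>F. k \<xi> * cnj (ft f \<xi>))"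
proof -
  have "ip (trig_poly F k) f = (\<Sum>\<xi>\<in>F. ip (\<lambda>\<gamma>. k \<xi> * \<gamma> \<xi>) f)"
    unfolding trig_poly_def[abs_def] by (rule L2_inner_sum_left[OF L2_cmult[OF char_L2] assms])
  then show ?thesis
    using L2_inner_commute[of \<mu> "\<lambda>\<gamma>. \<gamma> _" f] by (simp add: L2_inner_cmult_left fourier_eq_inner)
qed

lemma fourier_trig_poly:
  assumes "finite F"
  shows "ft (trig_poly F k) = truncate F k"
proof
  fix \<eta>
  have "ft (trig_poly F k) \<eta> = (\<Sum>\<xi>\<in>F. k \<xi> * (if \<xi> = \<eta> then 1 else 0))"
    unfolding fourier_eq_inner[of "trig_poly F k"] inner_trig_poly_left[OF char_L2]
    by (simp add: fourier_char if_distrib cong: if_cong)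
  then show "ft (trig_poly F k) \<eta> = truncate F k \<eta>"
    using assms by (simp add: truncate_def if_distrib sum.delta' cong: if_cong)
qed

lemma fourier_partial_sum_best_approx:
  assumes f: "f \<in> L2 \<mu>" and F: "finite F" "G \<subseteq> F"
  shows "nrm (\<lambda>\<gamma>. trig_poly F (ft f) \<gamma> - f \<gamma>) \<le> nrm (\<lambda>\<gamma>. trig_poly G k \<gamma> - f \<gamma>)"
proof (rule power2_le_imp_le)
  define r where "r = (\<lambda>\<gamma>. trig_poly F (ft f) \<gamma> - f \<gamma>)"
  define l where "l = (\<lambda>\<xi>. truncate G k \<xi> - ft f \<xi>)"
  have r: "r \<in> L2 \<mu>" unfolding r_def by (intro L2_diff f trig_poly_L2)
  have "ft r \<xi> = 0" if "\<xi> \<in> F" for \<xi>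
    unfolding r_def by (simp add: fourier_diff f trig_poly_L2 fourier_trig_poly F truncate_def that)
  then have "ip (trig_poly F l) r = 0" unfolding inner_trig_poly_left[OF r] by simp
  moreover have "(\<lambda>\<gamma>. trig_poly G k \<gamma> - f \<gamma>) = (\<lambda>\<gamma>. trig_poly F l \<gamma> + r \<gamma>)"
    unfolding r_def l_def trig_poly_eq_superset[OF F, of k]
    by (simp add: fun_eq_iff trig_poly_def algebra_simps sum_subtractf)
  ultimately have "(nrm (\<lambda>\<gamma>. trig_poly G k \<gamma> - f \<gamma>))\<^sup>2 = (nrm (trig_poly F l))\<^sup>2 + (nrm r)\<^sup>2"
    using L2_norm_add_sq[OF trig_poly_L2[of F l] r] by simp
  then show "(nrm (\<lambda>\<gamma>. trig_poly F (ft f) \<gamma> - f \<gamma>))\<^sup>2 \<le> (nrm (\<lambda>\<gamma>. trig_poly G k \<gamma> - f \<gamma>))\<^sup>2"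
    unfolding r_def by simp
qed simp

lemma trig_polys_dense:
  assumes f: "f \<in> L2 \<mu>" and "e > 0"
  obtains q where "q \<in> trig_polys UNIV" "nrm (\<lambda>\<gamma>. q \<gamma> - f \<gamma>) < e"
proof -
  have "L2_subspace \<mu> (trig_polys UNIV)"
    using trig_polys_L2 trig_polys_zero by (auto simp: L2_subspace_def intro!: trig_polys_lincomb)
  from L2_projection[OF this f] obtain v q where v: "v \<in> L2 \<mu>" and q: "\<And>n. q n \<in> trig_polys UNIV"
    and lim: "L2_tendsto \<mu> (\<lambda>n \<gamma>. f \<gamma> - q n \<gamma>) v sequentially"
    and orth: "\<And>d. d \<in> trig_polys UNIV \<Longrightarrow> ip v d = 0"
    by blast
  have "ft v = ft (\<lambda>\<gamma>. 0)"
    using orth[OF eval_in_trig_polys] by (simp add: fun_eq_iff fourier_eq_inner L2_inner_def)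
  then have "nrm v = 0"
    unfolding L2_fourier_eq_iff[OF v L2_zero] L2_norm_eq_0_iff[OF v] .
  then have "(\<lambda>n. nrm (\<lambda>\<gamma>. f \<gamma> - q n \<gamma>)) \<longlonglongrightarrow> 0"
    using tendsto_L2_norm[OF L2_diff[OF f trig_polys_L2[OF q]] v lim] by simp
  then have "\<forall>\<^sub>F n in sequentially. nrm (\<lambda>\<gamma>. f \<gamma> - q n \<gamma>) < e" using \<open>e > 0\<close>
    by (rule order_tendstoD)
  then obtain n where "nrm (\<lambda>\<gamma>. f \<gamma> - q n \<gamma>) < e" unfolding eventually_sequentially by blast
  with q show ?thesis by (intro that[of "q n"]) (simp_all add: L2_norm_diff_commute[of \<mu> f])
qed

theorem fourier_series_converges:
  assumes f: "f \<in> L2 \<mu>"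
  shows "L2_tendsto \<mu> (\<lambda>F. trig_poly F (ft f)) f (finite_subsets_at_top UNIV)"
  unfolding L2_tendsto_def
proof (rule tendstoI)
  fix e :: real assume "e > 0"
  then obtain q where "q \<in> trig_polys UNIV" "nrm (\<lambda>\<gamma>. q \<gamma> - f \<gamma>) < e"
    by (rule trig_polys_dense[OF f])
  then obtain G k where G: "finite G" "nrm (\<lambda>\<gamma>. trig_poly G k \<gamma> - f \<gamma>) < e"
    by (auto elim: trig_polysE)
  have "dist (nrm (\<lambda>\<gamma>. trig_poly F (ft f) \<gamma> - f \<gamma>)) 0 < e" if "finite F" "G \<subseteq> F" for F
    using fourier_partial_sum_best_approx[OF f that, of k] G(2) by simp
  then show "\<forall>\<^sub>F F in finite_subsets_at_top UNIV. dist (nrm (\<lambda>\<gamma>. trig_poly F (ft f) \<gamma> - f \<gamma>)) 0 < e"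
    unfolding eventually_finite_subsets_at_top using G(1) by blast
qed

theorem parseval:
  assumes f: "f \<in> L2 \<mu>" and g: "g \<in> L2 \<mu>"
  shows "((\<lambda>\<xi>. ft f \<xi> * cnj (ft g \<xi>)) has_sum ip f g) UNIV"
  unfolding has_sum_def
  using tendsto_L2_inner[OF trig_poly_L2 f g fourier_series_converges[OF f]]
  by (simp add: inner_trig_poly_left[OF g])

lemma has_sum_fourier_norm_sq: "f \<in> L2 \<mu> \<Longrightarrow> ((\<lambda>\<xi>. (cmod (ft f \<xi>))\<^sup>2) has_sum (nrm f)\<^sup>2) UNIV"
  using has_sum_Re[OF parseval[of f f]]
  by (simp add: L2_inner_self complex_norm_square[symmetric] del: of_real_power flip: of_real_power)

lemma fourier_l2space: "f \<in> L2 \<mu> \<Longrightarrow> ft f \<in> l2space UNIV"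
  using has_sum_fourier_norm_sq by (auto simp: l2space_def summable_on_def)

lemma l2norm_fourier: "f \<in> L2 \<mu> \<Longrightarrow> l2norm (ft f) = nrm f"
  unfolding l2norm_def using infsumI[OF has_sum_fourier_norm_sq] by simp

lemma l2norm_fourier_diff:
  assumes "f \<in> L2 \<mu>" "g \<in> L2 \<mu>"
  shows "l2norm (\<lambda>\<xi>. ft f \<xi> - ft g \<xi>) = nrm (\<lambda>\<gamma>. f \<gamma> - g \<gamma>)"
  unfolding fourier_diff[OF assms, symmetric] by (rule l2norm_fourier[OF L2_diff[OF assms]])

lemma fourier_mult_has_sum:
  assumes f: "f \<in> L2 \<mu>" and g: "g \<in> L2 \<mu>"
  shows "((\<lambda>\<eta>. ft f \<eta> * ft g (\<xi> - \<eta>)) has_sum ft (\<lambda>\<gamma>. f \<gamma> * g \<gamma>) \<xi>) UNIV"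
proof -
  have "((\<lambda>\<eta>. ft f \<eta> * cnj (ft (\<lambda>\<gamma>. cnj (g \<gamma>) * \<gamma> \<xi>) \<eta>)) has_sum
      ip f (\<lambda>\<gamma>. cnj (g \<gamma>) * \<gamma> \<xi>)) UNIV"
    by (rule parseval[OF f L2_mult_char[OF L2_cnj[OF g]]])
  moreover have "ip f (\<lambda>\<gamma>. cnj (g \<gamma>) * \<gamma> \<xi>) = ft (\<lambda>\<gamma>. f \<gamma> * g \<gamma>) \<xi>"
    by (simp add: L2_inner_def fourier_def mult.assoc)
  ultimately show ?thesis by (simp add: fourier_mult_char fourier_cnj)
qed

lemma L2_Cauchy_iff_fourier:
  assumes "\<And>n. s n \<in> L2 \<mu>"
  shows "L2_Cauchy \<mu> s \<longleftrightarrow> L2_Cauchy (count_space UNIV) (\<lambda>n. ft (s n))"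
  unfolding L2_Cauchy_def l2norm_eq_L2_norm[symmetric] by (simp add: l2norm_fourier_diff assms)

theorem riesz_fischer:
  assumes g: "g \<in> l2space UNIV"
  shows "\<exists>f. f \<in> L2 \<mu> \<and> ft f = g"
proof -
  have "\<exists>F. finite F \<and> l2norm (\<lambda>\<xi>. truncate F g \<xi> - g \<xi>) < 1 / real (Suc n)" for n
    using order_tendstoD(2)[OF l2_tendsto_truncate[OF g, unfolded L2_tendsto_def],
          of "1 / real (Suc n)"]
    by (auto simp: eventually_finite_subsets_at_top l2norm_eq_L2_norm)
  then obtain F
    where F: "\<And>n. finite (F n)" "\<And>n. l2norm (\<lambda>\<xi>. truncate (F n) g \<xi> - g \<xi>) < 1 / real (Suc n)"
    by metis
  have trunc_lim: "l2_tendsto (\<lambda>n. truncate (F n) g) g sequentially"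
    unfolding L2_tendsto_def
  proof (rule Lim_null_comparison)
    show "\<forall>\<^sub>F n in sequentially. norm (L2_norm (count_space UNIV) (\<lambda>\<xi>. truncate (F n) g \<xi> - g \<xi>))
        \<le> 1 / real (Suc n)"
      using F(2)[THEN less_imp_le] by (simp add: l2norm_eq_L2_norm)
    show "(\<lambda>n. 1 / real (Suc n)) \<longlonglongrightarrow> 0" by (rule LIMSEQ_Suc[OF lim_1_over_n])
  qed
  define s where "s n = trig_poly (F n) g" for n
  have s: "s n \<in> L2 \<mu>" and ft_s: "ft (s n) = truncate (F n) g" for n
    unfolding s_def by (rule trig_poly_L2) (rule fourier_trig_poly[OF F(1)])
  have "L2_Cauchy \<mu> s"
    unfolding L2_Cauchy_iff_fourier[OF s] ft_s
    by (rule L2_tendsto_imp_L2_Cauchy[OF l2space_L2[OF truncate_l2space[OF g]]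
            l2space_L2[OF g] trunc_lim])
  then obtain f where f: "f \<in> L2 \<mu>" and f_lim: "L2_tendsto \<mu> s f sequentially"
    by (rule L2_complete[OF s])
  have "ft f \<xi> = g \<xi>" for \<xi>
  proof (rule LIMSEQ_unique[OF tendsto_fourier[OF s f f_lim]])
    show "(\<lambda>n. ft (s n) \<xi>) \<longlonglongrightarrow> g \<xi>"
    proof (rule LIM_zero_cancel, rule Lim_null_comparison)
      show "(\<lambda>n. l2norm (\<lambda>\<xi>. truncate (F n) g \<xi> - g \<xi>)) \<longlonglongrightarrow> 0"
        using trunc_lim by (simp add: L2_tendsto_def l2norm_eq_L2_norm)
      show "\<forall>\<^sub>F n in sequentially. norm (ft (s n) \<xi> - g \<xi>) \<le> l2norm (\<lambda>\<xi>. truncate (F n) g \<xi> - g \<xi>)"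
        unfolding ft_s using cmod_le_l2norm[OF l2space_diff[OF truncate_l2space[OF g] g]] by simp
    qed
  qed
  with f show ?thesis by auto
qed

lemma is_check_imp_fourier:
  assumes "is_check \<mu> k f"
  shows "f \<in> L2 \<mu>" "ft f = k"
proof -
  show f: "f \<in> L2 \<mu>" using assms by (simp add: is_check_def L2_def)
  have "((\<lambda>F. nrm (\<lambda>\<gamma>. f \<gamma> - trig_poly F k \<gamma>)) \<longlongrightarrow> sqrt 0) (finite_subsets_at_top UNIV)"
    unfolding L2_norm_def trig_poly_def using assms
    by (intro tendsto_real_sqrt) (simp add: is_check_def)
  then have "L2_tendsto \<mu> (\<lambda>F. trig_poly F k) f (finite_subsets_at_top UNIV)"
    by (simp add: L2_tendsto_def L2_norm_diff_commute[of \<mu> f])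
  then have lim: "((\<lambda>F. ft (trig_poly F k) \<xi>) \<longlongrightarrow> ft f \<xi>) (finite_subsets_at_top UNIV)" for \<xi>
    by (intro tendsto_fourier f trig_poly_L2)
  show "ft f = k"
  proof
    fix \<xi>
    have "\<forall>\<^sub>F F in finite_subsets_at_top UNIV. ft (trig_poly F k) \<xi> = k \<xi>"
      unfolding eventually_finite_subsets_at_top
      by (rule exI[of _ "{\<xi>}"]) (auto simp: fourier_trig_poly truncate_def)
    from tendsto_unique[OF finite_subsets_at_top_neq_bot lim tendsto_eventually[OF this]]
    show "ft f \<xi> = k \<xi>" .
  qed
qed

definition fourier_inv :: "('x \<Rightarrow> complex) \<Rightarrow> ('x \<Rightarrow> complex) \<Rightarrow> complex" where
  "fourier_inv g = (SOME f. f \<in> L2 \<mu> \<and> ft f = g)"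

lemma fourier_inv_L2: "g \<in> l2space UNIV \<Longrightarrow> fourier_inv g \<in> L2 \<mu>"
  and fourier_fourier_inv: "g \<in> l2space UNIV \<Longrightarrow> ft (fourier_inv g) = g"
  using someI_ex[OF riesz_fischer[of g]] by (simp_all add: fourier_inv_def)

lemma fourier_inv_fourier: "f \<in> L2 \<mu> \<Longrightarrow> AE \<gamma> in \<mu>. fourier_inv (ft f) \<gamma> = f \<gamma>"
  using L2_fourier_eq_iff[OF fourier_inv_L2, of "ft f" f]
  by (simp add: fourier_l2space fourier_fourier_inv)

end


section \<open>Hardy spaces\<close>

context haar_measure
begin

definition H2 :: "(('x \<Rightarrow> complex) \<Rightarrow> complex) set" where
  "H2 = {f \<in> L2 \<mu>. \<forall>\<xi><0. ft f \<xi> = 0}"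

definition H2_perp :: "(('x \<Rightarrow> complex) \<Rightarrow> complex) set" where
  "H2_perp = {f \<in> L2 \<mu>. \<forall>\<xi>\<ge>0. ft f \<xi> = 0}"

definition riesz_proj :: "(('x \<Rightarrow> complex) \<Rightarrow> complex) \<Rightarrow> ('x \<Rightarrow> complex) \<Rightarrow> complex" where
  "riesz_proj f = fourier_inv (truncate posCone (ft f))"

lemma H2_L2: "f \<in> H2 \<Longrightarrow> f \<in> L2 \<mu>"
  and H2_fourier: "f \<in> H2 \<Longrightarrow> \<xi> < 0 \<Longrightarrow> ft f \<xi> = 0"
  and H2I: "f \<in> L2 \<mu> \<Longrightarrow> (\<And>\<xi>. \<xi> < 0 \<Longrightarrow> ft f \<xi> = 0) \<Longrightarrow> f \<in> H2"
  by (simp_all add: H2_def)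

lemma H2_perp_L2: "f \<in> H2_perp \<Longrightarrow> f \<in> L2 \<mu>"
  and H2_perp_fourier: "f \<in> H2_perp \<Longrightarrow> 0 \<le> \<xi> \<Longrightarrow> ft f \<xi> = 0"
  by (simp_all add: H2_perp_def)

lemma H2_cmult: "f \<in> H2 \<Longrightarrow> (\<lambda>\<gamma>. c * f \<gamma>) \<in> H2"
  by (auto simp: H2_def L2_cmult fourier_cmult)

lemma H2_diff: "f \<in> H2 \<Longrightarrow> g \<in> H2 \<Longrightarrow> (\<lambda>\<gamma>. f \<gamma> - g \<gamma>) \<in> H2"
  by (auto simp: H2_def L2_diff fourier_diff)

lemma one_H2: "(\<lambda>\<gamma>. 1) \<in> H2"
  by (simp add: H2_def fourier_one one_L2)

lemma H2_mult_char: "f \<in> H2 \<Longrightarrow> 0 \<le> \<xi> \<Longrightarrow> (\<lambda>\<gamma>. f \<gamma> * \<gamma> \<xi>) \<in> H2"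
  unfolding H2_def by (auto simp: L2_mult_char fourier_mult_char intro: less_le_trans)

lemma fourier_H2_l2space: "f \<in> H2 \<Longrightarrow> ft f \<in> l2space posCone"
  using fourier_l2space[OF H2_L2, of f] H2_fourier[of f] by (auto simp: l2space_def posCone_def)

lemma l2space_posCone_UNIV: "g \<in> l2space posCone \<Longrightarrow> g \<in> l2space UNIV"
  by (simp add: l2space_def)

lemma fourier_inv_H2:
  assumes "g \<in> l2space posCone"
  shows "fourier_inv g \<in> H2"
  using assms l2space_posCone_UNIV[OF assms] l2space_outside[OF assms]
  by (intro H2I) (simp_all add: fourier_inv_L2 fourier_fourier_inv posCone_def)

lemma l2space_posConeE:
  assumes "g \<in> l2space posCone"
  obtains f where "f \<in> H2" "g = ft f"
  using that[OF fourier_inv_H2[OF assms]] fourier_fourier_inv[OF l2space_posCone_UNIV[OF assms]]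
  by simp

lemma truncate_fourier_l2space: "f \<in> L2 \<mu> \<Longrightarrow> truncate posCone (ft f) \<in> l2space posCone"
  using truncate_l2space[OF fourier_l2space, of f posCone] by (simp add: l2space_def truncate_def)

lemma riesz_proj_H2: "f \<in> L2 \<mu> \<Longrightarrow> riesz_proj f \<in> H2"
  unfolding riesz_proj_def by (intro fourier_inv_H2 truncate_fourier_l2space)

lemma riesz_proj_L2: "f \<in> L2 \<mu> \<Longrightarrow> riesz_proj f \<in> L2 \<mu>"
  by (rule H2_L2) (rule riesz_proj_H2)

lemma fourier_riesz_proj: "f \<in> L2 \<mu> \<Longrightarrow> ft (riesz_proj f) \<xi> = (if 0 \<le> \<xi> then ft f \<xi> else 0)"
  unfolding riesz_proj_def fourier_fourier_inv[OF l2space_posCone_UNIV[OF truncate_fourier_l2space]]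
  by (simp add: truncate_def posCone_def)

lemma riesz_proj_cong_AE:
  assumes "f \<in> borel_measurable \<mu>" "g \<in> borel_measurable \<mu>" "AE \<gamma> in \<mu>. f \<gamma> = g \<gamma>"
  shows "riesz_proj f = riesz_proj g"
  unfolding riesz_proj_def fourier_cong_AE[OF assms] ..

lemma fourier_riesz_proj_H2: "f \<in> H2 \<Longrightarrow> ft (riesz_proj f) = ft f"
  using fourier_riesz_proj[OF H2_L2, of f] H2_fourier[of f] by (auto simp: fun_eq_iff not_le)

lemma diff_riesz_proj_H2_perp: "f \<in> L2 \<mu> \<Longrightarrow> (\<lambda>\<gamma>. f \<gamma> - riesz_proj f \<gamma>) \<in> H2_perp"
  by (auto simp: H2_perp_def L2_diff riesz_proj_L2 fourier_diff fourier_riesz_proj)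

lemma inner_H2_H2_perp:
  assumes "f \<in> H2" "b \<in> H2_perp"
  shows "ip f b = 0"
proof -
  have "ft f \<xi> * cnj (ft b \<xi>) = 0" for \<xi>
    using H2_fourier[OF assms(1)] H2_perp_fourier[OF assms(2)] by (cases "\<xi> < 0") auto
  then show ?thesis
    using has_sum_unique[OF parseval[OF H2_L2[OF assms(1)] H2_perp_L2[OF assms(2)]] has_sum_0]
    by simp
qed

lemma inner_riesz_proj_left:
  assumes "f \<in> L2 \<mu>" "e \<in> H2"
  shows "ip (riesz_proj f) e = ip f e"
proof -
  have "ip (\<lambda>\<gamma>. f \<gamma> - riesz_proj f \<gamma>) e = 0"
    unfolding L2_inner_eq_0_commute[of \<mu> _ e]
    by (rule inner_H2_H2_perp[OF assms(2) diff_riesz_proj_H2_perp[OF assms(1)]])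
  then show ?thesis by (simp add: L2_inner_diff_left assms riesz_proj_L2 H2_L2)
qed

lemma inner_riesz_proj_right:
  assumes "f \<in> L2 \<mu>" "e \<in> H2"
  shows "ip e (riesz_proj f) = ip e f"
  unfolding L2_inner_commute[of \<mu> e] inner_riesz_proj_left[OF assms] ..

lemma L2_norm_diff_H2_sq:
  assumes f: "f \<in> L2 \<mu>" and e: "e \<in> H2"
  shows "(nrm (\<lambda>\<gamma>. f \<gamma> - e \<gamma>))\<^sup>2 =
    (nrm (\<lambda>\<gamma>. riesz_proj f \<gamma> - e \<gamma>))\<^sup>2 + (nrm (\<lambda>\<gamma>. f \<gamma> - riesz_proj f \<gamma>))\<^sup>2"
proof -
  have H2: "(\<lambda>\<gamma>. riesz_proj f \<gamma> - e \<gamma>) \<in> H2" by (intro H2_diff riesz_proj_H2 f e)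
  note perp = diff_riesz_proj_H2_perp[OF f]
  show ?thesis
    using L2_norm_add_sq[OF H2_L2[OF H2] H2_perp_L2[OF perp]] inner_H2_H2_perp[OF H2 perp] by simp
qed

lemma L2_norm_riesz_proj_sq:
  assumes "f \<in> L2 \<mu>"
  shows "(nrm f)\<^sup>2 = (nrm (riesz_proj f))\<^sup>2 + (nrm (\<lambda>\<gamma>. f \<gamma> - riesz_proj f \<gamma>))\<^sup>2"
  using L2_norm_diff_H2_sq[OF assms H2_cmult[OF one_H2, of 0]] by simp

lemma riesz_proj_best_approx:
  assumes "f \<in> L2 \<mu>" "e \<in> H2"
  shows "nrm (\<lambda>\<gamma>. f \<gamma> - riesz_proj f \<gamma>) \<le> nrm (\<lambda>\<gamma>. f \<gamma> - e \<gamma>)"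
  using L2_norm_diff_H2_sq[OF assms] by (intro power2_le_imp_le[OF _ L2_norm_nonneg]) simp

lemma L2_norm_riesz_proj_le: "f \<in> L2 \<mu> \<Longrightarrow> nrm (riesz_proj f) \<le> nrm f"
  using L2_norm_riesz_proj_sq[of f] by (intro power2_le_imp_le[OF _ L2_norm_nonneg]) simp

lemma fourier_H2_mult:
  assumes f: "f \<in> H2" and g: "g \<in> H2"
  shows "\<xi> < 0 \<Longrightarrow> ft (\<lambda>\<gamma>. f \<gamma> * g \<gamma>) \<xi> = 0"
    and "ft (\<lambda>\<gamma>. f \<gamma> * g \<gamma>) 0 = ft f 0 * ft g 0"
proof -
  note sum = fourier_mult_has_sum[OF H2_L2[OF f] H2_L2[OF g]]
  have zero: "ft f \<eta> * ft g (\<xi> - \<eta>) = 0" if "\<xi> < 0 \<or> \<xi> = 0 \<and> \<eta> \<noteq> 0" for \<xi> \<eta>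
  proof (cases "\<eta> < 0")
    case False
    then have "\<xi> < \<eta>" using that by (meson le_less_trans neq_iff not_less)
    then show ?thesis using H2_fourier[OF g, of "\<xi> - \<eta>"] by simp
  qed (simp add: H2_fourier[OF f])
  show "ft (\<lambda>\<gamma>. f \<gamma> * g \<gamma>) \<xi> = 0" if "\<xi> < 0"
    using has_sum_unique[OF sum[of \<xi>] has_sum_0] zero that by simp
  have "((\<lambda>\<eta>. ft f \<eta> * ft g (0 - \<eta>)) has_sum ft (\<lambda>\<gamma>. f \<gamma> * g \<gamma>) 0) {0}"
    using sum[of 0] by (rule has_sum_cong_neutral[THEN iffD1, rotated -1]) (use zero[of 0] in auto)
  from has_sum_unique[OF this has_sum_finite[of "{0}"]]
  show "ft (\<lambda>\<gamma>. f \<gamma> * g \<gamma>) 0 = ft f 0 * ft g 0" by simp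
qed

lemma H2_bounded_mult:
  assumes "h \<in> H2" "AE \<gamma> in \<mu>. cmod (h \<gamma>) \<le> C" "f \<in> H2"
  shows "(\<lambda>\<gamma>. h \<gamma> * f \<gamma>) \<in> H2"
  using L2_bounded_mult[OF H2_L2[OF assms(3)] L2_measurable[OF H2_L2[OF assms(1)]] assms(2)]
    fourier_H2_mult(1)[OF assms(1,3)] by (rule H2I)

lemma fourier_cnj_H2_mult_H2_perp:
  assumes f: "f \<in> H2" and b: "b \<in> H2_perp" and "0 \<le> \<xi>"
  shows "ft (\<lambda>\<gamma>. cnj (f \<gamma>) * b \<gamma>) \<xi> = 0"
proof -
  have "ft (\<lambda>\<gamma>. cnj (f \<gamma>)) \<eta> * ft b (\<xi> - \<eta>) = 0" for \<eta>
  proof (cases "0 < \<eta>")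
    case True
    then show ?thesis using H2_fourier[OF f, of "- \<eta>"] by (simp add: fourier_cnj)
  next
    case False
    then have "\<eta> \<le> \<xi>" using assms(3) by (meson not_less order_trans)
    then show ?thesis using H2_perp_fourier[OF b, of "\<xi> - \<eta>"] by simp
  qed
  then show ?thesis
    using has_sum_unique[OF fourier_mult_has_sum[OF L2_cnj[OF H2_L2[OF f]] H2_perp_L2[OF b]] has_sum_0]
    by simp
qed

section \<open>Inner-outer factorization\<close>

lemma AE_const_if_positive_fourier_zero:
  fixes D :: "('x \<Rightarrow> complex) \<Rightarrow> real"
  assumes D: "integrable \<mu> D" and pos: "\<And>\<xi>. \<xi> > 0 \<Longrightarrow> ft (\<lambda>\<gamma>. of_real (D \<gamma>)) \<xi> = 0"
  shows "AE \<gamma> in \<mu>. D \<gamma> = (\<integral>\<gamma>. D \<gamma> \<partial>\<mu>)"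
proof -
  define c where "c = (\<integral>\<gamma>. D \<gamma> \<partial>\<mu>)"
  have "AE \<gamma> in \<mu>. complex_of_real (D \<gamma>) = of_real c * 1"
  proof (rule fourier_eq_imp_AE_eq)
    show "integrable \<mu> (\<lambda>\<gamma>. complex_of_real (D \<gamma>))" using D by simp
    fix \<xi> :: 'x
    have at_0: "ft (\<lambda>\<gamma>. of_real (D \<gamma>)) 0 = of_real c" by (simp add: fourier_at_0 c_def)
    have neg: "ft (\<lambda>\<gamma>. of_real (D \<gamma>)) \<xi> = 0" if "\<xi> < 0"
      using fourier_cnj[of "\<lambda>\<gamma>. of_real (D \<gamma>)" \<xi>] pos[of "- \<xi>"] that by simp
    show "ft (\<lambda>\<gamma>. of_real (D \<gamma>)) \<xi> = ft (\<lambda>\<gamma>. of_real c * 1) \<xi>"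
      unfolding fourier_cmult fourier_one using at_0 neg pos[of \<xi>]
      by (cases \<xi> "0::'x" rule: linorder_cases) auto
  qed simp
  then have "AE \<gamma> in \<mu>. complex_of_real (D \<gamma>) = complex_of_real c" by simp
  then show ?thesis unfolding c_def[symmetric] by (simp only: of_real_eq_iff)
qed

lemma fourier_norm_sq: "ft (\<lambda>\<gamma>. of_real ((cmod (f \<gamma>))\<^sup>2)) \<xi> = ip f (\<lambda>\<gamma>. f \<gamma> * \<gamma> \<xi>)"
  unfolding fourier_def L2_inner_def complex_norm_square by (simp add: mult.assoc)

lemma trig_polys_mult_char:
  assumes q: "q \<in> trig_polys {0<..}" and "\<xi> > 0"
  obtains q' where "q' \<in> trig_polys {0<..}" "\<And>\<gamma>. \<gamma> \<in> chars \<Longrightarrow> q \<gamma> * \<gamma> \<xi> = q' \<gamma>"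
proof -
  obtain F k where F: "q = trig_poly F k" "finite F" "F \<subseteq> {0<..}" using q by (rule trig_polysE)
  define q' where "q' = trig_poly ((\<lambda>\<eta>. \<eta> + \<xi>) ` F) (\<lambda>\<eta>. k (\<eta> - \<xi>))"
  have "q' \<in> trig_polys {0<..}"
    unfolding q'_def using F \<open>\<xi> > 0\<close> by (intro trig_polyI) (auto intro: add_pos_pos)
  moreover have "q \<gamma> * \<gamma> \<xi> = q' \<gamma>" if "\<gamma> \<in> chars" for \<gamma>
    unfolding q'_def F(1) trig_poly_def
    by (subst sum.reindex) (simp_all add: sum_distrib_right chars_add[OF that] mult.assoc)
  ultimately show ?thesis by (rule that)
qed

lemma trig_polys_mult_L2: "p \<in> L2 \<mu> \<Longrightarrow> q \<in> trig_polys A \<Longrightarrow> (\<lambda>\<gamma>. p \<gamma> * q \<gamma>) \<in> L2 \<mu>"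
  by (elim trig_polysE) (simp add: trig_poly_def sum_distrib_left mult.left_commute L2_sum L2_cmult
      L2_mult_char)

definition shift_residual :: "(('x \<Rightarrow> complex) \<Rightarrow> complex) \<Rightarrow> (('x \<Rightarrow> complex) \<Rightarrow> complex) \<Rightarrow>
    (nat \<Rightarrow> ('x \<Rightarrow> complex) \<Rightarrow> complex) \<Rightarrow> bool" where
  "shift_residual p v q \<longleftrightarrow> v \<in> L2 \<mu> \<and> (\<forall>n. q n \<in> trig_polys {0<..}) \<and>
     L2_tendsto \<mu> (\<lambda>n \<gamma>. p \<gamma> - p \<gamma> * q n \<gamma>) v sequentially \<and>
     (\<forall>q\<in>trig_polys {0<..}. ip v (\<lambda>\<gamma>. p \<gamma> * q \<gamma>) = 0)"

lemma shift_residual_L2: "shift_residual p v q \<Longrightarrow> v \<in> L2 \<mu>"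
  and shift_residual_trig_polys: "shift_residual p v q \<Longrightarrow> q n \<in> trig_polys {0<..}"
  and shift_residual_tendsto: "shift_residual p v q \<Longrightarrow>
      L2_tendsto \<mu> (\<lambda>n \<gamma>. p \<gamma> - p \<gamma> * q n \<gamma>) v sequentially"
  and shift_residual_orthogonal: "shift_residual p v q \<Longrightarrow> q' \<in> trig_polys {0<..} \<Longrightarrow>
      ip v (\<lambda>\<gamma>. p \<gamma> * q' \<gamma>) = 0"
  by (simp_all add: shift_residual_def)

lemma shift_residual_exists:
  assumes p: "p \<in> L2 \<mu>"
  obtains v q where "shift_residual p v q"
proof -
  define D where "D = (\<lambda>q \<gamma>. p \<gamma> * q \<gamma>) ` trig_polys {0<..}"
  have "L2_subspace \<mu> D"
    unfolding L2_subspace_def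
  proof (intro conjI ballI allI)
    show "D \<subseteq> L2 \<mu>" unfolding D_def using trig_polys_mult_L2[OF p] by blast
    show "D \<noteq> {}" unfolding D_def using trig_polys_zero by blast
    fix d e c assume "d \<in> D" "e \<in> D"
    then obtain q q' where q: "q \<in> trig_polys {0<..}" "q' \<in> trig_polys {0<..}"
      "d = (\<lambda>\<gamma>. p \<gamma> * q \<gamma>)" "e = (\<lambda>\<gamma>. p \<gamma> * q' \<gamma>)" unfolding D_def by blast
    then have "(\<lambda>\<gamma>. c * d \<gamma> + e \<gamma>) = (\<lambda>\<gamma>. p \<gamma> * (c * q \<gamma> + q' \<gamma>))"
      by (simp add: ring_distribs mult_ac)
    then show "(\<lambda>\<gamma>. c * d \<gamma> + e \<gamma>) \<in> D"
      unfolding D_def by (rule image_eqI[OF _ trig_polys_lincomb[OF q(1,2)]])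
  qed
  from L2_projection[OF this p] obtain v m where v: "v \<in> L2 \<mu>" "\<And>n. m n \<in> D"
    "L2_tendsto \<mu> (\<lambda>n \<gamma>. p \<gamma> - m n \<gamma>) v sequentially" "\<And>d. d \<in> D \<Longrightarrow> ip v d = 0"
    by blast
  from v(2) have "\<exists>q\<in>trig_polys {0<..}. m n = (\<lambda>\<gamma>. p \<gamma> * q \<gamma>)" for n unfolding D_def by blast
  then obtain q where "\<And>n. q n \<in> trig_polys {0<..}" "\<And>n. m n = (\<lambda>\<gamma>. p \<gamma> * q n \<gamma>)" by metis
  with v have "shift_residual p v q" by (simp add: shift_residual_def D_def)
  then show ?thesis by (rule that)
qed

lemma shift_residual_norm_const:
  assumes p: "p \<in> L2 \<mu>" and v: "shift_residual p v q"
  shows "AE \<gamma> in \<mu>. (cmod (v \<gamma>))\<^sup>2 = (nrm v)\<^sup>2"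
  unfolding L2_norm_sq
proof (rule AE_const_if_positive_fourier_zero)
  note vL = shift_residual_L2[OF v] and q = shift_residual_trig_polys[OF v]
    and lim = shift_residual_tendsto[OF v]
  show "integrable \<mu> (\<lambda>\<gamma>. (cmod (v \<gamma>))\<^sup>2)" by (rule L2_integrable_sq[OF vL])
  fix \<xi> :: 'x assume \<xi>: "\<xi> > 0"
  define w where "w = (\<lambda>\<gamma>. v \<gamma> * \<gamma> (- \<xi>))"
  have "ip (\<lambda>\<gamma>. p \<gamma> - p \<gamma> * q n \<gamma>) w = 0" for n
  proof -
    obtain q' where q': "q' \<in> trig_polys {0<..}" "\<And>\<gamma>. \<gamma> \<in> chars \<Longrightarrow> q n \<gamma> * \<gamma> \<xi> = q' \<gamma>"
      using trig_polys_mult_char[OF q[of n] \<xi>] by blast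
    have "(\<lambda>\<gamma>. - 1 * q' \<gamma> + \<gamma> \<xi>) \<in> trig_polys {0<..}"
      using \<xi> by (intro trig_polys_lincomb q' eval_in_trig_polys) simp
    then have "ip v (\<lambda>\<gamma>. p \<gamma> * (- 1 * q' \<gamma> + \<gamma> \<xi>)) = 0" by (rule shift_residual_orthogonal[OF v])
    moreover have "ip (\<lambda>\<gamma>. p \<gamma> * (- 1 * q' \<gamma> + \<gamma> \<xi>)) v = ip (\<lambda>\<gamma>. (p \<gamma> - p \<gamma> * q n \<gamma>) * \<gamma> \<xi>) v"
      unfolding L2_inner_def
      by (rule integral_chars_cong) (simp add: q'(2)[symmetric] algebra_simps)
    ultimately show ?thesis unfolding w_def inner_mult_char[symmetric] L2_inner_eq_0_commute[of \<mu> v]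
      by simp
  qed
  moreover have "(\<lambda>n. ip (\<lambda>\<gamma>. p \<gamma> - p \<gamma> * q n \<gamma>) w) \<longlonglongrightarrow> ip v w"
    unfolding w_def
    by (intro tendsto_L2_inner[OF _ vL _ lim] L2_diff p trig_polys_mult_L2[OF p q] L2_mult_char vL)
  ultimately have "ip v w = 0" by (simp add: LIMSEQ_const_iff)
  then show "ft (\<lambda>\<gamma>. of_real ((cmod (v \<gamma>))\<^sup>2)) \<xi> = 0"
    unfolding fourier_norm_sq w_def inner_mult_char[symmetric] L2_inner_eq_0_commute[of \<mu> _ v] .
qed

lemma shift_residual_div:
  assumes p: "p \<in> L2 \<mu>" and v: "shift_residual p v q" and c: "c > 0" "AE \<gamma> in \<mu>. c \<le> (cmod (p \<gamma>))\<^sup>2"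
  shows "(\<lambda>\<gamma>. inverse (p \<gamma>) * v \<gamma>) \<in> H2" "ft (\<lambda>\<gamma>. inverse (p \<gamma>) * v \<gamma>) 0 = 1"
proof -
  note vL = shift_residual_L2[OF v] and q = shift_residual_trig_polys[OF v]
    and lim = shift_residual_tendsto[OF v]
  have s: "(\<lambda>\<gamma>. p \<gamma> - p \<gamma> * q n \<gamma>) \<in> L2 \<mu>" for n by (intro L2_diff p trig_polys_mult_L2[OF p q])
  note bound = AE_inverse_bounded[OF c]
  have [measurable]: "(\<lambda>\<gamma>. inverse (p \<gamma>)) \<in> borel_measurable \<mu>" using L2_measurable[OF p]
    by measurable
  note div_L2 = L2_bounded_mult[OF _ this bound]
  note p0 = AE_neq_0_if_norm_sq_bounded_below[OF c]
  have quotient: "ft (\<lambda>\<gamma>. inverse (p \<gamma>) * (p \<gamma> - p \<gamma> * q n \<gamma>)) \<xi> = (if \<xi> = 0 then 1 else 0)"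
    if "\<xi> \<le> 0" for n \<xi>
  proof -
    obtain F k where F: "q n = trig_poly F k" "finite F" "F \<subseteq> {0<..}" using q[of n]
      by (rule trig_polysE)
    have "ft (\<lambda>\<gamma>. inverse (p \<gamma>) * (p \<gamma> - p \<gamma> * q n \<gamma>)) = ft (\<lambda>\<gamma>. 1 - q n \<gamma>)"
    proof (rule fourier_cong_AE)
      show "AE \<gamma> in \<mu>. inverse (p \<gamma>) * (p \<gamma> - p \<gamma> * q n \<gamma>) = 1 - q n \<gamma>"
        using p0 by eventually_elim (simp add: field_simps)
    qed (intro L2_measurable div_L2 s L2_diff one_L2 trig_polys_L2[OF q])+
    then show ?thesis
      using F that
      by (auto simp: fourier_diff one_L2 trig_poly_L2 fourier_one fourier_trig_poly truncate_def)
  qed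
  have limit: "ft (\<lambda>\<gamma>. inverse (p \<gamma>) * v \<gamma>) \<xi> = (if \<xi> = 0 then 1 else 0)" if "\<xi> \<le> 0" for \<xi>
  proof (rule LIMSEQ_unique)
    have "L2_tendsto \<mu> (\<lambda>n \<gamma>. inverse (p \<gamma>) * (p \<gamma> - p \<gamma> * q n \<gamma>))
        (\<lambda>\<gamma>. inverse (p \<gamma>) * v \<gamma>) sequentially"
      using c(1) by (intro L2_tendsto_bounded_mult[OF s vL lim bound]) simp
    from tendsto_fourier[OF div_L2[OF s] div_L2[OF vL] this]
    show "(\<lambda>n. ft (\<lambda>\<gamma>. inverse (p \<gamma>) * (p \<gamma> - p \<gamma> * q n \<gamma>)) \<xi>) \<longlonglongrightarrow> ft (\<lambda>\<gamma>. inverse (p \<gamma>) * v \<gamma>) \<xi>" .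
    show "(\<lambda>n. ft (\<lambda>\<gamma>. inverse (p \<gamma>) * (p \<gamma> - p \<gamma> * q n \<gamma>)) \<xi>) \<longlonglongrightarrow> (if \<xi> = 0 then 1 else 0)"
      unfolding quotient[OF that] by (rule tendsto_const)
  qed
  show "(\<lambda>\<gamma>. inverse (p \<gamma>) * v \<gamma>) \<in> H2" using limit by (intro H2I div_L2 vL) simp
  show "ft (\<lambda>\<gamma>. inverse (p \<gamma>) * v \<gamma>) 0 = 1" using limit[of 0] by simp
qed

lemma L2_norm_shift_residual_neq_0:
  assumes p: "p \<in> L2 \<mu>" and v: "shift_residual p v q" and c: "c > 0" "AE \<gamma> in \<mu>. c \<le> (cmod (p \<gamma>))\<^sup>2"
  shows "nrm v \<noteq> 0"
proof
  note quotient = shift_residual_div[OF assms]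
  assume "nrm v = 0"
  then have "AE \<gamma> in \<mu>. v \<gamma> = 0" using L2_norm_eq_0_iff[OF shift_residual_L2[OF v]] by simp
  then have "AE \<gamma> in \<mu>. inverse (p \<gamma>) * v \<gamma> = 0" by eventually_elim simp
  then have "ft (\<lambda>\<gamma>. inverse (p \<gamma>) * v \<gamma>) = ft (\<lambda>\<gamma>. 0)"
    using L2_fourier_eq_iff[OF H2_L2[OF quotient(1)] L2_zero] by simp
  with quotient(2) show False by (simp add: fourier_def)
qed

lemma shift_residual_H2:
  assumes p: "p \<in> H2" and v: "shift_residual p v q" and c: "c > 0" "AE \<gamma> in \<mu>. c \<le> (cmod (p \<gamma>))\<^sup>2"
  shows "v \<in> H2"
proof (rule H2I[OF shift_residual_L2[OF v]])
  define r where "r = (\<lambda>\<gamma>. inverse (p \<gamma>) * v \<gamma>)"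
  have r: "r \<in> H2" unfolding r_def by (rule shift_residual_div[OF H2_L2[OF p] v c])
  have "AE \<gamma> in \<mu>. v \<gamma> = r \<gamma> * p \<gamma>"
    using AE_neq_0_if_norm_sq_bounded_below[OF c] by eventually_elim (simp add: r_def)
  then have "ft v = ft (\<lambda>\<gamma>. r \<gamma> * p \<gamma>)"
    using L2_measurable[OF H2_L2[OF r]] L2_measurable[OF H2_L2[OF p]]
        L2_measurable[OF shift_residual_L2[OF v]]
    by (intro fourier_cong_AE) auto
  then show "ft v \<xi> = 0" if "\<xi> < 0" for \<xi> using fourier_H2_mult(1)[OF r p that] by simp
qed

lemma cnj_shift_residual_mult_fourier:
  assumes v: "shift_residual p v q" and "\<xi> < 0"
  shows "ft (\<lambda>\<gamma>. cnj (v \<gamma>) * p \<gamma>) \<xi> = 0"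
proof -
  have "ft (\<lambda>\<gamma>. cnj (v \<gamma>) * p \<gamma>) \<xi> = ip (\<lambda>\<gamma>. p \<gamma> * \<gamma> (- \<xi>)) v"
    unfolding fourier_def L2_inner_def
    by (rule integral_chars_cong) (simp add: chars_uminus mult_ac)
  moreover have "ip v (\<lambda>\<gamma>. p \<gamma> * \<gamma> (- \<xi>)) = 0"
    using \<open>\<xi> < 0\<close> by (intro shift_residual_orthogonal[OF v] eval_in_trig_polys) simp
  ultimately show ?thesis using L2_inner_eq_0_commute by metis
qed

text \<open>The residual of \<open>p\<close> modulo the closed span of its proper shifts has constant modulus; normalised,
  it is the inner factor of \<open>p\<close>.\<close>

theorem inner_outer_factorization:
  assumes p: "p \<in> H2" and c: "c > 0" "AE \<gamma> in \<mu>. c \<le> (cmod (p \<gamma>))\<^sup>2"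
  obtains u v r where "u \<in> H2" "v \<in> H2" "r \<in> H2" "AE \<gamma> in \<mu>. cmod (v \<gamma>) = 1"
    "AE \<gamma> in \<mu>. p \<gamma> = u \<gamma> * v \<gamma>" "AE \<gamma> in \<mu>. u \<gamma> * r \<gamma> = 1"
proof -
  note pL = H2_L2[OF p] and p0 = AE_neq_0_if_norm_sq_bounded_below[OF c]
  obtain w q where w: "shift_residual p w q" by (rule shift_residual_exists[OF pL])
  define a where "a = complex_of_real (1 / nrm w)"
  define v where "v = (\<lambda>\<gamma>. a * w \<gamma>)"
  define r where "r = (\<lambda>\<gamma>. a * (inverse (p \<gamma>) * w \<gamma>))"
  define u where "u = (\<lambda>\<gamma>. cnj (v \<gamma>) * p \<gamma>)"
  have v_norm: "AE \<gamma> in \<mu>. cmod (v \<gamma>) = 1"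
    using shift_residual_norm_const[OF pL w]
    by eventually_elim (use L2_norm_shift_residual_neq_0[OF pL w c] in
        \<open>simp add: v_def a_def norm_mult norm_divide\<close>)
  have v: "v \<in> H2" unfolding v_def by (intro H2_cmult shift_residual_H2[OF p w c])
  have r: "r \<in> H2" unfolding r_def by (intro H2_cmult shift_residual_div[OF pL w c])
  have u: "u \<in> H2"
  proof (rule H2I)
    show "u \<in> L2 \<mu>" unfolding u_def
      using L2_measurable[OF H2_L2[OF v]] v_norm
      by (intro L2_bounded_mult[OF pL, where C = 1]) (auto elim: eventually_mono)
    have "u = (\<lambda>\<gamma>. a * (cnj (w \<gamma>) * p \<gamma>))" by (simp add: u_def v_def a_def)
    then show "ft u \<xi> = 0" if "\<xi> < 0" for \<xi>
      by (simp add: fourier_cmult cnj_shift_residual_mult_fourier[OF w that])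
  qed
  have uv: "AE \<gamma> in \<mu>. p \<gamma> = u \<gamma> * v \<gamma>"
    using v_norm
  proof eventually_elim
    case (elim \<gamma>)
    then have "cnj (v \<gamma>) * v \<gamma> = 1" using complex_norm_square[of "v \<gamma>"] by (simp add: mult.commute)
    then show ?case by (simp add: u_def mult.commute mult.left_commute)
  qed
  have "AE \<gamma> in \<mu>. u \<gamma> * r \<gamma> = 1"
    using uv p0
  proof eventually_elim
    case (elim \<gamma>)
    have "u \<gamma> * r \<gamma> = u \<gamma> * v \<gamma> / p \<gamma>" by (simp add: r_def v_def field_simps)
    then show ?case using elim by simp
  qed
  with u v r v_norm uv show ?thesis by (rule that)
qed

end


section \<open>Toeplitz operators\<close>

lemma Linf_measurable [measurable_dest]: "\<psi> \<in> Linf M \<Longrightarrow> \<psi> \<in> borel_measurable M"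
  by (simp add: Linf_def)

lemma LinfI: "\<psi> \<in> borel_measurable M \<Longrightarrow> AE x in M. cmod (\<psi> x) \<le> C \<Longrightarrow> \<psi> \<in> Linf M"
  by (auto simp: Linf_def)

lemma Linf_bound:
  assumes "\<psi> \<in> Linf M"
  obtains C where "0 \<le> C" "AE x in M. cmod (\<psi> x) \<le> C"
proof -
  obtain C where "AE x in M. cmod (\<psi> x) \<le> C" using assms by (auto simp: Linf_def)
  then have "AE x in M. cmod (\<psi> x) \<le> \<bar>C\<bar>" by eventually_elim simp
  then show ?thesis by (rule that[rotated]) simp
qed

lemma Linf_cnj: "\<psi> \<in> Linf M \<Longrightarrow> (\<lambda>x. cnj (\<psi> x)) \<in> Linf M"
  by (auto simp: Linf_def)

lemma Linf_mult:
  assumes "\<psi> \<in> Linf M" "\<theta> \<in> Linf M"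
  shows "(\<lambda>x. \<psi> x * \<theta> x) \<in> Linf M"
proof -
  obtain C where C: "0 \<le> C" "AE x in M. cmod (\<psi> x) \<le> C" by (rule Linf_bound[OF assms(1)])
  obtain D where D: "0 \<le> D" "AE x in M. cmod (\<theta> x) \<le> D" by (rule Linf_bound[OF assms(2)])
  have "AE x in M. cmod (\<psi> x * \<theta> x) \<le> C * D"
    using C(2) D(2) by eventually_elim (auto simp: norm_mult intro!: mult_mono C D)
  then show ?thesis using Linf_measurable[OF assms(1)] Linf_measurable[OF assms(2)]
    by (intro LinfI) auto
qed

lemma Linf_mult_L2: "\<psi> \<in> Linf M \<Longrightarrow> f \<in> L2 M \<Longrightarrow> (\<lambda>x. \<psi> x * f x) \<in> L2 M"
  using L2_bounded_mult Linf_measurable by (metis Linf_bound)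

lemma linf_norm_less_iff:
  assumes "f \<in> borel_measurable M" "0 < c"
  shows "linf_norm M f < ereal c \<longleftrightarrow> (\<exists>\<rho>. 0 \<le> \<rho> \<and> \<rho> < c \<and> (AE x in M. cmod (f x) \<le> \<rho>))"
proof
  assume "linf_norm M f < ereal c"
  then obtain \<rho> where \<rho>: "linf_norm M f < ereal \<rho>" "\<rho> < c"
    using ereal_dense2[of "linf_norm M f" "ereal c"] by auto
  have "AE x in M. ereal (cmod (f x)) \<le> linf_norm M f" unfolding linf_norm_def by (rule esssup_AE)
  then have "AE x in M. cmod (f x) \<le> max 0 \<rho>"
  proof eventually_elim
    case (elim x)
    from order_le_less_trans[OF this \<rho>(1)] show ?case by simp
  qed
  then show "\<exists>\<rho>. 0 \<le> \<rho> \<and> \<rho> < c \<and> (AE x in M. cmod (f x) \<le> \<rho>)"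
    using \<rho>(2) assms(2) by (intro exI[of _ "max 0 \<rho>"]) simp
next
  assume "\<exists>\<rho>. 0 \<le> \<rho> \<and> \<rho> < c \<and> (AE x in M. cmod (f x) \<le> \<rho>)"
  then obtain \<rho> where \<rho>: "\<rho> < c" "AE x in M. cmod (f x) \<le> \<rho>" by blast
  have "linf_norm M f \<le> ereal \<rho>"
    unfolding linf_norm_def using assms(1) \<rho>(2) by (intro esssup_I) auto
  then show "linf_norm M f < ereal c" using \<rho>(1) order_le_less_trans by fastforce
qed

lemma dist_Hinf_less_iff: "dist_Hinf \<mu> f < c \<longleftrightarrow> (\<exists>h\<in>Hinf \<mu>. linf_norm \<mu> (\<lambda>\<gamma>. f \<gamma> - h \<gamma>) < c)"
  by (simp add: dist_Hinf_def INF_less_iff)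

lemma Hinf_Linf: "h \<in> Hinf \<mu> \<Longrightarrow> h \<in> Linf \<mu>"
  by (simp add: Hinf_def)

context haar_measure
begin

lemma Hinf_iff: "h \<in> Hinf \<mu> \<longleftrightarrow> h \<in> Linf \<mu> \<and> h \<in> H2"
proof
  assume h: "h \<in> Hinf \<mu>"
  obtain C where "AE \<gamma> in \<mu>. cmod (h \<gamma>) \<le> C" using Linf_bound[OF Hinf_Linf[OF h]] by blast
  then have "h \<in> L2 \<mu>" by (rule L2_bounded[OF Linf_measurable[OF Hinf_Linf[OF h]]])
  then show "h \<in> Linf \<mu> \<and> h \<in> H2" using h by (auto simp: Hinf_def H2_def posCone_def)
qed (auto simp: Hinf_def H2_def posCone_def)

lemma Hinf_H2: "h \<in> Hinf \<mu> \<Longrightarrow> h \<in> H2"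
  by (simp add: Hinf_iff)

lemma Hinf_mult_H2: "h \<in> Hinf \<mu> \<Longrightarrow> f \<in> H2 \<Longrightarrow> (\<lambda>\<gamma>. h \<gamma> * f \<gamma>) \<in> H2"
  using H2_bounded_mult[OF Hinf_H2 _, of h] Linf_bound[OF Hinf_Linf, of h] by metis

definition toeplitz_H2 ::
  "(('x \<Rightarrow> complex) \<Rightarrow> complex) \<Rightarrow> (('x \<Rightarrow> complex) \<Rightarrow> complex) \<Rightarrow> ('x \<Rightarrow> complex) \<Rightarrow> complex" where
  "toeplitz_H2 \<psi> f = riesz_proj (\<lambda>\<gamma>. \<psi> \<gamma> * f \<gamma>)"

definition toeplitz :: "(('x \<Rightarrow> complex) \<Rightarrow> complex) \<Rightarrow> ('x \<Rightarrow> complex) \<Rightarrow> 'x \<Rightarrow> complex" where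
  "toeplitz \<psi> g = ft (toeplitz_H2 \<psi> (fourier_inv g))"

lemma toeplitz_H2_H2: "\<psi> \<in> Linf \<mu> \<Longrightarrow> f \<in> L2 \<mu> \<Longrightarrow> toeplitz_H2 \<psi> f \<in> H2"
  unfolding toeplitz_H2_def by (intro riesz_proj_H2 Linf_mult_L2)

lemma toeplitz_H2_L2: "\<psi> \<in> Linf \<mu> \<Longrightarrow> f \<in> L2 \<mu> \<Longrightarrow> toeplitz_H2 \<psi> f \<in> L2 \<mu>"
  by (rule H2_L2) (rule toeplitz_H2_H2)

lemma fourier_toeplitz_H2:
  "\<psi> \<in> Linf \<mu> \<Longrightarrow> f \<in> L2 \<mu> \<Longrightarrow> ft (toeplitz_H2 \<psi> f) \<xi> = (if 0 \<le> \<xi> then ft (\<lambda>\<gamma>. \<psi> \<gamma> * f \<gamma>) \<xi> else 0)"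
  unfolding toeplitz_H2_def by (rule fourier_riesz_proj[OF Linf_mult_L2])

lemma toeplitz_H2_cong_AE:
  assumes "\<psi> \<in> Linf \<mu>" "f \<in> L2 \<mu>" "g \<in> L2 \<mu>" "AE \<gamma> in \<mu>. f \<gamma> = g \<gamma>"
  shows "toeplitz_H2 \<psi> f = toeplitz_H2 \<psi> g"
  unfolding toeplitz_H2_def
  using assms by (intro riesz_proj_cong_AE L2_measurable Linf_mult_L2) (auto elim: eventually_mono)

lemma L2_norm_toeplitz_H2_le:
  assumes "\<psi> \<in> Linf \<mu>" "AE \<gamma> in \<mu>. cmod (\<psi> \<gamma>) \<le> C" "0 \<le> C" "f \<in> L2 \<mu>"
  shows "nrm (toeplitz_H2 \<psi> f) \<le> C * nrm f"
  unfolding toeplitz_H2_def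
  using L2_norm_riesz_proj_le[OF Linf_mult_L2[OF assms(1,4)]] L2_norm_bounded_mult[OF assms(4,2,3)]
  by linarith

lemma inner_toeplitz_H2:
  assumes "\<psi> \<in> Linf \<mu>" "f \<in> H2" "g \<in> H2"
  shows "ip (toeplitz_H2 \<psi> f) g = ip f (toeplitz_H2 (\<lambda>\<gamma>. cnj (\<psi> \<gamma>)) g)"
proof -
  have "ip (toeplitz_H2 \<psi> f) g = ip (\<lambda>\<gamma>. \<psi> \<gamma> * f \<gamma>) g"
    unfolding toeplitz_H2_def by (intro inner_riesz_proj_left Linf_mult_L2 assms H2_L2)
  also have "\<dots> = ip f (\<lambda>\<gamma>. cnj (\<psi> \<gamma>) * g \<gamma>)" by (simp add: L2_inner_def mult_ac)
  also have "\<dots> = ip f (toeplitz_H2 (\<lambda>\<gamma>. cnj (\<psi> \<gamma>)) g)"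
    unfolding toeplitz_H2_def
    by (intro inner_riesz_proj_right[symmetric] Linf_mult_L2 Linf_cnj assms H2_L2)
  finally show ?thesis .
qed

lemma toeplitz_fourier:
  assumes "\<psi> \<in> Linf \<mu>" "f \<in> L2 \<mu>"
  shows "toeplitz \<psi> (ft f) = ft (toeplitz_H2 \<psi> f)"
  unfolding toeplitz_def
  using toeplitz_H2_cong_AE[OF assms(1) fourier_inv_L2[OF fourier_l2space]
      assms(2) fourier_inv_fourier]
    assms(2) by simp

lemma wienerHopf_eq_toeplitz:
  assumes \<psi>: "\<psi> \<in> Linf \<mu>" "\<psi> \<in> L2 \<mu>" and g: "g \<in> l2space posCone"
  shows "wienerHopf (ft \<psi>) g = toeplitz \<psi> g"
proof -
  obtain f where f: "f \<in> H2" "g = ft f" by (rule l2space_posConeE[OF g])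
  have "conv (ft \<psi>) g \<xi> = ft (\<lambda>\<gamma>. \<psi> \<gamma> * f \<gamma>) \<xi>" for \<xi>
    using infsumI[OF fourier_mult_has_sum[OF \<psi>(2) H2_L2[OF f(1)], of \<xi>]]
    by (simp add: conv_def f(2))
  then show ?thesis
    unfolding f(2) toeplitz_fourier[OF \<psi>(1) H2_L2[OF f(1)]]
    by (simp add: fun_eq_iff wienerHopf_def posCone_def fourier_toeplitz_H2 \<psi>(1) H2_L2[OF f(1)])
qed

lemma l2norm_toeplitz_fourier:
  "\<psi> \<in> Linf \<mu> \<Longrightarrow> f \<in> L2 \<mu> \<Longrightarrow> l2norm (toeplitz \<psi> (ft f)) = nrm (toeplitz_H2 \<psi> f)"
  by (simp add: toeplitz_fourier l2norm_fourier toeplitz_H2_L2)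

lemma l2norm_toeplitz_le:
  assumes "\<psi> \<in> Linf \<mu>" "AE \<gamma> in \<mu>. cmod (\<psi> \<gamma>) \<le> C" "0 \<le> C" "g \<in> l2space posCone"
  shows "l2norm (toeplitz \<psi> g) \<le> C * l2norm g"
proof -
  obtain f where f: "f \<in> H2" "g = ft f" by (rule l2space_posConeE[OF assms(4)])
  show ?thesis
    using L2_norm_toeplitz_H2_le[OF assms(1-3) H2_L2[OF f(1)]]
    by (simp add: f(2) l2norm_toeplitz_fourier assms(1) H2_L2[OF f(1)] l2norm_fourier)
qed

lemma bounded_op_toeplitz:
  assumes \<psi>: "\<psi> \<in> Linf \<mu>"
  shows "bounded_op posCone (toeplitz \<psi>)"
proof -
  obtain C where C: "0 \<le> C" "AE \<gamma> in \<mu>. cmod (\<psi> \<gamma>) \<le> C" by (rule Linf_bound[OF \<psi>])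
  show ?thesis
  proof (rule bounded_opI[OF _ _ l2norm_toeplitz_le[OF \<psi> C(2,1)]])
    fix g :: "'x \<Rightarrow> complex" assume "g \<in> l2space posCone"
    then show "toeplitz \<psi> g \<in> l2space posCone"
      unfolding toeplitz_def
      by (intro fourier_H2_l2space toeplitz_H2_H2[OF \<psi>] fourier_inv_L2 l2space_posCone_UNIV)
  next
    fix g h :: "'x \<Rightarrow> complex" and c assume g: "g \<in> l2space posCone" and h: "h \<in> l2space posCone"
    obtain f where f: "f \<in> H2" "g = ft f" by (rule l2space_posConeE[OF g])
    obtain e where e: "e \<in> H2" "h = ft e" by (rule l2space_posConeE[OF h])
    note fL = H2_L2[OF f(1)] and eL = H2_L2[OF e(1)]
    have lin: "(\<lambda>\<xi>. c * ft f \<xi> + ft e \<xi>) = ft (\<lambda>\<gamma>. c * f \<gamma> + e \<gamma>)"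
      by (simp add: fun_eq_iff fourier_add fourier_cmult L2_cmult fL eL)
    have mult: "(\<lambda>\<gamma>. \<psi> \<gamma> * (c * f \<gamma> + e \<gamma>)) = (\<lambda>\<gamma>. c * (\<psi> \<gamma> * f \<gamma>) + \<psi> \<gamma> * e \<gamma>)"
      by (simp add: ring_distribs mult_ac)
    show "toeplitz \<psi> (\<lambda>\<xi>. c * g \<xi> + h \<xi>) = (\<lambda>\<xi>. c * toeplitz \<psi> g \<xi> + toeplitz \<psi> h \<xi>)"
      unfolding f(2) e(2) lin
      by (simp add: fun_eq_iff toeplitz_fourier fourier_toeplitz_H2 \<psi> L2_add L2_cmult fL eL mult
        fourier_add fourier_cmult Linf_mult_L2)
  qed
qed

lemma l2inner_fourier: "f \<in> L2 \<mu> \<Longrightarrow> g \<in> L2 \<mu> \<Longrightarrow> l2inner (ft f) (ft g) = ip f g"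
  using infsumI[OF parseval[of f g]] l2inner_eq_infsum[OF fourier_l2space fourier_l2space, of f g]
  by simp

lemma adjoint_ops_toeplitz:
  assumes \<psi>: "\<psi> \<in> Linf \<mu>"
  shows "adjoint_ops posCone (toeplitz \<psi>) (toeplitz (\<lambda>\<gamma>. cnj (\<psi> \<gamma>)))"
  unfolding adjoint_ops_def
proof (intro conjI ballI bounded_op_toeplitz \<psi> Linf_cnj)
  fix g h :: "'x \<Rightarrow> complex" assume g: "g \<in> l2space posCone" and h: "h \<in> l2space posCone"
  obtain f where f: "f \<in> H2" "g = ft f" by (rule l2space_posConeE[OF g])
  obtain e where e: "e \<in> H2" "h = ft e" by (rule l2space_posConeE[OF h])
  note fL = H2_L2[OF f(1)] and eL = H2_L2[OF e(1)] and \<psi>c = Linf_cnj[OF \<psi>]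
  show "l2inner (toeplitz \<psi> g) h = l2inner g (toeplitz (\<lambda>\<gamma>. cnj (\<psi> \<gamma>)) h)"
    unfolding f(2) e(2) toeplitz_fourier[OF \<psi> fL] toeplitz_fourier[OF \<psi>c eL]
      l2inner_fourier[OF toeplitz_H2_L2[OF \<psi> fL] eL] l2inner_fourier[OF fL toeplitz_H2_L2[OF \<psi>c eL]]
    by (rule inner_toeplitz_H2[OF \<psi> f(1) e(1)])
qed

lemma toeplitz_Hinf_fourier:
  assumes "h \<in> Hinf \<mu>" "f \<in> H2"
  shows "toeplitz h (ft f) = ft (\<lambda>\<gamma>. h \<gamma> * f \<gamma>)"
  unfolding toeplitz_fourier[OF Hinf_Linf[OF assms(1)] H2_L2[OF assms(2)]] toeplitz_H2_def
  by (rule fourier_riesz_proj_H2[OF Hinf_mult_H2[OF assms]])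

lemma toeplitz_AE_one:
  assumes \<psi>: "\<psi> \<in> Linf \<mu>" "AE \<gamma> in \<mu>. \<psi> \<gamma> = 1" and g: "g \<in> l2space posCone"
  shows "toeplitz \<psi> g = g"
proof -
  obtain f where f: "f \<in> H2" "g = ft f" by (rule l2space_posConeE[OF g])
  note fL = H2_L2[OF f(1)]
  have "riesz_proj (\<lambda>\<gamma>. \<psi> \<gamma> * f \<gamma>) = riesz_proj f"
    using \<psi>(2)
    by (intro riesz_proj_cong_AE L2_measurable Linf_mult_L2 \<psi>(1) fL) (auto elim: eventually_mono)
  then show ?thesis
    by (simp add: f(2) toeplitz_fourier \<psi>(1) fL toeplitz_H2_def fourier_riesz_proj_H2 f(1))
qed

lemma toeplitz_cnj_Hinf_compose:
  assumes h: "h \<in> Hinf \<mu>" and \<psi>: "\<psi> \<in> Linf \<mu>" and g: "g \<in> l2space posCone"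
  shows "toeplitz (\<lambda>\<gamma>. cnj (h \<gamma>)) (toeplitz \<psi> g) = toeplitz (\<lambda>\<gamma>. cnj (h \<gamma>) * \<psi> \<gamma>) g"
proof -
  obtain f where f: "f \<in> H2" "g = ft f" by (rule l2space_posConeE[OF g])
  note hc = Linf_cnj[OF Hinf_Linf[OF h]]
  define m where "m = (\<lambda>\<gamma>. \<psi> \<gamma> * f \<gamma>)"
  have m: "m \<in> L2 \<mu>" unfolding m_def by (rule Linf_mult_L2[OF \<psi> H2_L2[OF f(1)]])
  have "ft (\<lambda>\<gamma>. cnj (h \<gamma>) * m \<gamma>) \<xi> = ft (\<lambda>\<gamma>. cnj (h \<gamma>) * riesz_proj m \<gamma>) \<xi>" if "0 \<le> \<xi>" for \<xi>
    using fourier_cnj_H2_mult_H2_perp[OF Hinf_H2[OF h] diff_riesz_proj_H2_perp[OF m] that]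
      fourier_diff[OF Linf_mult_L2[OF hc m] Linf_mult_L2[OF hc riesz_proj_L2[OF m]], of \<xi>]
    by (simp add: right_diff_distrib)
  then have "ft (toeplitz_H2 (\<lambda>\<gamma>. cnj (h \<gamma>)) (riesz_proj m))
      = ft (riesz_proj (\<lambda>\<gamma>. cnj (h \<gamma>) * m \<gamma>))"
    by (auto simp: fun_eq_iff fourier_toeplitz_H2 fourier_riesz_proj hc m riesz_proj_L2
        Linf_mult_L2)
  then have "ft (toeplitz_H2 (\<lambda>\<gamma>. cnj (h \<gamma>)) (toeplitz_H2 \<psi> f))
      = ft (toeplitz_H2 (\<lambda>\<gamma>. cnj (h \<gamma>) * \<psi> \<gamma>) f)"
    by (simp add: toeplitz_H2_def m_def mult.assoc)
  then show ?thesis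
    by (simp add: f(2) toeplitz_fourier hc \<psi> H2_L2[OF f(1)] toeplitz_H2_L2 Linf_mult)
qed

lemma toeplitz_Hinf_compose:
  assumes h: "h \<in> Hinf \<mu>" and \<psi>: "\<psi> \<in> Linf \<mu>" and g: "g \<in> l2space posCone"
  shows "toeplitz \<psi> (toeplitz h g) = toeplitz (\<lambda>\<gamma>. \<psi> \<gamma> * h \<gamma>) g"
proof -
  obtain f where f: "f \<in> H2" "g = ft f" by (rule l2space_posConeE[OF g])
  show ?thesis
    unfolding f(2) toeplitz_Hinf_fourier[OF h f(1)]
        toeplitz_fourier[OF \<psi> H2_L2[OF Hinf_mult_H2[OF h f(1)]]]
      toeplitz_fourier[OF Linf_mult[OF \<psi> Hinf_Linf[OF h]] H2_L2[OF f(1)]]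
    by (simp add: toeplitz_H2_def mult.assoc)
qed

lemma diff_toeplitz:
  assumes \<psi>: "\<psi> \<in> Linf \<mu>" "(\<lambda>\<gamma>. 1 - \<psi> \<gamma>) \<in> Linf \<mu>" and g: "g \<in> l2space posCone"
  shows "(\<lambda>\<xi>. g \<xi> - toeplitz \<psi> g \<xi>) = toeplitz (\<lambda>\<gamma>. 1 - \<psi> \<gamma>) g"
proof -
  obtain f where f: "f \<in> H2" "g = ft f" by (rule l2space_posConeE[OF g])
  note fL = H2_L2[OF f(1)]
  have "ft (\<lambda>\<gamma>. (1 - \<psi> \<gamma>) * f \<gamma>) \<xi> = ft f \<xi> - ft (\<lambda>\<gamma>. \<psi> \<gamma> * f \<gamma>) \<xi>" for \<xi>
    using fourier_diff[OF fL Linf_mult_L2[OF \<psi>(1) fL]] by (simp add: left_diff_distrib)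
  then show ?thesis
    using H2_fourier[OF f(1)]
    by (auto simp: fun_eq_iff f(2) toeplitz_fourier fourier_toeplitz_H2 \<psi> fL)
qed

lemma invertible_op_toeplitz_if_near_one:
  assumes \<psi>: "\<psi> \<in> Linf \<mu>" and near: "linf_norm \<mu> (\<lambda>\<gamma>. 1 - \<psi> \<gamma>) < 1"
  shows "invertible_op posCone (toeplitz \<psi>)"
proof -
  have meas: "(\<lambda>\<gamma>. 1 - \<psi> \<gamma>) \<in> borel_measurable \<mu>" using \<psi> by measurable
  obtain \<rho> where \<rho>: "0 \<le> \<rho>" "\<rho> < 1" "AE \<gamma> in \<mu>. cmod (1 - \<psi> \<gamma>) \<le> \<rho>"
    using near unfolding one_ereal_def linf_norm_less_iff[OF meas zero_less_one] by blast
  note diff = LinfI[OF meas \<rho>(3)]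
  show ?thesis
    by (rule invertible_op_if_near_identity[OF bounded_op_toeplitz[OF \<psi>] \<rho>(1,2)])
      (simp add: diff_toeplitz[OF \<psi> diff] l2norm_toeplitz_le[OF diff \<rho>(3,1)])
qed

end


section \<open>Nehari's theorem\<close>

context haar_measure
begin

definition hankel ::
  "(('x \<Rightarrow> complex) \<Rightarrow> complex) \<Rightarrow> (('x \<Rightarrow> complex) \<Rightarrow> complex) \<Rightarrow> ('x \<Rightarrow> complex) \<Rightarrow> complex" where
  "hankel \<psi> f = (\<lambda>\<gamma>. \<psi> \<gamma> * f \<gamma> - toeplitz_H2 \<psi> f \<gamma>)"

lemma hankel_H2_perp: "\<psi> \<in> Linf \<mu> \<Longrightarrow> f \<in> L2 \<mu> \<Longrightarrow> hankel \<psi> f \<in> H2_perp"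
  unfolding hankel_def toeplitz_H2_def by (intro diff_riesz_proj_H2_perp Linf_mult_L2)

lemma hankel_L2: "\<psi> \<in> Linf \<mu> \<Longrightarrow> f \<in> L2 \<mu> \<Longrightarrow> hankel \<psi> f \<in> L2 \<mu>"
  by (rule H2_perp_L2) (rule hankel_H2_perp)

lemma L2_norm_mult_sq_eq_toeplitz_hankel:
  assumes "\<psi> \<in> Linf \<mu>" "f \<in> L2 \<mu>"
  shows "(nrm (\<lambda>\<gamma>. \<psi> \<gamma> * f \<gamma>))\<^sup>2 = (nrm (toeplitz_H2 \<psi> f))\<^sup>2 + (nrm (hankel \<psi> f))\<^sup>2"
  unfolding hankel_def toeplitz_H2_def by (rule L2_norm_riesz_proj_sq[OF Linf_mult_L2[OF assms]])

lemma hankel_lincomb: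
  assumes \<psi>: "\<psi> \<in> Linf \<mu>" and f: "f \<in> L2 \<mu>" and g: "g \<in> L2 \<mu>"
  shows "AE \<gamma> in \<mu>. hankel \<psi> (\<lambda>\<gamma>. c * f \<gamma> + g \<gamma>) \<gamma> = c * hankel \<psi> f \<gamma> + hankel \<psi> g \<gamma>"
proof -
  have fourier: "ft (hankel \<psi> h) \<xi> = (if \<xi> < 0 then ft (\<lambda>\<gamma>. \<psi> \<gamma> * h \<gamma>) \<xi> else 0)"
    if "h \<in> L2 \<mu>" for h \<xi>
    unfolding hankel_def
    by (auto simp: fourier_diff fourier_toeplitz_H2 Linf_mult_L2 toeplitz_H2_L2 \<psi> that)
  have mult: "(\<lambda>\<gamma>. \<psi> \<gamma> * (c * f \<gamma> + g \<gamma>)) = (\<lambda>\<gamma>. c * (\<psi> \<gamma> * f \<gamma>) + \<psi> \<gamma> * g \<gamma>)"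
    by (simp add: ring_distribs mult_ac)
  have "ft (hankel \<psi> (\<lambda>\<gamma>. c * f \<gamma> + g \<gamma>)) = ft (\<lambda>\<gamma>. c * hankel \<psi> f \<gamma> + hankel \<psi> g \<gamma>)"
    by (simp add: fun_eq_iff fourier L2_add L2_cmult f g hankel_L2 \<psi> fourier_add fourier_cmult
        Linf_mult_L2 mult)
  then show ?thesis
    by (subst (asm) L2_fourier_eq_iff) (intro hankel_L2 L2_add L2_cmult \<psi> f g)+
qed

lemma L2_norm_hankel_diff:
  assumes \<psi>: "\<psi> \<in> Linf \<mu>" and f: "f \<in> L2 \<mu>" and g: "g \<in> L2 \<mu>"
  shows "nrm (hankel \<psi> (\<lambda>\<gamma>. f \<gamma> - g \<gamma>)) = nrm (\<lambda>\<gamma>. hankel \<psi> f \<gamma> - hankel \<psi> g \<gamma>)"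
  using hankel_lincomb[OF \<psi> g f, of "- 1"]
  by (intro L2_norm_cong_AE L2_measurable hankel_L2 L2_diff \<psi> f g) simp

lemma L2_norm_hankel_cmult:
  assumes \<psi>: "\<psi> \<in> Linf \<mu>" and f: "f \<in> L2 \<mu>"
  shows "nrm (hankel \<psi> (\<lambda>\<gamma>. c * f \<gamma>)) = cmod c * nrm (hankel \<psi> f)"
proof -
  have "AE \<gamma> in \<mu>. hankel \<psi> (\<lambda>\<gamma>. c * f \<gamma>) \<gamma> = c * hankel \<psi> f \<gamma>"
    using hankel_lincomb[OF \<psi> f f, of "c - 1"] hankel_lincomb[OF \<psi> f L2_zero, of 0]
    by eventually_elim (simp add: algebra_simps)
  then have "nrm (hankel \<psi> (\<lambda>\<gamma>. c * f \<gamma>)) = nrm (\<lambda>\<gamma>. c * hankel \<psi> f \<gamma>)"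
    by (intro L2_norm_cong_AE L2_measurable hankel_L2 L2_cmult \<psi> f)
  then show ?thesis by (simp add: L2_norm_cmult)
qed

lemma inner_hankel_right:
  assumes "b \<in> H2_perp" "\<psi> \<in> Linf \<mu>" "f \<in> L2 \<mu>"
  shows "ip b (hankel \<psi> f) = ip b (\<lambda>\<gamma>. \<psi> \<gamma> * f \<gamma>)"
proof -
  have "ip b (toeplitz_H2 \<psi> f) = 0"
    unfolding L2_inner_eq_0_commute[of \<mu> b]
    by (rule inner_H2_H2_perp[OF toeplitz_H2_H2[OF assms(2,3)] assms(1)])
  then show ?thesis
    unfolding hankel_def using assms
    by (simp add: L2_inner_diff_right H2_perp_L2 Linf_mult_L2 toeplitz_H2_L2)
qed

lemma inner_hankel_adjoint:
  assumes b: "b \<in> H2_perp" and \<psi>: "\<psi> \<in> Linf \<mu>" and e: "e \<in> H2"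
  shows "ip (toeplitz_H2 (\<lambda>\<gamma>. cnj (\<psi> \<gamma>)) b) e = ip b (hankel \<psi> e)"
proof -
  have "ip (toeplitz_H2 (\<lambda>\<gamma>. cnj (\<psi> \<gamma>)) b) e = ip (\<lambda>\<gamma>. cnj (\<psi> \<gamma>) * b \<gamma>) e"
    unfolding toeplitz_H2_def
    by (intro inner_riesz_proj_left Linf_mult_L2 Linf_cnj \<psi> H2_perp_L2[OF b] e)
  also have "\<dots> = ip b (\<lambda>\<gamma>. \<psi> \<gamma> * e \<gamma>)" by (simp add: L2_inner_def mult_ac)
  finally show ?thesis unfolding inner_hankel_right[OF b \<psi> H2_L2[OF e]] .
qed

lemma inner_hankel_mult_char:
  assumes \<psi>: "\<psi> \<in> Linf \<mu>" and f: "f \<in> L2 \<mu>" and "0 \<le> \<xi>"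
  shows "ip (hankel \<psi> f) (\<lambda>\<gamma>. hankel \<psi> f \<gamma> * \<gamma> \<xi>) = ip (hankel \<psi> f) (hankel \<psi> (\<lambda>\<gamma>. f \<gamma> * \<gamma> \<xi>))"
proof -
  define b where "b = hankel \<psi> f"
  define a where "a = (\<lambda>\<gamma>. toeplitz_H2 \<psi> f \<gamma> * \<gamma> \<xi>)"
  have b: "b \<in> H2_perp" unfolding b_def by (rule hankel_H2_perp[OF \<psi> f])
  have a: "a \<in> H2" unfolding a_def by (intro H2_mult_char toeplitz_H2_H2 \<psi> f assms(3))
  have "(\<lambda>\<gamma>. \<psi> \<gamma> * (f \<gamma> * \<gamma> \<xi>)) = (\<lambda>\<gamma>. a \<gamma> + b \<gamma> * \<gamma> \<xi>)"
    by (simp add: a_def b_def hankel_def algebra_simps)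
  then have "ip b (hankel \<psi> (\<lambda>\<gamma>. f \<gamma> * \<gamma> \<xi>)) = ip b a + ip b (\<lambda>\<gamma>. b \<gamma> * \<gamma> \<xi>)"
    by (simp add: inner_hankel_right[OF b \<psi> L2_mult_char[OF f]] L2_inner_add_right H2_perp_L2[OF b]
      H2_L2[OF a] L2_mult_char)
  moreover have "ip b a = 0" using inner_H2_H2_perp[OF a b] by (simp add: L2_inner_eq_0_commute)
  ultimately show ?thesis by (simp add: b_def)
qed

lemma L2_norm_hankel_mult_le:
  assumes \<psi>: "\<psi> \<in> Linf \<mu>" and u: "u \<in> L2 \<mu>" and v: "v \<in> H2" "AE \<gamma> in \<mu>. cmod (v \<gamma>) \<le> 1"
  shows "nrm (hankel \<psi> (\<lambda>\<gamma>. v \<gamma> * u \<gamma>)) \<le> nrm (hankel \<psi> u)"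
proof -
  have vu: "(\<lambda>\<gamma>. v \<gamma> * u \<gamma>) \<in> L2 \<mu>"
    by (rule L2_bounded_mult[OF u L2_measurable[OF H2_L2[OF v(1)]] v(2)])
  have "nrm (hankel \<psi> (\<lambda>\<gamma>. v \<gamma> * u \<gamma>)) \<le> nrm (\<lambda>\<gamma>. \<psi> \<gamma> * (v \<gamma> * u \<gamma>) - v \<gamma> * toeplitz_H2 \<psi> u \<gamma>)"
    unfolding hankel_def toeplitz_H2_def[of _ "\<lambda>\<gamma>. v \<gamma> * u \<gamma>"]
    by (intro riesz_proj_best_approx Linf_mult_L2 \<psi> vu H2_bounded_mult[OF v] toeplitz_H2_H2 u)
  also have "(\<lambda>\<gamma>. \<psi> \<gamma> * (v \<gamma> * u \<gamma>) - v \<gamma> * toeplitz_H2 \<psi> u \<gamma>) = (\<lambda>\<gamma>. v \<gamma> * hankel \<psi> u \<gamma>)"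
    by (simp add: hankel_def algebra_simps)
  also have "nrm \<dots> \<le> 1 * nrm (hankel \<psi> u)"
    by (rule L2_norm_bounded_mult[OF hankel_L2[OF \<psi> u] v(2)]) simp
  finally show ?thesis by simp
qed

definition hankel_sq :: "(('x \<Rightarrow> complex) \<Rightarrow> complex) \<Rightarrow> ('x \<Rightarrow> complex) \<Rightarrow> 'x \<Rightarrow> complex" where
  "hankel_sq \<psi> g \<xi> =
    - 1 * toeplitz (\<lambda>\<gamma>. cnj (\<psi> \<gamma>)) (toeplitz \<psi> g) \<xi> + toeplitz (\<lambda>\<gamma>. cnj (\<psi> \<gamma>) * \<psi> \<gamma>) g \<xi>"

lemma bounded_op_hankel_sq:
  assumes "\<psi> \<in> Linf \<mu>"
  shows "bounded_op posCone (hankel_sq \<psi>)"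
  unfolding hankel_sq_def[abs_def]
  by (rule bounded_op_lincomb[OF bounded_op_compose]; rule bounded_op_toeplitz;
      intro Linf_mult Linf_cnj assms)

lemma hankel_sq_fourier:
  assumes \<psi>: "\<psi> \<in> Linf \<mu>" and f: "f \<in> L2 \<mu>"
  shows "hankel_sq \<psi> (ft f) = ft (toeplitz_H2 (\<lambda>\<gamma>. cnj (\<psi> \<gamma>)) (hankel \<psi> f))"
proof -
  note \<psi>c = Linf_cnj[OF \<psi>] and Tf = toeplitz_H2_L2[OF \<psi> f]
  have "(\<lambda>\<gamma>. cnj (\<psi> \<gamma>) * hankel \<psi> f \<gamma>)
      = (\<lambda>\<gamma>. (cnj (\<psi> \<gamma>) * \<psi> \<gamma>) * f \<gamma> - cnj (\<psi> \<gamma>) * toeplitz_H2 \<psi> f \<gamma>)"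
    by (simp add: hankel_def algebra_simps)
  then have "ft (\<lambda>\<gamma>. cnj (\<psi> \<gamma>) * hankel \<psi> f \<gamma>) \<xi> =
      ft (\<lambda>\<gamma>. (cnj (\<psi> \<gamma>) * \<psi> \<gamma>) * f \<gamma>) \<xi> - ft (\<lambda>\<gamma>. cnj (\<psi> \<gamma>) * toeplitz_H2 \<psi> f \<gamma>) \<xi>" for \<xi>
    using fourier_diff[OF Linf_mult_L2[OF Linf_mult[OF \<psi>c \<psi>] f] Linf_mult_L2[OF \<psi>c Tf]] by simp
  then show ?thesis
    by (simp add: fun_eq_iff hankel_sq_def toeplitz_fourier fourier_toeplitz_H2 \<psi> \<psi>c f Tf hankel_L2
        Linf_mult)
qed

end

locale nehari_problem = haar_measure \<mu>
  for \<mu> :: "('x::linordered_ab_group_add \<Rightarrow> complex) measure" +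
  fixes \<phi> :: "('x \<Rightarrow> complex) \<Rightarrow> complex" and r t :: real
  assumes phi_Linf: "\<phi> \<in> Linf \<mu>" and r_nonneg: "0 \<le> r" and r_less: "r < t"
    and hankel_bound: "\<And>f. f \<in> H2 \<Longrightarrow> nrm (hankel \<phi> f) \<le> r * nrm f"
begin

definition nehari_solution :: "(('x \<Rightarrow> complex) \<Rightarrow> complex) \<Rightarrow> bool" where
  "nehari_solution p \<longleftrightarrow> p \<in> H2 \<and>
     (\<forall>e\<in>H2. of_real (t\<^sup>2) * ip p e - ip (hankel \<phi> p) (hankel \<phi> e) = cnj (ft e 0))"

definition energy :: "(('x \<Rightarrow> complex) \<Rightarrow> complex) \<Rightarrow> real" where
  "energy f = t\<^sup>2 * (nrm f)\<^sup>2 - (nrm (hankel \<phi> f))\<^sup>2"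

lemma r_sq_less: "r\<^sup>2 < t\<^sup>2"
  using r_nonneg r_less by (intro power_strict_mono) auto

lemma nehari_solution_H2: "nehari_solution p \<Longrightarrow> p \<in> H2"
  and nehari_solutionD: "nehari_solution p \<Longrightarrow> e \<in> H2 \<Longrightarrow>
    of_real (t\<^sup>2) * ip p e - ip (hankel \<phi> p) (hankel \<phi> e) = cnj (ft e 0)"
  by (simp_all add: nehari_solution_def)

lemma L2_norm_hankel_adjoint_le:
  assumes b: "b \<in> H2_perp"
  shows "nrm (toeplitz_H2 (\<lambda>\<gamma>. cnj (\<phi> \<gamma>)) b) \<le> r * nrm b"
proof -
  define e where "e = toeplitz_H2 (\<lambda>\<gamma>. cnj (\<phi> \<gamma>)) b"
  have e: "e \<in> H2" unfolding e_def by (intro toeplitz_H2_H2 Linf_cnj phi_Linf H2_perp_L2 b)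
  have "(nrm e)\<^sup>2 = cmod (ip b (hankel \<phi> e))"
    unfolding inner_hankel_adjoint[OF b phi_Linf e, symmetric] e_def[symmetric] L2_inner_self
        norm_of_real by simp
  also have "\<dots> \<le> nrm b * nrm (hankel \<phi> e)"
    by (intro L2_Cauchy_Schwarz H2_perp_L2[OF b] hankel_L2 phi_Linf H2_L2[OF e])
  also have "\<dots> \<le> nrm b * (r * nrm e)" by (intro mult_left_mono hankel_bound e) simp
  finally have "(nrm e)\<^sup>2 \<le> (r * nrm b) * nrm e" by (simp add: mult_ac)
  from le_if_power2_le_mult[OF this] show ?thesis unfolding e_def[symmetric] using r_nonneg by simp
qed

lemma l2norm_hankel_sq_le:
  assumes g: "g \<in> l2space posCone"
  shows "l2norm (hankel_sq \<phi> g) \<le> r\<^sup>2 * l2norm g"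
proof -
  obtain f where f: "f \<in> H2" "g = ft f" by (rule l2space_posConeE[OF g])
  note fL = H2_L2[OF f(1)]
  have "l2norm (hankel_sq \<phi> g) = nrm (toeplitz_H2 (\<lambda>\<gamma>. cnj (\<phi> \<gamma>)) (hankel \<phi> f))"
    unfolding f(2) hankel_sq_fourier[OF phi_Linf fL]
    by (intro l2norm_fourier toeplitz_H2_L2 Linf_cnj phi_Linf hankel_L2 fL)
  also have "\<dots> \<le> r * nrm (hankel \<phi> f)"
    by (intro L2_norm_hankel_adjoint_le hankel_H2_perp phi_Linf fL)
  also have "\<dots> \<le> r * (r * nrm f)" by (intro mult_left_mono hankel_bound f(1) r_nonneg)
  finally show ?thesis by (simp add: f(2) l2norm_fourier fL power2_eq_square)
qed

lemma nehari_equation_solvable: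
  assumes y: "y \<in> l2space posCone"
  obtains g where "g \<in> l2space posCone" "\<And>\<xi>. of_real (t\<^sup>2) * g \<xi> = hankel_sq \<phi> g \<xi> + y \<xi>"
proof -
  have t0: "t \<noteq> 0" using r_nonneg r_less by auto
  define a where "a = complex_of_real (1 / t\<^sup>2)"
  define N where "N g = (\<lambda>\<xi>. - a * hankel_sq \<phi> g \<xi> + g \<xi>)" for g
  have "l2norm (\<lambda>\<xi>. g \<xi> - N g \<xi>) \<le> (r\<^sup>2 / t\<^sup>2) * l2norm g" if "g \<in> l2space posCone" for g
  proof -
    have "l2norm (\<lambda>\<xi>. g \<xi> - N g \<xi>) = l2norm (hankel_sq \<phi> g) / t\<^sup>2"
      using L2_norm_cmult[of "count_space UNIV" a "hankel_sq \<phi> g"]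
      by (simp add: N_def l2norm_eq_L2_norm a_def norm_divide norm_power)
    also have "\<dots> \<le> r\<^sup>2 * l2norm g / t\<^sup>2" by (intro divide_right_mono l2norm_hankel_sq_le that) simp
    finally show ?thesis by simp
  qed
  moreover have "bounded_op posCone N"
    unfolding N_def by (intro bounded_op_lincomb bounded_op_hankel_sq bounded_op_id phi_Linf)
  ultimately have "invertible_op posCone N"
    using r_sq_less t0
    by (intro invertible_op_if_near_identity[of posCone N "r\<^sup>2 / t\<^sup>2"]) (auto simp: divide_less_eq)
  moreover have "(\<lambda>\<xi>. a * y \<xi>) \<in> l2space posCone" using l2space_lincomb[OF y zero_l2space] by simp
  ultimately obtain g where g: "g \<in> l2space posCone" "N g = (\<lambda>\<xi>. a * y \<xi>)"
    unfolding invertible_op_def using bounded_op_l2space by blast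
  have "of_real (t\<^sup>2) * g \<xi> = hankel_sq \<phi> g \<xi> + y \<xi>" for \<xi>
    using fun_cong[OF g(2), of \<xi>] t0 by (simp add: N_def a_def field_simps)
  with g(1) show ?thesis by (rule that)
qed

lemma nehari_solution_exists:
  obtains p where "nehari_solution p"
proof -
  obtain g where g: "g \<in> l2space posCone"
    and g_eq: "\<And>\<xi>. of_real (t\<^sup>2) * g \<xi> = hankel_sq \<phi> g \<xi> + ft (\<lambda>\<gamma>. 1) \<xi>"
    by (rule nehari_equation_solvable[OF fourier_H2_l2space[OF one_H2]]) blast
  obtain p where p: "p \<in> H2" "g = ft p" by (rule l2space_posConeE[OF g])
  note pL = H2_L2[OF p(1)]
  define k where "k = toeplitz_H2 (\<lambda>\<gamma>. cnj (\<phi> \<gamma>)) (hankel \<phi> p)"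
  have k: "k \<in> L2 \<mu>" unfolding k_def by (intro toeplitz_H2_L2 Linf_cnj phi_Linf hankel_L2 pL)
  have "ft (\<lambda>\<gamma>. of_real (t\<^sup>2) * p \<gamma>) = ft (\<lambda>\<gamma>. k \<gamma> + 1)"
    using g_eq
    by (simp add: fun_eq_iff fourier_cmult fourier_add k one_L2 p(2) hankel_sq_fourier phi_Linf pL
        flip: k_def)
  then have p_eq: "AE \<gamma> in \<mu>. of_real (t\<^sup>2) * p \<gamma> = k \<gamma> + 1"
    by (subst (asm) L2_fourier_eq_iff) (intro pL L2_add L2_cmult k one_L2)+
  have "of_real (t\<^sup>2) * ip p e - ip (hankel \<phi> p) (hankel \<phi> e) = cnj (ft e 0)" if e: "e \<in> H2" for e
  proof -
    have "of_real (t\<^sup>2) * ip p e = ip (\<lambda>\<gamma>. of_real (t\<^sup>2) * p \<gamma>) e"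
      by (simp only: L2_inner_cmult_left)
    also have "\<dots> = ip (\<lambda>\<gamma>. k \<gamma> + 1) e"
      using p_eq by (intro L2_inner_cong_AE L2_measurable L2_cmult pL H2_L2 e L2_add k one_L2) auto
    also have "\<dots> = ip k e + ip (\<lambda>\<gamma>. 1) e" by (rule L2_inner_add_left[OF k one_L2 H2_L2[OF e]])
    also have "ip k e = ip (hankel \<phi> p) (hankel \<phi> e)"
      unfolding k_def by (intro inner_hankel_adjoint hankel_H2_perp phi_Linf pL e)
    also have "ip (\<lambda>\<gamma>. 1) e = cnj (ft e 0)" by (simp add: fourier_at_0 L2_inner_def)
    finally show ?thesis by simp
  qed
  with p(1) show ?thesis using that[of p] by (simp add: nehari_solution_def)
qed

lemma energy_ge: "f \<in> H2 \<Longrightarrow> (t\<^sup>2 - r\<^sup>2) * (nrm f)\<^sup>2 \<le> energy f"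
  using power_mono[OF hankel_bound, of f 2]
  by (simp add: energy_def power_mult_distrib algebra_simps)

lemma energy_nonneg: "f \<in> H2 \<Longrightarrow> 0 \<le> energy f"
  using energy_ge[of f] r_sq_less
  by (meson diff_ge_0_iff_ge less_imp_le mult_nonneg_nonneg order_trans zero_le_power2)

lemma L2_norm_eq_0_if_energy_nonpos:
  assumes "f \<in> H2" "energy f \<le> 0"
  shows "nrm f = 0"
proof -
  have "(t\<^sup>2 - r\<^sup>2) * (nrm f)\<^sup>2 \<le> 0" using energy_ge[OF assms(1)] assms(2) by linarith
  then show ?thesis using r_sq_less by (auto simp: mult_le_0_iff)
qed

lemma energy_cmult:
  assumes "f \<in> L2 \<mu>"
  shows "energy (\<lambda>\<gamma>. c * f \<gamma>) = (cmod c)\<^sup>2 * energy f"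
  by (simp add: energy_def L2_norm_cmult L2_norm_hankel_cmult phi_Linf assms algebra_simps
      power_mult_distrib)

lemma energy_inner_mult_le:
  assumes u: "u \<in> L2 \<mu>" and v: "v \<in> H2" "AE \<gamma> in \<mu>. cmod (v \<gamma>) = 1"
    and p: "p \<in> L2 \<mu>" "AE \<gamma> in \<mu>. p \<gamma> = u \<gamma> * v \<gamma>"
  shows "energy u \<le> energy p"
proof -
  have v1: "AE \<gamma> in \<mu>. cmod (v \<gamma>) \<le> 1" using v(2) by eventually_elim simp
  note vm = L2_measurable[OF H2_L2[OF v(1)]]
  have vu: "(\<lambda>\<gamma>. v \<gamma> * u \<gamma>) \<in> L2 \<mu>" by (rule L2_bounded_mult[OF u vm v1])
  have p_eq: "AE \<gamma> in \<mu>. p \<gamma> = v \<gamma> * u \<gamma>" using p(2) by eventually_elim simp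
  have "hankel \<phi> p \<in> borel_measurable \<mu>" "hankel \<phi> (\<lambda>\<gamma>. v \<gamma> * u \<gamma>) \<in> borel_measurable \<mu>"
    by (intro L2_measurable hankel_L2 phi_Linf p(1) vu)+
  moreover have "AE \<gamma> in \<mu>. hankel \<phi> p \<gamma> = hankel \<phi> (\<lambda>\<gamma>. v \<gamma> * u \<gamma>) \<gamma>"
    unfolding hankel_def toeplitz_H2_cong_AE[OF phi_Linf p(1) vu p_eq] using p_eq
    by eventually_elim simp
  ultimately have "nrm (hankel \<phi> p) = nrm (hankel \<phi> (\<lambda>\<gamma>. v \<gamma> * u \<gamma>))" by (rule L2_norm_cong_AE)
  then have "(nrm (hankel \<phi> p))\<^sup>2 \<le> (nrm (hankel \<phi> u))\<^sup>2"
    using L2_norm_hankel_mult_le[OF phi_Linf u v(1) v1] by (intro power_mono) auto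
  moreover have "(\<integral>\<gamma>. (cmod (p \<gamma>))\<^sup>2 \<partial>\<mu>) = (\<integral>\<gamma>. (cmod (u \<gamma>))\<^sup>2 \<partial>\<mu>)"
  proof (rule integral_cong_AE)
    show "AE \<gamma> in \<mu>. (cmod (p \<gamma>))\<^sup>2 = (cmod (u \<gamma>))\<^sup>2"
      using v(2) p(2) by eventually_elim (simp add: norm_mult)
  qed (use L2_measurable[OF u] L2_measurable[OF p(1)] in measurable)
  ultimately show ?thesis by (simp add: energy_def L2_norm_sq)
qed

lemma fourier_nehari_solution_at_0:
  assumes "nehari_solution p"
  shows "ft p 0 = of_real (energy p)"
proof -
  have "cnj (ft p 0) = of_real (energy p)"
    using nehari_solutionD[OF assms nehari_solution_H2[OF assms]]
    by (simp add: L2_inner_self energy_def)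
  then show ?thesis by (metis complex_cnj_cnj complex_cnj_complex_of_real)
qed

lemma energy_nehari_solution_pos:
  assumes p: "nehari_solution p"
  shows "0 < energy p"
proof (rule ccontr)
  note pL = H2_L2[OF nehari_solution_H2[OF p]]
  assume "\<not> 0 < energy p"
  then have "nrm p = 0" by (intro L2_norm_eq_0_if_energy_nonpos nehari_solution_H2 p) simp
  moreover from this have "nrm (hankel \<phi> p) = 0"
    using hankel_bound[OF nehari_solution_H2[OF p]] L2_norm_nonneg[of \<mu> "hankel \<phi> p"] by simp
  ultimately have "ip p (\<lambda>\<gamma>. 1) = 0" "ip (hankel \<phi> p) (hankel \<phi> (\<lambda>\<gamma>. 1)) = 0"
    using L2_Cauchy_Schwarz[OF pL one_L2]
          L2_Cauchy_Schwarz[OF hankel_L2 hankel_L2, OF phi_Linf pL phi_Linf one_L2]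
    by simp_all
  then show False using nehari_solutionD[OF p one_H2] by (simp add: fourier_one)
qed

lemma nehari_solution_modulus:
  assumes p: "nehari_solution p"
  shows "AE \<gamma> in \<mu>. t\<^sup>2 * (cmod (p \<gamma>))\<^sup>2 - (cmod (hankel \<phi> p \<gamma>))\<^sup>2 = energy p"
proof -
  note pH = nehari_solution_H2[OF p] and pL = H2_L2[OF nehari_solution_H2[OF p]]
  define b where "b = hankel \<phi> p"
  have bL: "b \<in> L2 \<mu>" unfolding b_def by (rule hankel_L2[OF phi_Linf pL])
  define D where "D \<gamma> = t\<^sup>2 * (cmod (p \<gamma>))\<^sup>2 - (cmod (b \<gamma>))\<^sup>2" for \<gamma>
  have int: "integrable \<mu> D" unfolding D_def using L2_integrable_sq[OF pL] L2_integrable_sq[OF bL]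
    by simp
  have "AE \<gamma> in \<mu>. D \<gamma> = (\<integral>\<gamma>. D \<gamma> \<partial>\<mu>)"
  proof (rule AE_const_if_positive_fourier_zero[OF int])
    fix \<xi> :: 'x assume \<xi>: "\<xi> > 0"
    define e where "e = (\<lambda>\<gamma>. p \<gamma> * \<gamma> \<xi>)"
    have e: "e \<in> H2" unfolding e_def using \<xi> by (intro H2_mult_char pH) simp
    have "ft (\<lambda>\<gamma>. of_real (D \<gamma>)) \<xi> =
        (\<integral>\<gamma>. of_real (t\<^sup>2) * (p \<gamma> * cnj (e \<gamma>)) - b \<gamma> * cnj (b \<gamma> * \<gamma> \<xi>) \<partial>\<mu>)"
      unfolding fourier_def D_def e_def of_real_diff of_real_mult complex_norm_square
      by (simp add: algebra_simps)
    also have "\<dots> = of_real (t\<^sup>2) * ip p e - ip b (\<lambda>\<gamma>. b \<gamma> * \<gamma> \<xi>)"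
      using L2_inner_integrable[OF pL H2_L2[OF e]] L2_inner_integrable[OF bL L2_mult_char[OF bL]]
      unfolding L2_inner_def by (subst Bochner_Integration.integral_diff) auto
    also have "ip b (\<lambda>\<gamma>. b \<gamma> * \<gamma> \<xi>) = ip b (hankel \<phi> e)"
      unfolding b_def e_def using \<xi> by (intro inner_hankel_mult_char phi_Linf pL) simp
    also have "of_real (t\<^sup>2) * ip p e - ip b (hankel \<phi> e) = cnj (ft e 0)"
      unfolding b_def by (rule nehari_solutionD[OF p e])
    also have "ft e 0 = 0"
      unfolding e_def fourier_mult_char by (rule H2_fourier[OF pH]) (use \<xi> in simp)
    finally show "ft (\<lambda>\<gamma>. of_real (D \<gamma>)) \<xi> = 0" by simp
  qed
  moreover have "(\<integral>\<gamma>. D \<gamma> \<partial>\<mu>) = energy p"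
    unfolding D_def energy_def L2_norm_sq b_def[symmetric]
    using L2_integrable_sq[OF pL] L2_integrable_sq[OF bL] by simp
  ultimately show ?thesis unfolding D_def b_def by simp
qed

text \<open>The solution minimizes the energy among the \<open>f\<close> with the same mean value; since passing to the
  outer factor decreases the energy, the solution has no inner factor.\<close>

lemma nehari_solution_unique_minimizer:
  assumes p: "nehari_solution p" and f: "f \<in> H2" "ft f 0 = ft p 0" "energy f \<le> energy p"
  shows "AE \<gamma> in \<mu>. f \<gamma> = p \<gamma>"
proof -
  note pH = nehari_solution_H2[OF p] and fL = H2_L2[OF f(1)]
  note pL = H2_L2[OF pH]
  have "energy (\<lambda>\<gamma>. f \<gamma> - p \<gamma>) =
      energy f + energy p - 2 * (t\<^sup>2 * Re (ip f p) - Re (ip (hankel \<phi> f) (hankel \<phi> p)))"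
    unfolding energy_def L2_norm_hankel_diff[OF phi_Linf fL pL] L2_norm_diff_sq[OF fL pL]
      L2_norm_diff_sq[OF hankel_L2[OF phi_Linf fL] hankel_L2[OF phi_Linf pL]]
        by (simp add: algebra_simps)
  also have "t\<^sup>2 * Re (ip f p) - Re (ip (hankel \<phi> f) (hankel \<phi> p)) = energy p"
    using arg_cong[OF nehari_solutionD[OF p f(1)], of Re] L2_inner_commute[of \<mu> p f]
      L2_inner_commute[of \<mu> "hankel \<phi> p" "hankel \<phi> f"] f(2) fourier_nehari_solution_at_0[OF p]
        by simp
  finally have "energy (\<lambda>\<gamma>. f \<gamma> - p \<gamma>) \<le> 0" using f(3) by simp
  then have "nrm (\<lambda>\<gamma>. f \<gamma> - p \<gamma>) = 0"
    by (rule L2_norm_eq_0_if_energy_nonpos[OF H2_diff[OF f(1) pH]])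
  then show ?thesis using L2_norm_eq_0_iff[OF L2_diff[OF fL pL]] by simp
qed

lemma nehari_solution_norm_sq_ge:
  assumes "nehari_solution p"
  shows "AE \<gamma> in \<mu>. energy p / t\<^sup>2 \<le> (cmod (p \<gamma>))\<^sup>2"
  using nehari_solution_modulus[OF assms]
proof eventually_elim
  case (elim \<gamma>)
  have "energy p \<le> t\<^sup>2 * (cmod (p \<gamma>))\<^sup>2" unfolding elim[symmetric] by simp
  moreover have "t > 0" using r_nonneg r_less by linarith
  ultimately show ?case by (simp add: divide_le_eq mult.commute)
qed

lemma nehari_solution_outer:
  assumes p: "nehari_solution p"
  obtains q where "q \<in> H2" "AE \<gamma> in \<mu>. p \<gamma> * q \<gamma> = 1"
proof -
  note pH = nehari_solution_H2[OF p]
  have "energy p / t\<^sup>2 > 0" using energy_nehari_solution_pos[OF p] r_nonneg r_less by simp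
  then obtain u v w where u: "u \<in> H2" and v: "v \<in> H2" "AE \<gamma> in \<mu>. cmod (v \<gamma>) = 1" and w: "w \<in> H2"
    and p_eq: "AE \<gamma> in \<mu>. p \<gamma> = u \<gamma> * v \<gamma>" and uw: "AE \<gamma> in \<mu>. u \<gamma> * w \<gamma> = 1"
    by (rule inner_outer_factorization[OF pH _ nehari_solution_norm_sq_ge[OF p]]) blast
  note [measurable] = L2_measurable[OF H2_L2[OF u]] L2_measurable[OF H2_L2[OF v(1)]]
      L2_measurable[OF H2_L2[OF pH]]
  define \<beta> where "\<beta> = ft v 0"
  have \<beta>_le: "cmod \<beta> \<le> 1"
    using cmod_fourier_le[OF H2_L2[OF v(1)], of 0] L2_norm_unimodular[OF _ v(2)]
    by (simp add: \<beta>_def)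
  have "ft p = ft (\<lambda>\<gamma>. u \<gamma> * v \<gamma>)" by (rule fourier_cong_AE[OF _ _ p_eq]) measurable
  then have u\<beta>: "\<beta> * ft u 0 = ft p 0"
    using fourier_H2_mult(2)[OF u v(1)] by (simp add: \<beta>_def mult.commute)
  have "ft p 0 \<noteq> 0" unfolding fourier_nehari_solution_at_0[OF p]
    using energy_nehari_solution_pos[OF p] by simp
  with u\<beta> have \<beta>0: "\<beta> \<noteq> 0" by auto
  have "energy (\<lambda>\<gamma>. \<beta> * u \<gamma>) \<le> 1 * energy u"
    unfolding energy_cmult[OF H2_L2[OF u]]
    using \<beta>_le energy_nonneg[OF u] by (intro mult_right_mono) (auto simp: power_le_one)
  also have "\<dots> \<le> energy p" using energy_inner_mult_le[OF H2_L2[OF u] v H2_L2[OF pH] p_eq] by simp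
  finally have "AE \<gamma> in \<mu>. \<beta> * u \<gamma> = p \<gamma>"
    using u\<beta>
    by (intro nehari_solution_unique_minimizer[OF p] H2_cmult u) (simp_all add: fourier_cmult)
  with uw have "AE \<gamma> in \<mu>. p \<gamma> * (inverse \<beta> * w \<gamma>) = 1"
  proof eventually_elim
    case (elim \<gamma>)
    have "p \<gamma> * (inverse \<beta> * w \<gamma>) = (\<beta> * inverse \<beta>) * (u \<gamma> * w \<gamma>)"
      unfolding elim(2)[symmetric] by (simp add: mult_ac)
    then show ?case using \<beta>0 elim(1) by simp
  qed
  with H2_cmult[OF w] show ?thesis by (rule that)
qed

lemma nehari_quotient_near:
  assumes p: "nehari_solution p" and q: "AE \<gamma> in \<mu>. p \<gamma> * q \<gamma> = 1"
  shows "AE \<gamma> in \<mu>. cmod (\<phi> \<gamma> - toeplitz_H2 \<phi> p \<gamma> * q \<gamma>) \<le> t"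
  using q nehari_solution_modulus[OF p]
proof eventually_elim
  case (elim \<gamma>)
  have "\<phi> \<gamma> - toeplitz_H2 \<phi> p \<gamma> * q \<gamma> = \<phi> \<gamma> * (p \<gamma> * q \<gamma>) - toeplitz_H2 \<phi> p \<gamma> * q \<gamma>"
    by (simp add: elim(1))
  also have "\<dots> = hankel \<phi> p \<gamma> * q \<gamma>" by (simp add: hankel_def algebra_simps)
  finally have "(cmod (\<phi> \<gamma> - toeplitz_H2 \<phi> p \<gamma> * q \<gamma>))\<^sup>2 = (cmod (hankel \<phi> p \<gamma>))\<^sup>2 * (cmod (q \<gamma>))\<^sup>2"
    by (simp add: norm_mult power_mult_distrib)
  also have "\<dots> \<le> (t\<^sup>2 * (cmod (p \<gamma>))\<^sup>2) * (cmod (q \<gamma>))\<^sup>2"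
    using elim(2) energy_nehari_solution_pos[OF p] by (intro mult_right_mono) auto
  also have "\<dots> = t\<^sup>2 * (cmod (p \<gamma> * q \<gamma>))\<^sup>2" by (simp add: norm_mult power_mult_distrib)
  also have "\<dots> = t\<^sup>2" by (simp add: elim(1))
  finally show ?case by (rule power2_le_imp_le) (use r_nonneg r_less in simp)
qed

end

theorem (in haar_measure) nehari:
  assumes \<phi>: "\<phi> \<in> Linf \<mu>" and r: "0 \<le> r" "r < t"
    and bound: "\<And>f. f \<in> H2 \<Longrightarrow> nrm (hankel \<phi> f) \<le> r * nrm f"
  obtains h where "h \<in> Hinf \<mu>" "AE \<gamma> in \<mu>. cmod (\<phi> \<gamma> - h \<gamma>) \<le> t"
proof -
  interpret nehari_problem \<mu> \<phi> r t
    by unfold_locales (use assms in auto)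
  obtain p where p: "nehari_solution p" by (rule nehari_solution_exists)
  obtain q where q: "q \<in> H2" "AE \<gamma> in \<mu>. p \<gamma> * q \<gamma> = 1" by (rule nehari_solution_outer[OF p])
  define a where "a = toeplitz_H2 \<phi> p"
  have a: "a \<in> H2" unfolding a_def by (intro toeplitz_H2_H2 \<phi> H2_L2 nehari_solution_H2 p)
  define h where "h = (\<lambda>\<gamma>. a \<gamma> * q \<gamma>)"
  have [measurable]: "h \<in> borel_measurable \<mu>"
    unfolding h_def using L2_measurable[OF H2_L2[OF a]] L2_measurable[OF H2_L2[OF q(1)]]
    by measurable
  have near: "AE \<gamma> in \<mu>. cmod (\<phi> \<gamma> - h \<gamma>) \<le> t"
    unfolding h_def a_def by (rule nehari_quotient_near[OF p q(2)])
  obtain C where "AE \<gamma> in \<mu>. cmod (\<phi> \<gamma>) \<le> C" using Linf_bound[OF \<phi>] by blast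
  with near have h_bound: "AE \<gamma> in \<mu>. cmod (h \<gamma>) \<le> C + t"
  proof eventually_elim
    case (elim \<gamma>)
    then show ?case using norm_triangle_ineq4[of "\<phi> \<gamma>" "\<phi> \<gamma> - h \<gamma>"] by simp
  qed
  have "h \<in> Linf \<mu>" by (rule LinfI[OF _ h_bound]) measurable
  moreover have "h \<in> H2"
  proof (rule H2I)
    show "h \<in> L2 \<mu>" by (rule L2_bounded[OF _ h_bound]) measurable
    show "ft h \<xi> = 0" if "\<xi> < 0" for \<xi> unfolding h_def by (rule fourier_H2_mult(1)[OF a q(1) that])
  qed
  ultimately have "h \<in> Hinf \<mu>" by (simp add: Hinf_iff)
  then show ?thesis using near by (rule that)
qed


section \<open>Invertibility of Toeplitz operators with unimodular symbol\<close>

context haar_measure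
begin

lemma linf_norm_one_minus_cnj_mult:
  assumes \<phi>: "\<phi> \<in> borel_measurable \<mu>" "AE \<gamma> in \<mu>. cmod (\<phi> \<gamma>) = 1" and h: "h \<in> borel_measurable \<mu>"
  shows "linf_norm \<mu> (\<lambda>\<gamma>. 1 - cnj (h \<gamma>) * \<phi> \<gamma>) = linf_norm \<mu> (\<lambda>\<gamma>. \<phi> \<gamma> - h \<gamma>)"
    and "linf_norm \<mu> (\<lambda>\<gamma>. 1 - cnj (\<phi> \<gamma>) * h \<gamma>) = linf_norm \<mu> (\<lambda>\<gamma>. \<phi> \<gamma> - h \<gamma>)"
proof -
  show "linf_norm \<mu> (\<lambda>\<gamma>. 1 - cnj (\<phi> \<gamma>) * h \<gamma>) = linf_norm \<mu> (\<lambda>\<gamma>. \<phi> \<gamma> - h \<gamma>)"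
    unfolding linf_norm_def
  proof (rule esssup_AE_cong)
    show "AE \<gamma> in \<mu>. ereal (cmod (1 - cnj (\<phi> \<gamma>) * h \<gamma>)) = ereal (cmod (\<phi> \<gamma> - h \<gamma>))"
      using \<phi>(2)
    proof eventually_elim
      case (elim \<gamma>)
      have "cnj (\<phi> \<gamma>) * \<phi> \<gamma> = 1" using complex_norm_square[of "\<phi> \<gamma>"] elim
        by (simp add: mult.commute)
      then have "1 - cnj (\<phi> \<gamma>) * h \<gamma> = cnj (\<phi> \<gamma>) * (\<phi> \<gamma> - h \<gamma>)" by (simp add: right_diff_distrib)
      then show ?case using elim by (simp add: norm_mult)
    qed
  qed (use \<phi> h in measurable)
  have "cmod (1 - cnj (h \<gamma>) * \<phi> \<gamma>) = cmod (1 - cnj (\<phi> \<gamma>) * h \<gamma>)" for \<gamma>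
    using complex_mod_cnj[of "1 - cnj (h \<gamma>) * \<phi> \<gamma>"] by (simp add: mult.commute)
  then show "linf_norm \<mu> (\<lambda>\<gamma>. 1 - cnj (h \<gamma>) * \<phi> \<gamma>) = linf_norm \<mu> (\<lambda>\<gamma>. \<phi> \<gamma> - h \<gamma>)"
    using \<open>linf_norm \<mu> (\<lambda>\<gamma>. 1 - cnj (\<phi> \<gamma>) * h \<gamma>) = linf_norm \<mu> (\<lambda>\<gamma>. \<phi> \<gamma> - h \<gamma>)\<close>
    by (simp add: linf_norm_def)
qed

lemma invertible_op_toeplitz_compose_if_near:
  assumes \<phi>: "\<phi> \<in> Linf \<mu>" "AE \<gamma> in \<mu>. cmod (\<phi> \<gamma>) = 1"
    and h: "h \<in> Hinf \<mu>" and near: "linf_norm \<mu> (\<lambda>\<gamma>. \<phi> \<gamma> - h \<gamma>) < 1"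
  shows "invertible_op posCone (\<lambda>g. toeplitz (\<lambda>\<gamma>. cnj (h \<gamma>)) (toeplitz \<phi> g))"
    and "invertible_op posCone (\<lambda>g. toeplitz (\<lambda>\<gamma>. cnj (\<phi> \<gamma>)) (toeplitz h g))"
proof -
  note hL = Hinf_Linf[OF h] and hc = Linf_cnj[OF Hinf_Linf[OF h]] and \<phi>c = Linf_cnj[OF \<phi>(1)]
  note norms = linf_norm_one_minus_cnj_mult[OF Linf_measurable[OF \<phi>(1)] \<phi>(2) Linf_measurable[OF hL]]
  have "invertible_op posCone (\<lambda>g. toeplitz (\<lambda>\<gamma>. cnj (h \<gamma>)) (toeplitz \<phi> g)) \<longleftrightarrow>
      invertible_op posCone (toeplitz (\<lambda>\<gamma>. cnj (h \<gamma>) * \<phi> \<gamma>))"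
    by (rule invertible_op_cong) (rule toeplitz_cnj_Hinf_compose[OF h \<phi>(1)])
  then show "invertible_op posCone (\<lambda>g. toeplitz (\<lambda>\<gamma>. cnj (h \<gamma>)) (toeplitz \<phi> g))"
    using invertible_op_toeplitz_if_near_one[OF Linf_mult[OF hc \<phi>(1)]] near by (simp add: norms)
  have "invertible_op posCone (\<lambda>g. toeplitz (\<lambda>\<gamma>. cnj (\<phi> \<gamma>)) (toeplitz h g)) \<longleftrightarrow>
      invertible_op posCone (toeplitz (\<lambda>\<gamma>. cnj (\<phi> \<gamma>) * h \<gamma>))"
    by (rule invertible_op_cong) (rule toeplitz_Hinf_compose[OF h \<phi>c])
  then show "invertible_op posCone (\<lambda>g. toeplitz (\<lambda>\<gamma>. cnj (\<phi> \<gamma>)) (toeplitz h g))"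
    using invertible_op_toeplitz_if_near_one[OF Linf_mult[OF \<phi>c hL]] near by (simp add: norms)
qed

lemma hankel_bound_if_left_invertible_toeplitz:
  assumes \<phi>: "\<phi> \<in> Linf \<mu>" "AE \<gamma> in \<mu>. cmod (\<phi> \<gamma>) \<le> 1"
    and inv: "left_invertible_op posCone (toeplitz \<phi>)"
  obtains r where "0 \<le> r" "r < 1" "\<And>f. f \<in> H2 \<Longrightarrow> nrm (hankel \<phi> f) \<le> r * nrm f"
proof -
  obtain \<epsilon> where "\<epsilon> > 0" and below: "\<And>g. g \<in> l2space posCone \<Longrightarrow> \<epsilon> * l2norm g \<le> l2norm (toeplitz \<phi> g)"
    by (rule left_invertible_op_bounded_below[OF inv]) blast
  define \<delta> where "\<delta> = min \<epsilon> 1"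
  have \<delta>: "0 < \<delta>" "\<delta>\<^sup>2 \<le> 1" using \<open>\<epsilon> > 0\<close> by (auto simp: \<delta>_def power_le_one)
  show ?thesis
  proof (rule that)
    show "0 \<le> sqrt (1 - \<delta>\<^sup>2)" "sqrt (1 - \<delta>\<^sup>2) < 1" using \<delta> by simp_all
    fix f assume f: "f \<in> H2"
    note fL = H2_L2[OF f]
    have "\<delta> * nrm f \<le> \<epsilon> * nrm f" by (intro mult_right_mono) (auto simp: \<delta>_def)
    also have "\<dots> \<le> nrm (toeplitz_H2 \<phi> f)"
      using below[OF fourier_H2_l2space[OF f]]
      by (simp add: l2norm_fourier l2norm_toeplitz_fourier \<phi>(1) fL)
    finally have "(\<delta> * nrm f)\<^sup>2 \<le> (nrm (toeplitz_H2 \<phi> f))\<^sup>2" using \<delta>(1) by (intro power_mono) auto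
    moreover have "(nrm (\<lambda>\<gamma>. \<phi> \<gamma> * f \<gamma>))\<^sup>2 \<le> (1 * nrm f)\<^sup>2"
      by (intro power_mono L2_norm_bounded_mult fL \<phi>(2)) auto
    ultimately have "(nrm (hankel \<phi> f))\<^sup>2 \<le> (sqrt (1 - \<delta>\<^sup>2) * nrm f)\<^sup>2"
      using L2_norm_mult_sq_eq_toeplitz_hankel[OF \<phi>(1) fL] \<delta>(2)
      by (simp add: power_mult_distrib algebra_simps)
    then show "nrm (hankel \<phi> f) \<le> sqrt (1 - \<delta>\<^sup>2) * nrm f"
      using \<delta>(2) by (intro power2_le_imp_le[of "nrm (hankel \<phi> f)"]) simp_all
  qed
qed

theorem left_invertible_toeplitz_iff:
  assumes \<phi>: "\<phi> \<in> Linf \<mu>" "AE \<gamma> in \<mu>. cmod (\<phi> \<gamma>) = 1"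
  shows "left_invertible_op posCone (toeplitz \<phi>) \<longleftrightarrow> (\<exists>h\<in>Hinf \<mu>. linf_norm \<mu> (\<lambda>\<gamma>. \<phi> \<gamma> - h \<gamma>) < 1)"
proof
  have "AE \<gamma> in \<mu>. cmod (\<phi> \<gamma>) \<le> 1" using \<phi>(2) by eventually_elim simp
  moreover assume "left_invertible_op posCone (toeplitz \<phi>)"
  ultimately obtain r where r: "0 \<le> r" "r < 1" "\<And>f. f \<in> H2 \<Longrightarrow> nrm (hankel \<phi> f) \<le> r * nrm f"
    by (rule hankel_bound_if_left_invertible_toeplitz[OF \<phi>(1)]) blast
  have "r < (r + 1) / 2" using r(2) by simp
  then obtain h where h: "h \<in> Hinf \<mu>" "AE \<gamma> in \<mu>. cmod (\<phi> \<gamma> - h \<gamma>) \<le> (r + 1) / 2"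
    using nehari[OF \<phi>(1) r(1) _ r(3)] by blast
  have "(\<lambda>\<gamma>. \<phi> \<gamma> - h \<gamma>) \<in> borel_measurable \<mu>"
    using Linf_measurable[OF \<phi>(1)] Linf_measurable[OF Hinf_Linf[OF h(1)]] by measurable
  then have "linf_norm \<mu> (\<lambda>\<gamma>. \<phi> \<gamma> - h \<gamma>) < 1"
    unfolding one_ereal_def using h(2) r(1,2)
    by (subst linf_norm_less_iff) (auto intro!: exI[of _ "(r + 1) / 2"])
  with h(1) show "\<exists>h\<in>Hinf \<mu>. linf_norm \<mu> (\<lambda>\<gamma>. \<phi> \<gamma> - h \<gamma>) < 1" by blast
next
  assume "\<exists>h\<in>Hinf \<mu>. linf_norm \<mu> (\<lambda>\<gamma>. \<phi> \<gamma> - h \<gamma>) < 1"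
  then obtain h where h: "h \<in> Hinf \<mu>" "linf_norm \<mu> (\<lambda>\<gamma>. \<phi> \<gamma> - h \<gamma>) < 1" by blast
  have "left_invertible_op posCone (\<lambda>g. toeplitz (\<lambda>\<gamma>. cnj (h \<gamma>)) (toeplitz \<phi> g))"
    using invertible_op_toeplitz_compose_if_near(1)[OF \<phi> h]
    by (simp add: invertible_op_iff_left_right)
  then show "left_invertible_op posCone (toeplitz \<phi>)"
    by (rule left_invertible_op_if_compose[OF bounded_op_toeplitz[OF Linf_cnj[OF Hinf_Linf[OF h(1)]]]
      bounded_op_toeplitz[OF \<phi>(1)]])
qed

theorem right_invertible_toeplitz_iff:
  assumes "\<phi> \<in> Linf \<mu>" "AE \<gamma> in \<mu>. cmod (\<phi> \<gamma>) = 1"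
  shows "right_invertible_op posCone (toeplitz \<phi>) \<longleftrightarrow>
    (\<exists>h\<in>Hinf \<mu>. linf_norm \<mu> (\<lambda>\<gamma>. cnj (\<phi> \<gamma>) - h \<gamma>) < 1)"
  unfolding right_invertible_op_iff_adjoint_left_invertible[OF adjoint_ops_toeplitz[OF assms(1)]]
  using assms by (intro left_invertible_toeplitz_iff Linf_cnj) simp_all

lemma invertible_toeplitz_cnj_if_Hinf_invertible:
  assumes \<psi>: "\<psi> \<in> Hinf \<mu>" and \<theta>: "\<theta> \<in> Hinf \<mu>" and one: "AE \<gamma> in \<mu>. \<psi> \<gamma> * \<theta> \<gamma> = 1"
  shows "invertible_op posCone (toeplitz (\<lambda>\<gamma>. cnj (\<psi> \<gamma>)))"
proof -
  have inverse: "toeplitz (\<lambda>\<gamma>. cnj (a \<gamma>)) (toeplitz (\<lambda>\<gamma>. cnj (b \<gamma>)) g) = g"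
    if "a \<in> Hinf \<mu>" "b \<in> Hinf \<mu>" "AE \<gamma> in \<mu>. a \<gamma> * b \<gamma> = 1" "g \<in> l2space posCone" for a b g
  proof -
    note ac = Linf_cnj[OF Hinf_Linf[OF that(1)]] and bc = Linf_cnj[OF Hinf_Linf[OF that(2)]]
    have "AE \<gamma> in \<mu>. cnj (a \<gamma>) * cnj (b \<gamma>) = 1"
      using that(3) by eventually_elim (metis complex_cnj_mult complex_cnj_one)
    then show ?thesis
      using toeplitz_cnj_Hinf_compose[OF that(1) bc that(4)]
          toeplitz_AE_one[OF Linf_mult[OF ac bc] _ that(4)] by simp
  qed
  have "AE \<gamma> in \<mu>. \<theta> \<gamma> * \<psi> \<gamma> = 1" using one by (simp add: mult.commute)
  with one show ?thesis
    unfolding invertible_op_def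
    using bounded_op_toeplitz[OF Linf_cnj[OF Hinf_Linf[OF \<psi>]]]
      bounded_op_toeplitz[OF Linf_cnj[OF Hinf_Linf[OF \<theta>]]]
      inverse \<psi> \<theta>
    by blast
qed

lemma Hinf_inverse_if_invertible_toeplitz:
  assumes h: "h \<in> Hinf \<mu>" and inv: "invertible_op posCone (toeplitz h)"
    and \<delta>: "\<delta> > 0" "AE \<gamma> in \<mu>. \<delta> \<le> cmod (h \<gamma>)"
  obtains f where "f \<in> Hinf \<mu>" "AE \<gamma> in \<mu>. h \<gamma> * f \<gamma> = 1"
proof -
  obtain g where "g \<in> l2space posCone" "toeplitz h g = ft (\<lambda>\<gamma>. 1)"
    using inv bounded_op_l2space fourier_H2_l2space[OF one_H2] unfolding invertible_op_def by blast
  then obtain f where f: "f \<in> H2" "toeplitz h (ft f) = ft (\<lambda>\<gamma>. 1)" by (metis l2space_posConeE)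
  have one: "AE \<gamma> in \<mu>. h \<gamma> * f \<gamma> = 1"
    using f(2) unfolding toeplitz_Hinf_fourier[OF h f(1)]
      L2_fourier_eq_iff[OF H2_L2[OF Hinf_mult_H2[OF h f(1)]] one_L2] .
  then have "AE \<gamma> in \<mu>. cmod (f \<gamma>) \<le> 1 / \<delta>"
    using \<delta>(2)
  proof eventually_elim
    case (elim \<gamma>)
    have "\<delta> * cmod (f \<gamma>) \<le> cmod (h \<gamma>) * cmod (f \<gamma>)" using elim(2) by (intro mult_right_mono) auto
    also have "\<dots> = 1" using arg_cong[OF elim(1), of cmod] by (simp add: norm_mult)
    finally show ?case using \<delta>(1) by (simp add: field_simps)
  qed
  then have "f \<in> Linf \<mu>" by (rule LinfI[OF L2_measurable[OF H2_L2[OF f(1)]]])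
  with f(1) have "f \<in> Hinf \<mu>" by (simp add: Hinf_iff)
  then show ?thesis using one by (rule that)
qed

lemma Hinf_invertible_if_near_invertible_symbol:
  assumes \<phi>: "\<phi> \<in> Linf \<mu>" "AE \<gamma> in \<mu>. cmod (\<phi> \<gamma>) = 1" and inv: "invertible_op posCone (toeplitz \<phi>)"
    and h: "h \<in> Hinf \<mu>" and near: "linf_norm \<mu> (\<lambda>\<gamma>. \<phi> \<gamma> - h \<gamma>) < 1"
  obtains f where "f \<in> Hinf \<mu>" "AE \<gamma> in \<mu>. h \<gamma> * f \<gamma> = 1"
proof -
  note hL = Hinf_Linf[OF h]
  note [measurable] = Linf_measurable[OF \<phi>(1)] Linf_measurable[OF hL]
  have "invertible_op posCone (toeplitz (\<lambda>\<gamma>. cnj (\<phi> \<gamma>)))"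
    using inv unfolding invertible_op_adjoint[OF adjoint_ops_toeplitz[OF \<phi>(1)]] .
  then have inv_h: "invertible_op posCone (toeplitz h)"
    by (rule invertible_op_cancel_left[OF _ bounded_op_toeplitz[OF hL]
      invertible_op_toeplitz_compose_if_near(2)[OF \<phi> h near]])
  have "(\<lambda>\<gamma>. \<phi> \<gamma> - h \<gamma>) \<in> borel_measurable \<mu>" by measurable
  then obtain \<rho> where \<rho>: "\<rho> < 1" "AE \<gamma> in \<mu>. cmod (\<phi> \<gamma> - h \<gamma>) \<le> \<rho>"
    using near unfolding one_ereal_def by (subst (asm) linf_norm_less_iff) auto
  have lower: "AE \<gamma> in \<mu>. 1 - \<rho> \<le> cmod (h \<gamma>)"
    using \<rho>(2) \<phi>(2)
  proof eventually_elim
    case (elim \<gamma>)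
    then show ?case using norm_triangle_ineq2[of "\<phi> \<gamma>" "h \<gamma>"] by linarith
  qed
  show ?thesis
    by (rule Hinf_inverse_if_invertible_toeplitz[OF h inv_h _ lower]) (use \<rho>(1) that in auto)
qed

theorem invertible_toeplitz_iff:
  assumes \<phi>: "\<phi> \<in> Linf \<mu>" "AE \<gamma> in \<mu>. cmod (\<phi> \<gamma>) = 1"
  shows "invertible_op posCone (toeplitz \<phi>) \<longleftrightarrow>
    (\<exists>\<psi>\<in>Hinf \<mu>. (\<exists>\<theta>\<in>Hinf \<mu>. AE \<gamma> in \<mu>. \<psi> \<gamma> * \<theta> \<gamma> = 1) \<and> linf_norm \<mu> (\<lambda>\<gamma>. \<phi> \<gamma> - \<psi> \<gamma>) < 1)"
proof
  assume inv: "invertible_op posCone (toeplitz \<phi>)"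
  then obtain \<psi> where \<psi>: "\<psi> \<in> Hinf \<mu>" "linf_norm \<mu> (\<lambda>\<gamma>. \<phi> \<gamma> - \<psi> \<gamma>) < 1"
    unfolding invertible_op_iff_left_right left_invertible_toeplitz_iff[OF \<phi>] by blast
  with Hinf_invertible_if_near_invertible_symbol[OF \<phi> inv \<psi>]
  show "\<exists>\<psi>\<in>Hinf \<mu>. (\<exists>\<theta>\<in>Hinf \<mu>. AE \<gamma> in \<mu>. \<psi> \<gamma> * \<theta> \<gamma> = 1) \<and> linf_norm \<mu> (\<lambda>\<gamma>. \<phi> \<gamma> - \<psi> \<gamma>) < 1"
    by blast
next
  assume "\<exists>\<psi>\<in>Hinf \<mu>. (\<exists>\<theta>\<in>Hinf \<mu>. AE \<gamma> in \<mu>. \<psi> \<gamma> * \<theta> \<gamma> = 1) \<and> linf_norm \<mu> (\<lambda>\<gamma>. \<phi> \<gamma> - \<psi> \<gamma>) < 1"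
  then obtain \<psi> \<theta> where \<psi>: "\<psi> \<in> Hinf \<mu>" "linf_norm \<mu> (\<lambda>\<gamma>. \<phi> \<gamma> - \<psi> \<gamma>) < 1"
    and \<theta>: "\<theta> \<in> Hinf \<mu>" "AE \<gamma> in \<mu>. \<psi> \<gamma> * \<theta> \<gamma> = 1" by blast
  show "invertible_op posCone (toeplitz \<phi>)"
    by (rule invertible_op_cancel_left[OF invertible_toeplitz_cnj_if_Hinf_invertible[OF \<psi>(1) \<theta>]
      bounded_op_toeplitz[OF \<phi>(1)] invertible_op_toeplitz_compose_if_near(1)[OF \<phi> \<psi>]])
qed

end

theorem mainTheorem10:
  fixes \<mu> :: "('x::linordered_ab_group_add \<Rightarrow> complex) measure"
    and k :: "'x \<Rightarrow> complex"
    and kc :: "('x \<Rightarrow> complex) \<Rightarrow> complex"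
  assumes "haar \<mu>"
    and "k \<in> l2space UNIV"
    and "is_check \<mu> k kc"
    and "kc \<in> Linf \<mu>"
    and "AE \<gamma> in \<mu>. cmod (kc \<gamma>) = 1"
  shows "(left_invertible_op posCone (wienerHopf k) \<longleftrightarrow> dist_Hinf \<mu> kc < 1)
       \<and> (right_invertible_op posCone (wienerHopf k) \<longleftrightarrow> dist_Hinf \<mu> (\<lambda>\<gamma>. cnj (kc \<gamma>)) < 1)
       \<and> (invertible_op posCone (wienerHopf k) \<longleftrightarrow>
            (\<exists>\<psi>\<in>Hinf \<mu>. (\<exists>\<phi>\<in>Hinf \<mu>. AE \<gamma> in \<mu>. \<psi> \<gamma> * \<phi> \<gamma> = 1)
                 \<and> linf_norm \<mu> (\<lambda>\<gamma>. kc \<gamma> - \<psi> \<gamma>) < 1))"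
proof -
  interpret haar_measure \<mu> by unfold_locales (rule assms(1))
  have "wienerHopf k g = toeplitz kc g" if "g \<in> l2space posCone" for g
    using wienerHopf_eq_toeplitz[OF assms(4) _ that] is_check_imp_fourier[OF assms(3)] by simp
  then have "left_invertible_op posCone (wienerHopf k) = left_invertible_op posCone (toeplitz kc)"
    "right_invertible_op posCone (wienerHopf k) = right_invertible_op posCone (toeplitz kc)"
    "invertible_op posCone (wienerHopf k) = invertible_op posCone (toeplitz kc)"
    by (rule left_invertible_op_cong right_invertible_op_cong invertible_op_cong; simp)+
  then show ?thesis
    using left_invertible_toeplitz_iff right_invertible_toeplitz_iff invertible_toeplitz_iff
        assms(4,5)
    by (simp add: dist_Hinf_less_iff)
qed

end
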